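(* Let $A\in\mathbb{C}^{n\times n}$, $B\in\mathbb{C}^{n\times m}$, $\Pi\in\mathbb{C}^{(n+m)\times(n+m)}$ be complex matrices and let $\varpi_1,\varpi_2$ be real scalars. Define $$\Omega:=\{\omega\in\mathbb{R} : (\omega-\varpi_1)(\omega-\varpi_2)\le 0\}.$$ Consider the system $$\dot x(t)=Ax(t)+Bu(t),\qquad t\in[0,\infty),$$ where $x(t)\in\mathbb{C}^n$ is the state and $u(t)\in\mathbb{C}^m$ is the input. Assume that $(A,B)$ is controllable, $\Pi$ is Hermitian, and $\Omega$ has nonempty interior. Then the following statements are equivalent. (i) The frequency domain inequality $$\begin{bmatrix}(j\omega I-A)^{-1}B\\ I\end{bmatrix}^*\Pi\begin{bmatrix}(j\omega I-A)^{-1}B\\ I\end{bmatrix}\le 0$$ holds for all $\omega\in\Omega$ such that $\det(j\omega I-A)\ne 0$. (ii) The time domain inequality $$\int_0^\infty\begin{bmatrix} x \\ u \end{bmatrix}^*\Pi\begin{bmatrix} x \\ u \end{bmatrix}dt\le 0$$ holds for all solutions of the system with $u\in\mathcal{L}_2[0,\infty)$ such that $x(0)=0$, $x\in\mathcal{L}_2[0,\infty)$ and $$\operatorname{He}\int_0^\infty(\varpi_1x+j\dot x)(\varpi_2x+j\dot x)^*\,dt\le 0.$$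
   Context: $j$ is the imaginary unit, $M^*$ is the conjugate transpose of a matrix (or vector) $M$, and $\operatorname{He}(M):=(M+M^* )/2$ for a square matrix $M$. For Hermitian matrices, $M\le 0$ means that $M$ is negative semidefinite. $\mathcal{L}_2[0,\infty)$ is the set of square integrable (vector-valued) functions on $[0,\infty)$. Solutions $x$ are (locally) absolutely continuous functions satisfying the differential equation almost everywhere. *)

theory Defs
  imports "HOL-Analysis.Analysis"
begin

definition conj_transpose :: "complex^'n^'m \<Rightarrow> complex^'m^'n" where
  "conj_transpose M = (\<chi> i k. cnj (M $ k $ i))"

definition hermitian :: "complex^'n^'n \<Rightarrow> bool" where
  "hermitian M \<longleftrightarrow> conj_transpose M = M"

definition He :: "complex^'n^'n \<Rightarrow> complex^'n^'n" where
  "He M = (1/2) *\<^sub>R (M + conj_transpose M)"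

(* v^* M v *)
definition quad_form :: "complex^'n^'n \<Rightarrow> complex^'n \<Rightarrow> complex" where
  "quad_form M v = (\<Sum>i\<in>UNIV. \<Sum>k\<in>UNIV. cnj (v $ i) * M $ i $ k * v $ k)"

(* Passing to the real part below loses nothing. *)
lemma quad_form_hermitian_real:
  assumes "hermitian M"
  shows "quad_form M v \<in> \<real>"
proof -
  have M: "cnj (M $ k $ i) = M $ i $ k" for i k
    using assms unfolding hermitian_def conj_transpose_def
    by (metis vec_lambda_beta)
  have "cnj (quad_form M v)
      = (\<Sum>i\<in>UNIV. \<Sum>k\<in>UNIV. cnj (v $ k) * M $ k $ i * v $ i)"
    by (simp add: quad_form_def M mult_ac)
  also have "\<dots> = quad_form M v"
    unfolding quad_form_def by (rule sum.swap)
  finally show ?thesis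
    by (simp add: Reals_cnj_iff)
qed

definition neg_semidef :: "complex^'n^'n \<Rightarrow> bool" where
  "neg_semidef M \<longleftrightarrow> hermitian M \<and> (\<forall>v. Re (quad_form M v) \<le> 0)"

(* v w^* *)
definition outer :: "complex^'n \<Rightarrow> complex^'m \<Rightarrow> complex^'m^'n" where
  "outer v w = (\<chi> i k. v $ i * cnj (w $ k))"

(* The block column [x; y].  With 'a = complex it stacks vectors; with
   'a = complex^'k it stacks matrices, since a matrix is a vector of rows. *)
definition stack :: "'a^'n \<Rightarrow> 'a^'m \<Rightarrow> 'a^('n + 'm)" where
  "stack x y = (\<chi> r. case r of Inl i \<Rightarrow> x $ i | Inr k \<Rightarrow> y $ k)"

definition freq_set :: "real \<Rightarrow> real \<Rightarrow> real set" where
  "freq_set w1 w2 = {w. (w - w1) * (w - w2) \<le> 0}"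

(* A pair (s, t) in D stands for the interval from s to t. *)
definition abs_continuous_on_interval ::
    "real \<Rightarrow> real \<Rightarrow> (real \<Rightarrow> 'a::real_normed_vector) \<Rightarrow> bool" where
  "abs_continuous_on_interval a b f \<longleftrightarrow>
    (\<forall>\<epsilon>>0. \<exists>\<delta>>0. \<forall>D. finite D
        \<and> (\<forall>(s, t)\<in>D. a \<le> s \<and> s \<le> t \<and> t \<le> b)
        \<and> pairwise (\<lambda>(s, t) (s', t'). {s<..<t} \<inter> {s'<..<t'} = {}) D
        \<and> (\<Sum>(s, t)\<in>D. t - s) < \<delta>
      \<longrightarrow> (\<Sum>(s, t)\<in>D. norm (f t - f s)) < \<epsilon>)"

definition L2_on :: "real set \<Rightarrow> (real \<Rightarrow> 'a::euclidean_space) \<Rightarrow> bool" where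
  "L2_on S f \<longleftrightarrow> f \<in> borel_measurable (lebesgue_on S)
     \<and> integrable (lebesgue_on S) (\<lambda>t. (norm (f t))\<^sup>2)"

(* x is locally absolutely continuous on the interval S and x' = A x + B u
   holds almost everywhere on S. *)
definition solution_on ::
    "real set \<Rightarrow> complex^'n^'n \<Rightarrow> complex^'m^'n
      \<Rightarrow> (real \<Rightarrow> complex^'m) \<Rightarrow> (real \<Rightarrow> complex^'n) \<Rightarrow> bool" where
  "solution_on S A B u x \<longleftrightarrow>
     (\<forall>a b. {a..b} \<subseteq> S \<longrightarrow> abs_continuous_on_interval a b x)
     \<and> (AE t in lebesgue_on S.
          (x has_vector_derivative (A *v x t + B *v u t)) (at t within S))"

(* Every state can be steered to every other state in finite time. *)
definition controllable :: "complex^'n^'n \<Rightarrow> complex^'m^'n \<Rightarrow> bool" where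
  "controllable A B \<longleftrightarrow>
     (\<forall>x0 x1. \<exists>T>0. \<exists>u x. L2_on {0..T} u \<and> solution_on {0..T} A B u x
        \<and> x 0 = x0 \<and> x T = x1)"

(* The block column [(j w I - A)^-1 B; I]; meaningful if det (j w I - A) is nonzero. *)
definition freq_response ::
    "complex^'n^'n \<Rightarrow> complex^'m^'n \<Rightarrow> real \<Rightarrow> complex^'m^('n + 'm)" where
  "freq_response A B w =
     stack (matrix_inv (mat (\<i> * of_real w) - A) ** B) (mat 1)"

(* w x + j x', where x' is the one-sided derivative at the endpoint 0. *)
definition shifted_deriv :: "real \<Rightarrow> (real \<Rightarrow> complex^'n) \<Rightarrow> real \<Rightarrow> complex^'n" where
  "shifted_deriv w x t =
     of_real w *s x t + \<i> *s vector_derivative x (at t within {0..})"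

end

theory Submission
  imports Defs
begin

text \<open>Let \<open>\<eta>\<close> be the joint vector of state and input, \<open>G\<close> the matrix that extracts the state from it and \<open>F\<close> the block row
of \<open>A\<close> and \<open>B\<close>, so that trajectories satisfy \<open>(G \<eta>)' = F \<eta>\<close>. A vector \<open>\<eta>\<close> is called harmonic at frequency \<open>w\<close> if
\<open>F \<eta> = \<i> w G \<eta>\<close>. Both inequalities are equivalent to a third statement: the quadratic form of \<open>P\<close> is nonpositive
at all vectors that are harmonic at some frequency of the interval.

For the frequency domain inequality this is a matter of continuity (\<open>frequency_inequality_iff_harmonic\<close>). Where the
resolvent exists, the harmonic vectors are the range of the frequency response; the finitely many other
frequencies are limits of these, and by controllability the harmonic vectors depend continuously on the frequency
(\<open>harmonic_perturbation\<close>).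

The time domain inequality depends on a trajectory only through its Gram matrix \<open>H\<close>, the integral of \<open>\<eta> \<eta>\<^sup>*\<close>: the
integral of the quadratic form is the trace of \<open>P H\<close>, the constraint is an inequality for \<open>H\<close>, and since the state
vanishes at zero and at infinity, \<open>F H G\<^sup>* + G H F\<^sup>* = 0\<close>. The key point is that these conditions force \<open>H\<close> to be a sum
of matrices \<open>e e\<^sup>*\<close> with \<open>e\<close> harmonic at a frequency of the interval
(\<open>trace_nonpos_if_constrained_vectors_nonpos\<close>); the summands come from generalized eigenvectors of a pair of
Hermitian matrices. Hence the trace is nonpositive as soon as the form is nonpositive at harmonic vectors.

Conversely, a harmonic vector at which the form is positive is turned into a trajectory violating the time domain
inequality (\<open>harmonic_nonpos_if_trajectories_nonpos\<close>): steer from the origin to its state, run through many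
periods and steer back. The transients are bounded, but they may point in any direction and could destroy the
constraint, to which a single harmonic vector contributes a matrix of rank at most one. This is repaired by
inserting periods of harmonic vectors at interior frequencies whose states span the state space
(\<open>span_harmonic_states\<close>); their contribution is negative definite and dominates the transients in the long run.\<close>

section \<open>Absolutely continuous functions\<close>

definition nonoverlapping_intervals :: "real \<Rightarrow> real \<Rightarrow> (real \<times> real) set \<Rightarrow> bool" where
  "nonoverlapping_intervals a b D \<longleftrightarrow> finite D
     \<and> (\<forall>(s, t)\<in>D. a \<le> s \<and> s \<le> t \<and> t \<le> b)
     \<and> pairwise (\<lambda>(s, t) (s', t'). {s<..<t} \<inter> {s'<..<t'} = {}) D"

lemma abs_continuous_iff:
  "abs_continuous_on_interval a b f \<longleftrightarrow>
    (\<forall>\<epsilon>>0. \<exists>\<delta>>0. \<forall>D. nonoverlapping_intervals a b D \<longrightarrow> (\<Sum>(s, t)\<in>D. t - s) < \<delta>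
      \<longrightarrow> (\<Sum>(s, t)\<in>D. norm (f t - f s)) < \<epsilon>)"
  unfolding abs_continuous_on_interval_def nonoverlapping_intervals_def by (simp add: conj_assoc imp_conjL)

lemma abs_continuousE:
  assumes "abs_continuous_on_interval a b f" and "\<epsilon> > 0"
  obtains \<delta> where "\<delta> > 0"
    and "\<And>D. nonoverlapping_intervals a b D \<Longrightarrow> (\<Sum>(s, t)\<in>D. t - s) < \<delta>
      \<Longrightarrow> (\<Sum>(s, t)\<in>D. norm (f t - f s)) < \<epsilon>"
  using assms unfolding abs_continuous_iff by blast

lemma nonoverlapping_intervalsD:
  assumes "nonoverlapping_intervals a b D"
  shows "finite D" and "(s, t) \<in> D \<Longrightarrow> a \<le> s \<and> s \<le> t \<and> t \<le> b"
    and "(s, t) \<in> D \<Longrightarrow> (s', t') \<in> D \<Longrightarrow> (s, t) \<noteq> (s', t') \<Longrightarrow> {s<..<t} \<inter> {s'<..<t'} = {}"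
  using assms unfolding nonoverlapping_intervals_def pairwise_def by blast+

lemma nonoverlapping_intervalsI:
  assumes "finite D" and "\<And>s t. (s, t) \<in> D \<Longrightarrow> a \<le> s \<and> s \<le> t \<and> t \<le> b"
    and "\<And>s t s' t'. (s, t) \<in> D \<Longrightarrow> (s', t') \<in> D \<Longrightarrow> (s, t) \<noteq> (s', t') \<Longrightarrow> {s<..<t} \<inter> {s'<..<t'} = {}"
  shows "nonoverlapping_intervals a b D"
  using assms unfolding nonoverlapping_intervals_def pairwise_def by blast

text \<open>Lipschitz functions of two absolutely continuous functions are absolutely continuous. Linear images,
products and functions with bounded derivative are all instances.\<close>

lemma abs_continuous_dominated:
  fixes f :: "real \<Rightarrow> 'a::real_normed_vector" and h :: "real \<Rightarrow> 'b::real_normed_vector"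
    and F :: "real \<Rightarrow> 'c::real_normed_vector"
  assumes f: "abs_continuous_on_interval a b f" and h: "abs_continuous_on_interval a b h"
    and bound: "\<And>s t. \<lbrakk>a \<le> s; s \<le> t; t \<le> b\<rbrakk> \<Longrightarrow>
      norm (F t - F s) \<le> K * (norm (f t - f s) + norm (h t - h s))"
  shows "abs_continuous_on_interval a b F"
  unfolding abs_continuous_iff
proof (intro allI impI)
  fix e :: real assume e: "e > 0"
  define C where "C = \<bar>K\<bar> + 1"
  have C: "C > 0" "K \<le> C" by (auto simp: C_def)
  from e C have e': "e / (2 * C) > 0" by simp
  obtain d1 where d1: "d1 > 0"
    "\<And>D. nonoverlapping_intervals a b D \<Longrightarrow> (\<Sum>(s, t)\<in>D. t - s) < d1 \<Longrightarrow> (\<Sum>(s, t)\<in>D. norm (f t - f s)) < e / (2 * C)"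
    using abs_continuousE[OF f e'] by blast
  obtain d2 where d2: "d2 > 0"
    "\<And>D. nonoverlapping_intervals a b D \<Longrightarrow> (\<Sum>(s, t)\<in>D. t - s) < d2 \<Longrightarrow> (\<Sum>(s, t)\<in>D. norm (h t - h s)) < e / (2 * C)"
    using abs_continuousE[OF h e'] by blast
  show "\<exists>\<delta>>0. \<forall>D. nonoverlapping_intervals a b D \<longrightarrow> (\<Sum>(s, t)\<in>D. t - s) < \<delta>
      \<longrightarrow> (\<Sum>(s, t)\<in>D. norm (F t - F s)) < e"
  proof (rule exI[of _ "min d1 d2"], intro conjI allI impI)
    fix D assume D0: "nonoverlapping_intervals a b D" and len: "(\<Sum>(s, t)\<in>D. t - s) < min d1 d2"
    note D = nonoverlapping_intervalsD[OF D0]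
    have "norm (F t - F s) \<le> C * (norm (f t - f s) + norm (h t - h s))" if "(s,t) \<in> D" for s t
    proof -
      have "norm (F t - F s) \<le> K * (norm (f t - f s) + norm (h t - h s))"
        using D(2)[OF that] by (intro bound) auto
      also have "\<dots> \<le> C * (norm (f t - f s) + norm (h t - h s))"
        using C by (intro mult_right_mono) auto
      finally show ?thesis .
    qed
    then have "(\<Sum>(s, t)\<in>D. norm (F t - F s)) \<le> (\<Sum>(s, t)\<in>D. C * (norm (f t - f s) + norm (h t - h s)))"
      by (intro sum_mono) auto
    also have "\<dots> = C * ((\<Sum>(s, t)\<in>D. norm (f t - f s)) + (\<Sum>(s, t)\<in>D. norm (h t - h s)))"
      by (simp add: sum.distrib sum_distrib_left case_prod_unfold distrib_left)
    also have "\<dots> < C * (e / (2 * C) + e / (2 * C))"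
      using D0 len C d1 d2 by (intro mult_strict_left_mono add_strict_mono) auto
    also have "\<dots> = e" using C by (simp add: field_simps)
    finally show "(\<Sum>(s, t)\<in>D. norm (F t - F s)) < e" .
  qed (use d1 d2 in auto)
qed

lemma abs_continuous_ident: "abs_continuous_on_interval a b (\<lambda>t::real. t)"
  unfolding abs_continuous_iff
proof (intro allI impI)
  fix e :: real assume e: "e > 0"
  have "(\<Sum>(s, t)\<in>D. norm (t - s)) = (\<Sum>(s, t)\<in>D. t - s)"
    if "nonoverlapping_intervals a b D" for D
    using nonoverlapping_intervalsD(2)[OF that] by (intro sum.cong) auto
  with e show "\<exists>\<delta>>0. \<forall>D. nonoverlapping_intervals a b D \<longrightarrow> (\<Sum>(s, t)\<in>D. t - s) < \<delta>
      \<longrightarrow> (\<Sum>(s, t)\<in>D. norm (t - s)) < e" by auto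
qed

lemma abs_continuous_bounded_linear:
  assumes L: "bounded_linear L" and f: "abs_continuous_on_interval a b f"
  shows "abs_continuous_on_interval a b (\<lambda>t. L (f t))"
proof -
  interpret bounded_linear L by fact
  obtain K where K: "K > 0" "\<And>x. norm (L x) \<le> norm x * K" using pos_bounded by blast
  show ?thesis
  proof (rule abs_continuous_dominated[OF f f])
    fix s t
    have "norm (L (f t) - L (f s)) \<le> norm (f t - f s) * K" using K(2)[of "f t - f s"] by (simp add: diff)
    also have "\<dots> \<le> K * (norm (f t - f s) + norm (f t - f s))" using K(1) by (simp add: algebra_simps)
    finally show "norm (L (f t) - L (f s)) \<le> K * (norm (f t - f s) + norm (f t - f s))" .
  qed
qed

lemma abs_continuous_bounded_derivative:
  fixes f :: "real \<Rightarrow> 'a::real_normed_vector"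
  assumes "\<And>t. t \<in> {a..b} \<Longrightarrow> (f has_vector_derivative f' t) (at t within {a..b})"
    and "\<And>t. t \<in> {a..b} \<Longrightarrow> norm (f' t) \<le> K"
  shows "abs_continuous_on_interval a b f"
proof (rule abs_continuous_dominated[OF abs_continuous_ident abs_continuous_ident])
  fix s t assume st: "a \<le> s" "s \<le> t" "t \<le> b"
  have "norm (f t - f s) \<le> K * norm (t - s)"
  proof (rule differentiable_bound[of "{a..b}" f "\<lambda>t h. h *\<^sub>R f' t"])
    show "(f has_derivative (\<lambda>h. h *\<^sub>R f' x)) (at x within {a..b})" if "x \<in> {a..b}" for x
      using assms(1)[OF that] by (simp add: has_vector_derivative_def)
    show "onorm (\<lambda>h. h *\<^sub>R f' x) \<le> K" if "x \<in> {a..b}" for x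
      using assms(2)[OF that] by (intro onorm_le) (simp add: mult.commute[of K] mult_left_mono)
  qed (use st in auto)
  also have "\<dots> \<le> K * (norm (t - s) + norm (t - s))"
  proof -
    have "0 \<le> K" using order_trans[OF norm_ge_zero assms(2)[of s]] st by auto
    then show ?thesis by (intro mult_left_mono) auto
  qed
  finally show "norm (f t - f s) \<le> K * (norm (t - s) + norm (t - s))" .
qed

text \<open>Clamping and shifting the time argument preserves absolute continuity. Joining two trajectories end to
end is therefore a sum of clamped trajectories, with no need to cut intervals at the joint.\<close>

lemma abs_continuous_comp_mono:
  fixes f :: "real \<Rightarrow> 'a::real_normed_vector" and \<psi> :: "real \<Rightarrow> real"
  assumes f: "abs_continuous_on_interval c d f"
    and mono: "\<And>s t. s \<le> t \<Longrightarrow> \<psi> s \<le> \<psi> t"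
    and lip: "\<And>s t. s \<le> t \<Longrightarrow> \<psi> t - \<psi> s \<le> t - s"
    and range: "\<And>t. a \<le> t \<Longrightarrow> t \<le> b \<Longrightarrow> c \<le> \<psi> t \<and> \<psi> t \<le> d"
  shows "abs_continuous_on_interval a b (\<lambda>t. f (\<psi> t))"
  unfolding abs_continuous_iff
proof (intro allI impI)
  fix e :: real assume e: "e > 0"
  obtain \<delta> where d: "\<delta> > 0"
    "\<And>D. nonoverlapping_intervals c d D \<Longrightarrow> (\<Sum>(s, t)\<in>D. t - s) < \<delta> \<Longrightarrow> (\<Sum>(s, t)\<in>D. norm (f t - f s)) < e"
    using abs_continuousE[OF f e] by blast
  show "\<exists>\<delta>>0. \<forall>D. nonoverlapping_intervals a b D \<longrightarrow> (\<Sum>(s, t)\<in>D. t - s) < \<delta>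
      \<longrightarrow> (\<Sum>(s, t)\<in>D. norm (f (\<psi> t) - f (\<psi> s))) < e"
  proof (rule exI[of _ \<delta>], intro conjI allI impI)
    fix D assume D0: "nonoverlapping_intervals a b D" and len: "(\<Sum>(s, t)\<in>D. t - s) < \<delta>"
    note D = nonoverlapping_intervalsD[OF D0]
    \<comment> \<open>Intervals that \<open>\<psi>\<close> collapses contribute nothing and are dropped, since their images may coincide.\<close>
    define D' where "D' = {(s, t)\<in>D. \<psi> s < \<psi> t}"
    define m where "m = (\<lambda>(s, t). (\<psi> s, \<psi> t))"
    have sub: "D' \<subseteq> D" by (auto simp: D'_def)
    then have fin: "finite D'" using D(1) by (rule finite_subset)
    have sep: "{\<psi> s<..<\<psi> t} \<inter> {\<psi> s'<..<\<psi> t'} = {}"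
      if "(s, t) \<in> D'" "(s', t') \<in> D'" "(s, t) \<noteq> (s', t')" for s t s' t'
    proof -
      have lt: "s < t" "s' < t'" using that mono by (force simp: D'_def not_le[symmetric])+
      have "{s<..<t} \<inter> {s'<..<t'} = {}"
        using D(3)[of s t s' t'] that sub by blast
      then have "t \<le> s' \<or> t' \<le> s"
      proof -
        have "\<not> max s s' < min t t'"
        proof
          assume "max s s' < min t t'"
          then obtain z where "max s s' < z" "z < min t t'" using dense by blast
          then have "z \<in> {s<..<t} \<inter> {s'<..<t'}" by auto
          with \<open>{s<..<t} \<inter> {s'<..<t'} = {}\<close> show False by blast
        qed
        with lt show ?thesis by auto
      qed
      then have "\<psi> t \<le> \<psi> s' \<or> \<psi> t' \<le> \<psi> s" using mono by blast
      then show ?thesis by auto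
    qed
    have inj: "inj_on m D'"
    proof (rule inj_onI, rule ccontr)
      fix p q assume pq: "p \<in> D'" "q \<in> D'" "m p = m q" "p \<noteq> q"
      obtain s t s' t' where [simp]: "p = (s, t)" "q = (s', t')" by fastforce
      have "{\<psi> s<..<\<psi> t} = {}" using sep[of s t s' t'] pq by (auto simp: m_def)
      with pq show False by (auto simp: D'_def)
    qed
    have "(\<Sum>(s, t)\<in>D. norm (f (\<psi> t) - f (\<psi> s))) = (\<Sum>(s, t)\<in>D'. norm (f (\<psi> t) - f (\<psi> s)))"
    proof (rule sum.mono_neutral_right)
      show "\<forall>p\<in>D - D'. (case p of (s, t) \<Rightarrow> norm (f (\<psi> t) - f (\<psi> s))) = 0"
      proof safe
        fix s t assume "(s, t) \<in> D" "(s, t) \<notin> D'"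
        moreover from this have "\<psi> s \<le> \<psi> t" using D(2) mono by blast
        ultimately have "\<psi> s = \<psi> t" by (auto simp: D'_def)
        then show "norm (f (\<psi> t) - f (\<psi> s)) = 0" by simp
      qed
    qed (use D(1) sub in auto)
    also have "\<dots> = (\<Sum>(s, t)\<in>m ` D'. norm (f t - f s))"
      by (subst sum.reindex[OF inj]) (auto simp: m_def case_prod_unfold)
    also have "\<dots> < e"
    proof (rule d(2))
      show "nonoverlapping_intervals c d (m ` D')"
      proof (rule nonoverlapping_intervalsI)
        show "finite (m ` D')" using fin by simp
        show "c \<le> u \<and> u \<le> v \<and> v \<le> d" if uv: "(u, v) \<in> m ` D'" for u v
        proof -
          obtain s t where "(s, t) \<in> D'" "u = \<psi> s" "v = \<psi> t" using uv by (auto simp: m_def)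
          moreover have "a \<le> s \<and> s \<le> t \<and> t \<le> b" using D(2) sub calculation by blast
          ultimately show ?thesis using range[of s] range[of t] mono[of s t] by auto
        qed
        show "{u<..<v} \<inter> {u'<..<v'} = {}"
          if uv: "(u, v) \<in> m ` D'" "(u', v') \<in> m ` D'" "(u, v) \<noteq> (u', v')" for u v u' v'
        proof -
          obtain s t where st: "(s, t) \<in> D'" "u = \<psi> s" "v = \<psi> t" using uv by (auto simp: m_def)
          obtain s' t' where st': "(s', t') \<in> D'" "u' = \<psi> s'" "v' = \<psi> t'" using uv by (auto simp: m_def)
          show ?thesis using sep[OF st(1) st'(1)] uv(3) st st' by auto
        qed
      qed
      have "(\<Sum>(s, t)\<in>m ` D'. t - s) = (\<Sum>(s, t)\<in>D'. \<psi> t - \<psi> s)"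
        by (subst sum.reindex[OF inj]) (auto simp: m_def case_prod_unfold)
      also have "\<dots> \<le> (\<Sum>(s, t)\<in>D'. t - s)"
        using D(2) sub lip by (intro sum_mono) fastforce
      also have "\<dots> \<le> (\<Sum>(s, t)\<in>D. t - s)"
        using D(1,2) sub by (intro sum_mono2) fastforce+
      finally show "(\<Sum>(s, t)\<in>m ` D'. t - s) < \<delta>" using len by linarith
    qed
    finally show "(\<Sum>(s, t)\<in>D. norm (f (\<psi> t) - f (\<psi> s))) < e" .
  qed (use d in auto)
qed

lemma abs_continuous_imp_continuous:
  fixes f :: "real \<Rightarrow> 'a::real_normed_vector"
  assumes f: "abs_continuous_on_interval a b f"
  shows "continuous_on {a..b} f"
  unfolding continuous_on_iff
proof (intro ballI allI impI)
  fix x e :: real assume x: "x \<in> {a..b}" and e: "e > 0"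
  obtain d where d: "d > 0"
    "\<And>D. nonoverlapping_intervals a b D \<Longrightarrow> (\<Sum>(s, t)\<in>D. t - s) < d \<Longrightarrow> (\<Sum>(s, t)\<in>D. norm (f t - f s)) < e"
    using abs_continuousE[OF f e] by blast
  have "dist (f x') (f x) < e" if "x' \<in> {a..b}" "dist x' x < d" for x'
    using d(2)[of "{(min x x', max x x')}"] that x
    by (auto simp: nonoverlapping_intervals_def dist_norm norm_minus_commute min_def max_def abs_if split: if_splits)
  with d(1) show "\<exists>d>0. \<forall>x'\<in>{a..b}. dist x' x < d \<longrightarrow> dist (f x') (f x) < e" by blast
qed

lemma abs_continuous_bilinear:
  fixes f :: "real \<Rightarrow> 'a::real_normed_vector" and h :: "real \<Rightarrow> 'b::real_normed_vector"
  assumes bil: "bounded_bilinear pr"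
    and f: "abs_continuous_on_interval a b f" and h: "abs_continuous_on_interval a b h"
  shows "abs_continuous_on_interval a b (\<lambda>t. pr (f t) (h t))"
proof -
  interpret bounded_bilinear pr by fact
  obtain K where K: "K > 0" "\<And>x y. norm (pr x y) \<le> norm x * norm y * K" using pos_bounded by blast
  have "compact (f ` {a..b})" "compact (h ` {a..b})"
    using abs_continuous_imp_continuous[OF f] abs_continuous_imp_continuous[OF h]
    by (auto intro: compact_continuous_image)
  then obtain M1 M2 where M: "\<And>t. t \<in> {a..b} \<Longrightarrow> norm (f t) \<le> M1" "\<And>t. t \<in> {a..b} \<Longrightarrow> norm (h t) \<le> M2"
    by (metis compact_imp_bounded bounded_iff imageI)
  show ?thesis
  proof (rule abs_continuous_dominated[OF f h])
    fix s t assume st: "a \<le> s" "s \<le> t" "t \<le> b"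
    have nn: "0 \<le> norm (f t)" "0 \<le> norm (h s)" by auto
    have M': "norm (f t) \<le> \<bar>M1\<bar>" "norm (h s) \<le> \<bar>M2\<bar>" using M(1)[of t] M(2)[of s] st by auto
    have "pr (f t) (h t) - pr (f s) (h s) = pr (f t) (h t - h s) + pr (f t - f s) (h s)"
      by (simp add: diff_left diff_right)
    then have "norm (pr (f t) (h t) - pr (f s) (h s))
        \<le> norm (f t) * norm (h t - h s) * K + norm (f t - f s) * norm (h s) * K"
      using norm_triangle_mono K(2) by metis
    also have "\<dots> \<le> \<bar>M1\<bar> * norm (h t - h s) * K + norm (f t - f s) * \<bar>M2\<bar> * K"
      using M' K by (intro add_mono mult_right_mono mult_left_mono) auto
    also have "\<dots> \<le> (\<bar>M1\<bar> + \<bar>M2\<bar>) * norm (h t - h s) * K + norm (f t - f s) * (\<bar>M1\<bar> + \<bar>M2\<bar>) * K"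
      using K by (intro add_mono mult_right_mono mult_left_mono) auto
    also have "\<dots> = (\<bar>M1\<bar> + \<bar>M2\<bar>) * K * (norm (f t - f s) + norm (h t - h s))"
      by (simp add: algebra_simps)
    finally show "norm (pr (f t) (h t) - pr (f s) (h s)) \<le> (\<bar>M1\<bar> + \<bar>M2\<bar>) * K * (norm (f t - f s) + norm (h t - h s))" .
  qed
qed

text \<open>An absolutely continuous function is the integral of its derivative even though the derivative exists only
off a null set \<open>N\<close>. In the gauge integral one proof treats both parts: a tag outside \<open>N\<close> gets a ball on
which the difference quotient is good, and a tag in \<open>N\<close> gets an open set of small measure containing \<open>N\<close>, so
that absolute continuity bounds the total increment over the intervals with such tags.\<close>

lemma abs_continuous_fundamental_theorem:
  fixes f :: "real \<Rightarrow> 'a::banach"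
  assumes ab: "a \<le> b" and ac: "abs_continuous_on_interval a b f" and N: "negligible N"
    and deriv: "\<And>t. t \<in> {a..b} - N \<Longrightarrow> (f has_vector_derivative g t) (at t within {a..b})"
  shows "(g has_integral (f b - f a)) {a..b}"
proof -
  \<comment> \<open>The values of the derivative on the null set do not affect the integral; zero is convenient.\<close>
  define g0 where "g0 t = (if t \<in> N then 0 else g t)" for t
  have "(g0 has_integral (f b - f a)) (cbox a b)"
    unfolding has_integral
  proof (intro allI impI)
    fix e :: real assume e: "e > 0"
    then have e2: "e / 2 > 0" by simp
    obtain \<delta> where \<delta>: "\<delta> > 0"
    "\<And>D. nonoverlapping_intervals a b D \<Longrightarrow> (\<Sum>(s, t)\<in>D. t - s) < \<delta> \<Longrightarrow> (\<Sum>(s, t)\<in>D. norm (f t - f s)) < e / 2"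
    using abs_continuousE[OF ac e2] by blast
    obtain U where U: "open U" "N \<subseteq> U" "U \<in> lmeasurable" "measure lebesgue U < \<delta>"
    proof -
      have Ns: "N \<in> sets lebesgue" using N by (simp add: negligible_imp_sets)
      obtain T where T: "open T" "N \<subseteq> T" "T - N \<in> lmeasurable" "emeasure lebesgue (T - N) < ennreal \<delta>"
        using sets_lebesgue_outer_open[OF Ns \<delta>(1)] by metis
      have NL: "N \<in> lmeasurable" "measure lebesgue N = 0"
        using N by (auto simp: negligible_iff_measure)
      have "T = (T - N) \<union> N" using T by auto
      then have "T \<in> lmeasurable" using T NL by (metis fmeasurable.Un)
      moreover have "measure lebesgue T = measure lebesgue (T - N)"
        using T NL measurable_measure_Diff[of T lebesgue N] calculation Ns by simp
      moreover have "measure lebesgue (T - N) < \<delta>"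
        using T(4) \<delta>(1) by (simp add: emeasure_eq_measure2[OF T(3)] ennreal_less_iff)
      ultimately show ?thesis using T that by auto
    qed
    define c where "c = e / (2 * (b - a + 1))"
    have c: "c > 0" using e ab by (simp add: c_def)
    have "\<forall>x. \<exists>d>0. x \<in> {a..b} - N \<longrightarrow>
         (\<forall>y\<in>{a..b}. norm (y-x) < d \<longrightarrow> norm (f y - f x - (y-x) *\<^sub>R g x) \<le> c * norm (y-x))"
      using deriv[unfolded has_vector_derivative_def has_derivative_within_alt] c by blast
    then obtain d where d: "\<And>x. 0 < d x"
                 "\<And>x y. \<lbrakk>x \<in> {a..b} - N; y \<in> {a..b}; norm (y-x) < d x\<rbrakk>
                        \<Longrightarrow> norm (f y - f x - (y-x) *\<^sub>R g x) \<le> c * norm (y-x)"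
      by metis
    define \<gamma> where "\<gamma> x = (if x \<in> N then U else ball x (d x))" for x
    have gauge: "gauge \<gamma>" using U d(1) by (auto simp: gauge_def \<gamma>_def)
    show "\<exists>\<gamma>. gauge \<gamma> \<and> (\<forall>p. p tagged_division_of (cbox a b) \<and> \<gamma> fine p \<longrightarrow>
            norm ((\<Sum>(x, k)\<in>p. measure lborel k *\<^sub>R g0 x) - (f b - f a)) < e)"
    proof (rule exI[of _ \<gamma>], intro conjI gauge allI impI)
      fix p assume "p tagged_division_of (cbox a b) \<and> \<gamma> fine p"
      then have p: "p tagged_division_of (cbox a b)" and fine: "\<gamma> fine p" by auto
      have finp: "finite p" using p by blast
      have box: "\<exists>u v. K = {u..v} \<and> u \<le> v \<and> x \<in> K \<and> a \<le> u \<and> v \<le> b" if xK: "(x, K) \<in> p" for x K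
      proof -
        obtain u v where "K = cbox u v" "x \<in> K" "K \<subseteq> cbox a b"
          using tagged_division_ofD(2,3,4)[OF p xK] that by metis
        then show ?thesis by (intro exI[of _ u] exI[of _ v]) auto
      qed
      have fba: "f b - f a = (\<Sum>(x,K)\<in>p. f(Sup K) - f(Inf K))" and 
        ba: "b - a = (\<Sum>(x,K)\<in>p. Sup K - Inf K)"
        using additive_tagged_division_1[where f= f] additive_tagged_division_1[where f= "\<lambda>x. x"] ab p by auto
      define q where "q = {(x, K)\<in>p. x \<in> N}"
      \<comment> \<open>Degenerate intervals are discarded so that the endpoints determine the tagged interval.\<close>
      define q' where "q' = {(x, K)\<in>q. Inf K < Sup K}"
      have qp: "q \<subseteq> p" "q' \<subseteq> q" by (auto simp: q_def q'_def)
      have finq: "finite q" "finite q'" using finp qp finite_subset by metis+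
      have sepK: "interior K \<inter> interior K' = {}" if "(x, K) \<in> p" "(x', K') \<in> p" "(x, K) \<noteq> (x', K')" for x K x' K'
        using tagged_division_ofD(5)[OF p that] .
      have good: "norm (\<Sum>(x,K)\<in>p - q. measure lborel K *\<^sub>R g0 x - (f(Sup K) - f(Inf K))) \<le> c * (b - a)"
      proof -
        have "norm (\<Sum>(x,K)\<in>p - q. measure lborel K *\<^sub>R g0 x - (f(Sup K) - f(Inf K)))
            \<le> (\<Sum>(x,K)\<in>p - q. c * (Sup K - Inf K))"
        proof (rule sum_norm_le, safe)
          fix x K assume xK: "(x, K) \<in> p" "(x, K) \<notin> q"
          obtain u v where k: "K = {u..v}" "u \<le> v" "x \<in> K" "a \<le> u" "v \<le> b" using box xK by metis
          have xN: "x \<notin> N" using xK by (auto simp: q_def)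
          have x: "x \<in> {a..b} - N" using k xN by auto
          have ball: "K \<subseteq> ball x (d x)" using fineD[OF fine xK(1)] xN by (simp add: \<gamma>_def)
          have uv: "u \<in> ball x (d x)" "v \<in> ball x (d x)" using subsetD[OF ball, of u] subsetD[OF ball, of v] k by auto
          have "norm ((v - u) *\<^sub>R g x - (f v - f u)) = norm (f u - f x - (u - x) *\<^sub>R g x - (f v - f x - (v - x) *\<^sub>R g x))"
            by (auto simp: algebra_simps)
          also have "\<dots> \<le> norm (f u - f x - (u - x) *\<^sub>R g x) + norm (f v - f x - (v - x) *\<^sub>R g x)"
            by (rule norm_triangle_ineq4)
          also have "\<dots> \<le> c * norm (u - x) + c * norm (v - x)"
            using d(2)[OF x, of u] d(2)[OF x, of v] k uv by (intro add_mono) (auto simp: dist_norm norm_minus_commute)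
          also have "\<dots> = c * (v - u)" using k by (auto simp: algebra_simps)
          finally show "norm (measure lborel K *\<^sub>R g0 x - (f(Sup K) - f(Inf K))) \<le> c * (Sup K - Inf K)"
            using k xN by (simp add: g0_def)
        qed
        also have "\<dots> \<le> (\<Sum>(x,K)\<in>p. c * (Sup K - Inf K))"
          using c box by (intro sum_mono2) (use finp in \<open>force+\<close>)
        also have "\<dots> = c * (b - a)" unfolding ba by (simp add: sum_distrib_left case_prod_unfold)
        finally show ?thesis .
      qed
      have bad: "norm (\<Sum>(x,K)\<in>q. measure lborel K *\<^sub>R g0 x - (f(Sup K) - f(Inf K))) < e / 2"
      proof -
        define m where "m = (\<lambda>(x::real, K::real set). (Inf K, Sup K))"
        have inj: "inj_on m q'"
        proof (rule inj_onI, rule ccontr)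
          fix r s assume rs: "r \<in> q'" "s \<in> q'" "m r = m s" "r \<noteq> s"
          obtain x K x' K' where [simp]: "r = (x, K)" "s = (x', K')" by fastforce
          obtain u v where k: "K = {u..v}" "u \<le> v" using box[of x K] rs qp by auto
          obtain u' v' where k': "K' = {u'..v'}" "u' \<le> v'" using box[of x' K'] rs qp by auto
          have "interior K \<inter> interior K' = {}" using sepK[of x K x' K'] rs qp by auto
          then show False using rs k k' by (auto simp: m_def q'_def)
        qed
        have "norm (\<Sum>(x,K)\<in>q. measure lborel K *\<^sub>R g0 x - (f(Sup K) - f(Inf K)))
            \<le> (\<Sum>(x,K)\<in>q. norm (f(Sup K) - f(Inf K)))"
          by (rule sum_norm_le) (auto simp: q_def g0_def norm_minus_commute)
        also have "\<dots> = (\<Sum>(x,K)\<in>q'. norm (f(Sup K) - f(Inf K)))"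
        proof (rule sum.mono_neutral_right)
          show "\<forall>r\<in>q - q'. (case r of (x, K) \<Rightarrow> norm (f (Sup K) - f (Inf K))) = 0"
          proof safe
            fix x K assume "(x, K) \<in> q" "(x, K) \<notin> q'"
            moreover from this obtain u v where "K = {u..v}" "u \<le> v" using box[of x K] qp by auto
            ultimately show "norm (f (Sup K) - f (Inf K)) = 0" by (auto simp: q'_def)
          qed
        qed (use finq qp in auto)
        also have "\<dots> = (\<Sum>(s, t)\<in>m ` q'. norm (f t - f s))"
          by (subst sum.reindex[OF inj]) (auto simp: m_def case_prod_unfold)
        also have "\<dots> < e / 2"
        proof (rule \<delta>(2))
          show "nonoverlapping_intervals a b (m ` q')"
          proof (rule nonoverlapping_intervalsI)
            show "finite (m ` q')" using finq by simp
            show "a \<le> s \<and> s \<le> t \<and> t \<le> b" if st: "(s, t) \<in> m ` q'" for s t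
            proof -
              obtain x K where xK: "(x, K) \<in> q'" "s = Inf K" "t = Sup K" using st unfolding m_def by force
              obtain u v where "K = {u..v}" "u \<le> v" "a \<le> u" "v \<le> b" using box[of x K] qp xK by auto
              with xK show ?thesis by auto
            qed
            show "{s<..<t} \<inter> {s'<..<t'} = {}"
              if st: "(s, t) \<in> m ` q'" "(s', t') \<in> m ` q'" "(s, t) \<noteq> (s', t')" for s t s' t'
            proof -
              obtain x K where xK: "(x, K) \<in> q'" "s = Inf K" "t = Sup K" using st unfolding m_def by force
              obtain x' K' where xK': "(x', K') \<in> q'" "s' = Inf K'" "t' = Sup K'" using st unfolding m_def by force
              obtain u v where k: "K = {u..v}" "u \<le> v" using box[of x K] xK qp by auto
              obtain u' v' where k': "K' = {u'..v'}" "u' \<le> v'" using box[of x' K'] xK' qp by auto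
              have "interior K \<inter> interior K' = {}" using sepK[of x K x' K'] xK xK' st qp by auto
              with xK xK' k k' show ?thesis by auto
            qed
          qed
          have div: "(snd ` q') division_of \<Union>(snd ` q')"
          proof (rule partial_division_of_tagged_division)
            show "q' tagged_partial_division_of cbox a b"
              using p qp unfolding tagged_division_of_def by (meson tagged_partial_division_subset subset_trans)
          qed
          have injs: "inj_on snd q'"
          proof (rule inj_onI)
            fix r s assume "r \<in> q'" "s \<in> q'" "snd r = snd s"
            then have "m r = m s" by (simp add: m_def case_prod_unfold)
            with inj \<open>r \<in> q'\<close> \<open>s \<in> q'\<close> show "r = s" by (simp add: inj_on_eq_iff)
          qed
          have "(\<Sum>(s, t)\<in>m ` q'. t - s) = (\<Sum>(x, K)\<in>q'. Sup K - Inf K)"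
            by (subst sum.reindex[OF inj]) (auto simp: m_def case_prod_unfold)
          also have "\<dots> = (\<Sum>(x, K)\<in>q'. measure lebesgue K)"
          proof (intro sum.cong refl, safe)
            fix x K assume "(x, K) \<in> q'"
            then obtain u v where "K = {u..v}" "u \<le> v" using box[of x K] qp by auto
            then show "Sup K - Inf K = measure lebesgue K" by (simp add: measure_completion)
          qed
          also have "\<dots> = (\<Sum>K\<in>snd ` q'. measure lebesgue K)"
            by (subst sum.reindex[OF injs]) (auto simp: case_prod_unfold)
          also have "\<dots> = measure lebesgue (\<Union>(snd ` q'))"
            using content_division[OF div] by simp
          also have "\<dots> \<le> measure lebesgue U"
          proof (rule measure_mono_fmeasurable)
            show "\<Union>(snd ` q') \<subseteq> U"
              using fine qp by (force simp: fine_def \<gamma>_def q_def q'_def)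
            show "\<Union>(snd ` q') \<in> sets lebesgue"
              using div by (meson fmeasurableD lmeasurable_division)
          qed (use U in auto)
          finally show "(\<Sum>(s, t)\<in>m ` q'. t - s) < \<delta>" using U by linarith
        qed
        finally show ?thesis .
      qed
      have "(\<Sum>(x, K)\<in>p. measure lborel K *\<^sub>R g0 x) - (f b - f a) 
          = (\<Sum>(x,K)\<in>p. measure lborel K *\<^sub>R g0 x - (f(Sup K) - f(Inf K)))"
        unfolding fba by (simp add: sum_subtractf case_prod_unfold)
      also have "\<dots> = (\<Sum>(x,K)\<in>p - q. measure lborel K *\<^sub>R g0 x - (f(Sup K) - f(Inf K)))
                    + (\<Sum>(x,K)\<in>q. measure lborel K *\<^sub>R g0 x - (f(Sup K) - f(Inf K)))"
        using sum.subset_diff[OF qp(1) finp] .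
      finally have "norm ((\<Sum>(x, K)\<in>p. measure lborel K *\<^sub>R g0 x) - (f b - f a)) < c * (b - a) + e / 2"
        using good bad norm_triangle_ineq by (smt (verit))
      also have "c * (b - a) \<le> e / 2" using e ab by (simp add: c_def field_simps)
      finally show "norm ((\<Sum>(x, K)\<in>p. measure lborel K *\<^sub>R g0 x) - (f b - f a)) < e" by simp
    qed
  qed
  then have "(g0 has_integral (f b - f a)) {a..b}" by simp
  moreover have "g t = g0 t" if "t \<in> {a..b} - N" for t using that by (simp add: g0_def)
  ultimately show ?thesis by (rule has_integral_spike[OF N, rotated])
qed

lemma AE_lebesgue_onE:
  assumes "AE t in lebesgue_on S. P t" and "S \<in> sets lebesgue"
  obtains N where "negligible N" and "\<And>t. t \<in> S - N \<Longrightarrow> P t"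
proof -
  have "AE t in lebesgue. t \<in> S \<longrightarrow> P t"
    using assms by (subst (asm) AE_restrict_space_iff) auto
  then obtain N where "{t \<in> space lebesgue. \<not> (t \<in> S \<longrightarrow> P t)} \<subseteq> N" "N \<in> null_sets lebesgue"
    by (auto simp: eventually_ae_filter)
  then show ?thesis using that by (auto simp: negligible_iff_null_sets)
qed

lemma AE_lebesgue_onI:
  assumes "negligible N" and "\<And>t. t \<in> S - N \<Longrightarrow> P t" and "S \<in> sets lebesgue"
  shows "AE t in lebesgue_on S. P t"
proof -
  have "AE t in lebesgue. t \<notin> N" using assms(1) by (simp add: negligible_iff_null_sets AE_not_in)
  then have "AE t in lebesgue. t \<in> S \<longrightarrow> P t" by eventually_elim (use assms(2) in auto)
  with assms(3) show ?thesis by (subst AE_restrict_space_iff) auto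
qed

lemma solution_onE:
  assumes "solution_on S A B u x" and "S \<in> sets lebesgue"
  obtains N where "negligible N"
    and "\<And>t. t \<in> S - N \<Longrightarrow> (x has_vector_derivative (A *v x t + B *v u t)) (at t within S)"
proof -
  have "AE t in lebesgue_on S. (x has_vector_derivative (A *v x t + B *v u t)) (at t within S)"
    using assms(1) by (simp add: solution_on_def)
  from this assms(2) show ?thesis by (rule AE_lebesgue_onE) (rule that)
qed

section \<open>Hermitian forms\<close>

text \<open>The Hermitian inner product, conjugate linear in its first argument; its real part is the inner
product of the underlying real Euclidean space.\<close>

definition hinner :: "complex^'n \<Rightarrow> complex^'n \<Rightarrow> complex" where
  "hinner a b = (\<Sum>i\<in>UNIV. cnj (a $ i) * b $ i)"

lemma hinner_add_left: "hinner (a + b) c = hinner a c + hinner b c"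
  and hinner_add_right: "hinner a (b + c) = hinner a b + hinner a c"
  and hinner_diff_left: "hinner (a - b) c = hinner a c - hinner b c"
  and hinner_diff_right: "hinner a (b - c) = hinner a b - hinner a c"
  and hinner_scale_left: "hinner (z *s a) c = cnj z * hinner a c"
  and hinner_scale_right: "hinner a (z *s c) = z * hinner a c"
  and hinner_zero_left [simp]: "hinner 0 c = 0"
  and hinner_zero_right [simp]: "hinner a 0 = 0"
  by (simp_all add: hinner_def algebra_simps sum.distrib sum_subtractf sum_distrib_left)

lemma hinner_commute: "hinner b a = cnj (hinner a b)"
  by (simp add: hinner_def mult.commute)

lemma hinner_self: "hinner a a = of_real ((norm a)\<^sup>2)"
proof -
  have "hinner a a = (\<Sum>i\<in>UNIV. of_real ((norm (a $ i))\<^sup>2))"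
    unfolding hinner_def by (intro sum.cong refl) (metis complex_norm_square mult.commute of_real_power)
  also have "\<dots> = of_real ((norm a)\<^sup>2)"
    by (simp add: norm_vec_def L2_set_def sum_nonneg)
  finally show ?thesis .
qed

lemma Re_hinner: "Re (hinner a b) = a \<bullet> b"
  by (simp add: hinner_def inner_vec_def inner_complex_def)

lemma conj_transpose_nth [simp]: "conj_transpose M $ i $ k = cnj (M $ k $ i)"
  by (simp add: conj_transpose_def)

lemma conj_transpose_conj_transpose [simp]: "conj_transpose (conj_transpose M) = M"
  by (simp add: vec_eq_iff)

lemma conj_transpose_mult: "conj_transpose (M ** N) = conj_transpose N ** conj_transpose M"
  by (simp add: vec_eq_iff matrix_matrix_mult_def mult.commute)

lemma hinner_adjoint: "hinner a (M *v b) = hinner (conj_transpose M *v a) b"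
proof -
  have "hinner a (M *v b) = (\<Sum>i\<in>UNIV. \<Sum>k\<in>UNIV. cnj (a $ i) * M $ i $ k * b $ k)"
    by (simp add: hinner_def matrix_vector_mult_def sum_distrib_left mult.assoc)
  also have "\<dots> = (\<Sum>k\<in>UNIV. \<Sum>i\<in>UNIV. cnj (a $ i) * M $ i $ k * b $ k)"
    by (rule sum.swap)
  also have "\<dots> = hinner (conj_transpose M *v a) b"
    by (simp add: hinner_def matrix_vector_mult_def sum_distrib_right sum_distrib_left mult_ac)
  finally show ?thesis .
qed

lemma scaleR_eq_scale: "t *\<^sub>R w = of_real t *s (w :: complex^'n)"
  unfolding vec_eq_iff by (simp add: complex_eq_iff)

lemma norm_scale: "norm (z *s v) = norm z * norm v" for v :: "complex^'n"
  unfolding norm_vec_def by (simp add: norm_mult L2_set_right_distrib)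

lemma power2_norm_vec: "(norm v)\<^sup>2 = (\<Sum>i\<in>UNIV. (norm (v $ i))\<^sup>2)"
  by (simp add: norm_vec_def L2_set_def sum_nonneg)

lemma mat_mult_vec: "mat z *v v = z *s v" for v :: "complex^'n"
  by (simp add: vec_eq_iff matrix_vector_mult_def mat_def if_distribR if_distrib[of "\<lambda>a. a * _"] cong: if_cong)

lemma mat_matrix_mult_nth: "(mat z ** M) $ i $ k = z * M $ i $ k" for M :: "complex^'k^'n"
  by (simp add: matrix_matrix_mult_def mat_def if_distribR if_distrib[of "\<lambda>a. a * _"] cong: if_cong)

lemma matrix_sub_ldistrib: "M ** (N - L) = M ** N - M ** (L :: complex^'k^'n)"
  by (simp add: vec_eq_iff matrix_matrix_mult_def right_diff_distrib sum_subtractf)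

lemma matrix_sub_rdistrib: "(N - L) ** M = N ** M - (L :: complex^'k^'n) ** M"
  by (simp add: vec_eq_iff matrix_matrix_mult_def left_diff_distrib sum_subtractf)

lemma matrix_add_rdistrib: "(N + L) ** M = N ** M + (L :: complex^'k^'n) ** M"
  by (simp add: vec_eq_iff matrix_matrix_mult_def distrib_right sum.distrib)

lemma linear_sandwich: "linear (\<lambda>X. M ** X ** (N :: complex^'l^'k))" for M :: "complex^'j^'i"
proof (rule linearI)
  fix X Y :: "complex^'k^'j" and r :: real
  show "M ** (X + Y) ** N = M ** X ** N + M ** Y ** N"
    by (simp add: matrix_add_ldistrib matrix_add_rdistrib)
  have "M ** (r *\<^sub>R X) = r *\<^sub>R (M ** X)" "(r *\<^sub>R Y) ** N = r *\<^sub>R (Y ** N)" for Y :: "complex^'k^'i"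
    by (simp_all add: vec_eq_iff matrix_matrix_mult_def scaleR_sum_right)
  then show "M ** (r *\<^sub>R X) ** N = r *\<^sub>R (M ** X ** N)" by simp
qed

lemma quad_form_eq_hinner: "quad_form M v = hinner v (M *v v)"
  by (simp add: quad_form_def hinner_def matrix_vector_mult_def sum_distrib_left mult.assoc)

lemma quad_form_congruence:
  "quad_form (conj_transpose F ** M ** F) v = quad_form M (F *v v)"
  by (simp add: quad_form_eq_hinner matrix_vector_mul_assoc[symmetric] hinner_adjoint)

lemma hermitian_hinner: "hermitian M \<Longrightarrow> hinner a (M *v b) = hinner (M *v a) b"
  by (simp add: hinner_adjoint hermitian_def)

lemma quad_form_add: "hermitian M \<Longrightarrow>
  Re (quad_form M (a + b)) = Re (quad_form M a) + 2 * Re (hinner a (M *v b)) + Re (quad_form M b)"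
proof -
  assume h: "hermitian M"
  have "hinner b (M *v a) = cnj (hinner a (M *v b))"
    using h by (metis hinner_commute hermitian_hinner)
  then show ?thesis
    by (simp add: quad_form_eq_hinner matrix_vector_right_distrib hinner_add_left hinner_add_right)
qed

lemma quad_form_scale: "quad_form M (z *s v) = of_real ((norm z)\<^sup>2) * quad_form M v"
  proof -
  have "quad_form M (z *s v) = (z * cnj z) * quad_form M v"
    by (simp add: quad_form_eq_hinner vector_scalar_commute hinner_scale_left hinner_scale_right)
  then show ?thesis by (simp only: complex_norm_square)
qed

lemma quad_form_scaleR: "quad_form (t *\<^sub>R M) v = of_real t * quad_form M v"
  by (simp add: quad_form_def sum_distrib_left scaleR_conv_of_real[where 'a = complex] mult_ac)

lemma quad_form_diff: "quad_form (M - N) v = quad_form M v - quad_form N v"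
  by (simp add: quad_form_eq_hinner matrix_vector_mult_diff_rdistrib hinner_diff_right)

lemma quad_form_conj_transpose: "quad_form (conj_transpose M) v = cnj (quad_form M v)"
  unfolding quad_form_eq_hinner by (metis hinner_adjoint hinner_commute conj_transpose_conj_transpose)

lemma quad_form_sandwich:
  "quad_form (M ** H ** conj_transpose L) q = hinner (conj_transpose M *v q) (H *v (conj_transpose L *v q))"
  by (simp add: quad_form_eq_hinner matrix_vector_mul_assoc[symmetric] hinner_adjoint[of q M])

lemma outer_nth [simp]: "outer v w $ i $ k = v $ i * cnj (w $ k)"
  by (simp add: outer_def)

lemma outer_mult_vec: "outer v w *v z = hinner w z *s v"
  by (simp add: vec_eq_iff matrix_vector_mult_def hinner_def sum_distrib_left sum_distrib_right mult_ac)

lemma outer_congruence: "outer (M *v v) (N *v w) = M ** outer v w ** conj_transpose N"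
  by (simp add: vec_eq_iff matrix_vector_mult_def matrix_matrix_mult_def sum_distrib_left
      sum_distrib_right mult_ac)

lemma norm_outer: "norm (outer v w) = norm v * norm w"
proof -
  have "norm (vec_lambda (\<lambda>k. cnj (w $ k))) = norm w" by (simp add: norm_vec_def)
  moreover have "outer v w $ i = v $ i *s vec_lambda (\<lambda>k. cnj (w $ k))" for i by (simp add: vec_eq_iff)
  ultimately have "norm (outer v w $ i) = norm (v $ i) * norm w" for i by (simp add: norm_scale)
  then show ?thesis by (simp add: norm_vec_def[of "outer v w"] norm_vec_def[of v] L2_set_left_distrib)
qed

lemma quad_form_outer: "quad_form (outer v w) z = cnj (hinner v z) * hinner w z"
  by (simp add: quad_form_eq_hinner outer_mult_vec hinner_scale_right hinner_commute[of v z] mult.commute)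

lemma trace_mult_outer: "trace (P ** outer v v) = quad_form P v"
  by (simp add: trace_def matrix_matrix_mult_def quad_form_def mult_ac)

lemma continuous_on_quad_form [continuous_intros]: "continuous_on S (\<lambda>v. quad_form M v)"
  unfolding quad_form_def by (intro continuous_intros)

lemma hermitian_outer: "hermitian (outer v v)"
  by (simp add: hermitian_def vec_eq_iff mult.commute)

lemma hermitian_congruence: "hermitian M \<Longrightarrow> hermitian (F ** M ** conj_transpose F)"
  by (simp add: hermitian_def conj_transpose_mult matrix_mul_assoc)

lemma hermitian_diff: "hermitian M \<Longrightarrow> hermitian N \<Longrightarrow> hermitian (M - N)"
  by (simp add: hermitian_def vec_eq_iff)

lemma quad_form_sandwich_commute:
  assumes "hermitian H"
  shows "Re (quad_form (M ** H ** conj_transpose L) q) = Re (quad_form (L ** H ** conj_transpose M) q)"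
proof -
  have "conj_transpose (M ** H ** conj_transpose L) = L ** H ** conj_transpose M"
    using assms by (simp add: conj_transpose_mult hermitian_def matrix_mul_assoc)
  then show ?thesis by (metis quad_form_conj_transpose cnj.sel(1))
qed

lemma neg_semidef_He_iff: "neg_semidef (He M) \<longleftrightarrow> (\<forall>v. Re (quad_form M v) \<le> 0)"
proof -
  have "hermitian (He M)" by (simp add: hermitian_def He_def vec_eq_iff add.commute)
  moreover have "Re (quad_form (He M) v) = Re (quad_form M v)" for v
  proof -
    have "He M *v v = of_real (1/2) *s (M *v v + conj_transpose M *v v)"
      by (simp add: He_def vec_eq_iff matrix_vector_mult_def distrib_left distrib_right sum.distrib sum_distrib_left sum_divide_distrib scaleR_conv_of_real[where 'a = complex])
    then have "quad_form (He M) v = of_real (1/2) * (quad_form M v + quad_form (conj_transpose M) v)"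
      by (simp only: quad_form_eq_hinner hinner_scale_right hinner_add_right)
    then have "quad_form (He M) v = of_real (1/2) * (quad_form M v + cnj (quad_form M v))"
      by (simp only: quad_form_conj_transpose)
    then show ?thesis by (simp only: complex_add_cnj) simp
  qed
  ultimately show ?thesis by (simp add: neg_semidef_def)
qed

definition pos_semidef :: "complex^'n^'n \<Rightarrow> bool" where
  "pos_semidef M \<longleftrightarrow> hermitian M \<and> (\<forall>v. 0 \<le> Re (quad_form M v))"

text \<open>At a zero \<open>p\<close> of the nonnegative form, moving from \<open>p\<close> a small distance in the direction \<open>- K p\<close> would make the
form negative unless \<open>K p\<close> vanishes.\<close>

lemma pos_semidef_kernel:
  assumes K: "pos_semidef K" and p: "Re (quad_form K p) = 0"
  shows "K *v p = 0"
proof (rule ccontr)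
  assume "K *v p \<noteq> 0"
  define z where "z = K *v p"
  have h: "hermitian K" using K by (simp add: pos_semidef_def)
  define q where "q = Re (quad_form K z)"
  have q: "q \<ge> 0" using K by (simp add: pos_semidef_def q_def)
  define n where "n = (norm z)\<^sup>2"
  have n: "n > 0" using \<open>K *v p \<noteq> 0\<close> by (simp add: n_def z_def)
  \<comment> \<open>Small enough for the linear term to dominate the quadratic one; the summand 1 covers \<open>q = 0\<close>.\<close>
  define t where "t = n / (q + 1)"
  have t: "t > 0" using n q by (simp add: t_def)
  have "hinner p (K *v z) = of_real n"
    using hermitian_hinner[OF h, of p z] by (simp only: z_def[symmetric] hinner_self n_def)
  then have "hinner p (K *v (of_real (- t) *s z)) = of_real (- t * n)"
    by (simp only: vector_scalar_commute hinner_scale_right of_real_mult)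
  then have "Re (quad_form K (p + of_real (- t) *s z)) = - 2 * t * n + t\<^sup>2 * q"
    using quad_form_add[OF h, of p "of_real (- t) *s z"] p quad_form_scale[of K "of_real (- t)" z]
    by (simp add: q_def del: of_real_minus)
  moreover have "\<dots> = t * (t * q - 2 * n)" by (simp add: power2_eq_square algebra_simps)
  moreover have "t * q \<le> n" using n q by (simp add: t_def field_simps)
  then have "t * (t * q - 2 * n) < 0" using t n by (simp add: mult_less_0_iff)
  ultimately show False using K unfolding pos_semidef_def by (metis not_less)
qed

text \<open>By compactness of the unit sphere one multiple of the negative definite form works for all vectors.\<close>

lemma neg_def_dominates:
  fixes M1 M2 :: "complex^'n^'n"
  assumes neg: "\<And>p. p \<noteq> 0 \<Longrightarrow> Re (quad_form M1 p) < 0"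
  obtains N0 :: nat where "\<And>N p. N \<ge> N0 \<Longrightarrow> real N * Re (quad_form M1 p) + Re (quad_form M2 p) \<le> 0"
proof -
  define S where "S = sphere (0 :: complex^'n) 1"
  have S: "compact S" "S \<noteq> {}" by (simp_all add: S_def)
  have cont: "continuous_on S (\<lambda>p. Re (quad_form M p))" for M by (intro continuous_intros)
  obtain p1 where p1: "p1 \<in> S" "\<And>p. p \<in> S \<Longrightarrow> Re (quad_form M1 p) \<le> Re (quad_form M1 p1)"
    using continuous_attains_sup[OF S cont[of M1]] by blast
  obtain p2 where p2: "p2 \<in> S" "\<And>p. p \<in> S \<Longrightarrow> Re (quad_form M2 p) \<le> Re (quad_form M2 p2)"
    using continuous_attains_sup[OF S cont[of M2]] by blast
  define d where "d = - Re (quad_form M1 p1)"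
  have "p1 \<noteq> 0" using p1(1) by (auto simp: S_def)
  then have d: "d > 0" using neg[of p1] by (simp add: d_def)
  obtain N0 :: nat where N0: "Re (quad_form M2 p2) / d < real N0" using reals_Archimedean2 by blast
  have "real N * Re (quad_form M1 p) + Re (quad_form M2 p) \<le> 0" if N: "N \<ge> N0" for N p
  proof (cases "p = 0")
    case True then show ?thesis by (simp add: quad_form_eq_hinner)
  next
    case False
    define q where "q = (1 / norm p) *\<^sub>R p"
    have q: "q \<in> S" using False by (simp add: q_def S_def)
    have pq: "p = of_real (norm p) *s q" using False by (simp add: q_def scaleR_eq_scale)
    have Re_p: "Re (quad_form M p) = (norm p)\<^sup>2 * Re (quad_form M q)" for M
      by (subst pq) (simp add: quad_form_scale)
    have "real N * Re (quad_form M1 q) \<le> real N * (- d)" using p1(2)[OF q] by (intro mult_left_mono) (auto simp: d_def)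
    moreover have "Re (quad_form M2 q) \<le> real N0 * d" using p2(2)[OF q] N0 d by (simp add: pos_divide_less_eq)
    moreover have "real N0 * d \<le> real N * d" using N d by (intro mult_right_mono) auto
    ultimately have "real N * Re (quad_form M1 q) + Re (quad_form M2 q) \<le> 0" by simp
    then have "(norm p)\<^sup>2 * (real N * Re (quad_form M1 q) + Re (quad_form M2 q)) \<le> 0"
      by (intro mult_nonneg_nonpos) auto
    then show ?thesis unfolding Re_p[of M1] Re_p[of M2] by (simp add: algebra_simps)
  qed
  then show ?thesis using that by blast
qed

section \<open>Splitting a positive semidefinite matrix along a pencil\<close>

text \<open>The eigenvector maximizes the Rayleigh quotient of \<open>K1\<close> by \<open>K2\<close>. The bound by \<open>c\<close> puts the kernel of \<open>K2\<close> into that of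
\<open>K1\<close>, so the quotient may be restricted to the orthogonal complement of the kernel of \<open>K2\<close>, where the denominator is
positive. At a maximum \<open>\<mu>\<close> the form of \<open>\<mu> K2 - K1\<close> is nonnegative with a zero at the maximizer, which then lies
in its kernel.\<close>

lemma pencil_eigenvector:
  fixes K1 K2 :: "complex^'n^'n"
  assumes K1: "pos_semidef K1" and K2: "pos_semidef K2"
    and le: "\<And>v. Re (quad_form K1 v) \<le> c * Re (quad_form K2 v)" and "K1 \<noteq> 0"
  obtains p \<mu> where "0 < \<mu>" "\<mu> \<le> c" "K1 *v p = of_real \<mu> *s (K2 *v p)" "quad_form K1 p = 1"
proof -
  define q1 where "q1 v = Re (quad_form K1 v)" for v
  define q2 where "q2 v = Re (quad_form K2 v)" for v
  have h: "hermitian K1" "hermitian K2" using K1 K2 by (auto simp: pos_semidef_def)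
  have q_nn: "q1 v \<ge> 0" "q2 v \<ge> 0" for v using K1 K2 by (auto simp: pos_semidef_def q1_def q2_def)
  define U where "U = {v. K2 *v v = 0}"
  have "subspace U"
    unfolding U_def by (auto simp: subspace_def matrix_vector_right_distrib scaleR_eq_scale vector_scalar_commute)
  have U: "K1 *v y = 0" if "y \<in> U" for y
  proof -
    have "q2 y = 0" using that by (simp add: U_def q2_def quad_form_eq_hinner)
    then have "q1 y = 0" using le[of y] q_nn[of y] by (simp add: q1_def q2_def)
    then show ?thesis using pos_semidef_kernel[OF K1] by (simp add: q1_def)
  qed
  have decomp: "\<exists>w. (\<forall>y\<in>U. orthogonal w y) \<and> q1 v = q1 w \<and> q2 v = q2 w" for v
  proof -
    obtain y w where yw: "y \<in> span U" "\<And>z. z \<in> span U \<Longrightarrow> orthogonal w z" "v = y + w"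
      using orthogonal_subspace_decomp_exists by metis
    have y: "y \<in> U" using yw(1) \<open>subspace U\<close> by (metis span_eq_iff)
    have "q1 v = q1 w" "q2 v = q2 w"
      using quad_form_add[OF h(1), of w y] quad_form_add[OF h(2), of w y] U[OF y] y yw(3)
      by (simp_all add: q1_def q2_def U_def quad_form_eq_hinner add.commute)
    then show ?thesis using yw(2) by (meson span_base)
  qed
  have q2_pos: "q2 w > 0" if "\<forall>y\<in>U. orthogonal w y" "w \<noteq> 0" for w
  proof (rule ccontr)
    assume "\<not> q2 w > 0"
    then have "q2 w = 0" using q_nn(2)[of w] by simp
    then have "w \<in> U" using pos_semidef_kernel[OF K2] by (simp add: q2_def U_def)
    then show False using that by (auto simp: orthogonal_def)
  qed
  have q_scale: "q1 (of_real t *s v) = t\<^sup>2 * q1 v" "q2 (of_real t *s v) = t\<^sup>2 * q2 v" for t v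
    by (simp_all add: q1_def q2_def quad_form_scale)
  obtain v0 where "K1 *v v0 \<noteq> 0" using \<open>K1 \<noteq> 0\<close>
    by (auto simp: matrix_eq)
  then have "q1 v0 \<noteq> 0" using pos_semidef_kernel[OF K1] by (auto simp: q1_def)
  then have q1v0: "q1 v0 > 0" using q_nn(1)[of v0] by simp
  define S where "S = {w. norm w = 1 \<and> (\<forall>y\<in>U. orthogonal w y)}"
  have normalize: "(1 / norm w) *\<^sub>R w \<in> S" if "\<forall>y\<in>U. orthogonal w y" "w \<noteq> 0" for w
    using that by (simp add: S_def orthogonal_def)
  obtain w0 where w0: "\<forall>y\<in>U. orthogonal w0 y" "q1 v0 = q1 w0" "q2 v0 = q2 w0" using decomp by blast
  have "w0 \<noteq> 0" using w0 q1v0 by (auto simp: q1_def quad_form_eq_hinner)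
  then have "S \<noteq> {}" using normalize[OF w0(1)] by auto
  moreover have "compact S"
  proof -
    have "closed {w. \<forall>y\<in>U. orthogonal w y}"
    proof -
      have "{w. \<forall>y\<in>U. orthogonal w y} = (\<Inter>y\<in>U. {w. w \<bullet> y = 0})" by (auto simp: orthogonal_def)
      also have "closed \<dots>" by (intro closed_INT ballI closed_Collect_eq continuous_intros)
      finally show ?thesis .
    qed
    moreover have "S = sphere 0 1 \<inter> {w. \<forall>y\<in>U. orthogonal w y}" by (auto simp: S_def)
    ultimately show ?thesis by (simp add: compact_Int_closed)
  qed
  moreover have "continuous_on S (\<lambda>w. q1 w / q2 w)"
    unfolding q1_def q2_def
  proof (intro continuous_intros ballI)
    fix w assume "w \<in> S"
    then have "w \<noteq> 0" "\<forall>y\<in>U. orthogonal w y" by (auto simp: S_def)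
    then show "Re (quad_form K2 w) \<noteq> 0" using q2_pos[of w] by (simp add: q2_def)
  qed
  ultimately obtain w where w: "w \<in> S" "\<And>w'. w' \<in> S \<Longrightarrow> q1 w' / q2 w' \<le> q1 w / q2 w"
    using continuous_attains_sup[of S "\<lambda>w. q1 w / q2 w"] by blast
  define \<mu> where "\<mu> = q1 w / q2 w"
  have wU: "\<forall>y\<in>U. orthogonal w y" "w \<noteq> 0" using w(1) by (auto simp: S_def)
  have q2w: "q2 w > 0" using q2_pos[OF wU] .
  have bound: "q1 v \<le> \<mu> * q2 v" for v
  proof -
    obtain v' where v': "\<forall>y\<in>U. orthogonal v' y" "q1 v = q1 v'" "q2 v = q2 v'" using decomp by blast
    show ?thesis
    proof (cases "v' = 0")
      case True then show ?thesis using v' by (simp add: q1_def q2_def quad_form_eq_hinner)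
    next
      case False
      have "q1 v' / q2 v' = q1 ((1 / norm v') *\<^sub>R v') / q2 ((1 / norm v') *\<^sub>R v')"
        using False by (simp only: scaleR_eq_scale q_scale) (simp add: field_simps)
      also have "\<dots> \<le> \<mu>" using w(2)[OF normalize[OF v'(1) False]] by (simp add: \<mu>_def)
      finally show ?thesis using q2_pos[OF v'(1) False] v' by (simp add: field_simps)
    qed
  qed
  have "0 < \<mu> * q2 v0" using bound[of v0] q1v0 by linarith
  then have lam0: "\<mu> > 0" using q_nn(2)[of v0] by (simp add: zero_less_mult_iff)
  have lamc: "\<mu> \<le> c" using le[of w] q2w by (simp add: \<mu>_def q1_def q2_def field_simps)
  have q1w: "q1 w = \<mu> * q2 w" using q2w by (simp add: \<mu>_def)
  define Q where "Q = (\<chi> i k. of_real \<mu> * K2 $ i $ k - K1 $ i $ k)"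
  have Qv: "Q *v v = of_real \<mu> *s (K2 *v v) - K1 *v v" for v
    by (simp add: Q_def vec_eq_iff matrix_vector_mult_def sum_subtractf sum_distrib_left algebra_simps)
  have Qq: "Re (quad_form Q v) = \<mu> * q2 v - q1 v" for v
    by (simp add: quad_form_eq_hinner Qv hinner_diff_right hinner_scale_right q1_def q2_def)
  have "cnj (K1 $ i $ k) = K1 $ k $ i" "cnj (K2 $ i $ k) = K2 $ k $ i" for i k
    using h unfolding hermitian_def by (metis conj_transpose_nth)+
  then have "hermitian Q" by (simp add: hermitian_def Q_def vec_eq_iff)
  then have "pos_semidef Q" using bound by (simp add: pos_semidef_def Qq)
  then have "Q *v w = 0" using Qq[of w] q1w by (intro pos_semidef_kernel) auto
  then have eig: "K1 *v w = of_real \<mu> *s (K2 *v w)" by (simp add: Qv)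
  define p where "p = of_real (1 / sqrt (q1 w)) *s w"
  have q1w0: "q1 w > 0" using q1w lam0 q2w by simp
  have "K1 *v p = of_real \<mu> *s (K2 *v p)"
    using eig by (simp add: p_def vector_scalar_commute vector_smult_assoc mult.commute)
  moreover have "quad_form K1 p = 1"
  proof -
    have "quad_form K1 w = of_real (q1 w)"
      using quad_form_hermitian_real[OF h(1)] by (simp add: q1_def of_real_Re)
    then show ?thesis using q1w0
      by (simp add: p_def quad_form_scale norm_divide power_divide flip: of_real_power of_real_mult)
  qed
  ultimately show ?thesis using that lam0 lamc by blast
qed

text \<open>Completing the square: removing the rank one part along \<open>K p\<close> from a form \<open>K\<close> amounts to projecting the argument
along \<open>p\<close>. A projected form inherits every inequality of the original one.\<close>

lemma quad_form_deflation:
  assumes h: "hermitian K" and \<beta>: "of_real \<beta> * quad_form K p = 1"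
  shows "quad_form K (q - (of_real \<beta> * hinner p (K *v q)) *s p)
    = quad_form K q - of_real \<beta> * (cnj (hinner p (K *v q)) * hinner p (K *v q))"
proof -
  define \<alpha> where "\<alpha> = hinner p (K *v q)"
  have \<alpha>: "hinner q (K *v p) = cnj \<alpha>" unfolding \<alpha>_def using h by (metis hinner_commute hermitian_hinner)
  have "quad_form K (q - (of_real \<beta> * \<alpha>) *s p)
    = quad_form K q - of_real \<beta> * \<alpha> * cnj \<alpha> - of_real \<beta> * cnj \<alpha> * \<alpha>
      + of_real \<beta> * \<alpha> * cnj \<alpha> * (of_real \<beta> * quad_form K p)"
    by (simp add: quad_form_eq_hinner matrix_vector_mult_diff_distrib vector_scalar_commute
        hinner_diff_left hinner_diff_right hinner_scale_left hinner_scale_right \<alpha> \<alpha>_def[symmetric] algebra_simps)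
  then show ?thesis unfolding \<beta> by (simp add: \<alpha>_def mult_ac)
qed

text \<open>A positive semidefinite \<open>H\<close> with \<open>N H N\<^sup>* \<le> c N H G\<^sup>*\<close> and Hermitian \<open>N H G\<^sup>*\<close> is a sum of matrices \<open>e e\<^sup>*\<close>
with \<open>N e = l G e\<close> and \<open>0 \<le> l \<le> c\<close>, and on each of them the trace is the quadratic form of \<open>P\<close> at \<open>e\<close>. The
induction peels off one summand, with \<open>e = H u\<close>, lowering the rank of \<open>H\<close>.

If \<open>K1 = N H N\<^sup>*\<close> does not vanish, then \<open>u = N\<^sup>* p\<close> for an eigenvector \<open>p\<close> of the pair \<open>K1\<close>, \<open>K2 = N H G\<^sup>*\<close>; deflation
of both forms is the same projection along \<open>p\<close>, so the inequality between them survives. If \<open>K1\<close> vanishes,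
so does \<open>N H\<close>, and every vector of the range of \<open>H\<close> qualifies with \<open>l = 0\<close>.\<close>

lemma trace_nonpos_if_constrained_vectors_nonpos:
  fixes P H :: "complex^'k^'k" and N G :: "complex^'k^'n"
  assumes vec: "\<And>l v. \<lbrakk>0 \<le> l; l \<le> c; N *v v = of_real l *s (G *v v)\<rbrakk> \<Longrightarrow> Re (quad_form P v) \<le> 0"
    and c: "0 \<le> c"
    and H: "pos_semidef H"
    and herm: "hermitian (N ** H ** conj_transpose G)"
    and le: "\<And>q. Re (quad_form (N ** H ** conj_transpose N) q) \<le> c * Re (quad_form (N ** H ** conj_transpose G) q)"
  shows "Re (trace (P ** H)) \<le> 0"
  using H herm le
proof (induction "dim (range ((*v) H))" arbitrary: H rule: less_induct)
  case less
  define K1 where "K1 = N ** H ** conj_transpose N"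
  define K2 where "K2 = N ** H ** conj_transpose G"
  have hH: "hermitian H" using less.prems(1) by (simp add: pos_semidef_def)
  have hK1: "hermitian K1" using hermitian_congruence[OF hH] by (simp add: K1_def)
  have hK2: "hermitian K2" using less.prems(2) by (simp add: K2_def)
  have psd: "pos_semidef (M ** H ** conj_transpose M)" for M :: "complex^'k^'n"
    using less.prems(1) hermitian_congruence[OF hH, of M] quad_form_congruence[of "conj_transpose M" H]
    by (simp add: pos_semidef_def)
  have psdK1: "pos_semidef K1" using psd by (simp add: K1_def)
  show ?case
  proof (cases "H = 0")
    case True
    then show ?thesis by (simp add: trace_def matrix_matrix_mult_def)
  next
    case False
    have "\<exists>u l. 0 \<le> l \<and> l \<le> c \<and> quad_form H u = 1 \<and> N *v (H *v u) = of_real l *s (G *v (H *v u))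
      \<and> (\<forall>q. Re (quad_form (K1 - outer (N *v (H *v u)) (N *v (H *v u))) q)
          \<le> c * Re (quad_form (K2 - outer (N *v (H *v u)) (G *v (H *v u))) q))"
    proof (cases "K1 = 0")
      case True
      have "H *v (conj_transpose N *v q) = 0" for q
      proof (rule pos_semidef_kernel[OF less.prems(1)])
        show "Re (quad_form H (conj_transpose N *v q)) = 0"
          using quad_form_congruence[of "conj_transpose N" H q] True
          by (simp add: K1_def quad_form_eq_hinner)
      qed
      then have "H ** conj_transpose N = 0" by (simp add: matrix_eq matrix_vector_mul_assoc)
      then have "conj_transpose (H ** conj_transpose N) = 0" by (simp add: vec_eq_iff)
      then have NH: "N ** H = 0" using hH by (simp add: conj_transpose_mult hermitian_def)
      then have NHv: "N *v (H *v v) = 0" for v by (simp add: matrix_vector_mul_assoc)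
      obtain v where "H *v v \<noteq> 0" using False by (auto simp: matrix_eq)
      then have "Re (quad_form H v) \<noteq> 0" using pos_semidef_kernel[OF less.prems(1)] by blast
      then have pos: "Re (quad_form H v) > 0" using less.prems(1)
        by (metis pos_semidef_def order_less_le)
      define u where "u = of_real (1 / sqrt (Re (quad_form H v))) *s v"
      have "quad_form H v = of_real (Re (quad_form H v))"
        using quad_form_hermitian_real[OF hH] by (simp add: of_real_Re)
      then have "quad_form H u = of_real ((1 / sqrt (Re (quad_form H v)))\<^sup>2 * Re (quad_form H v))"
        unfolding u_def quad_form_scale by (metis norm_of_real power2_abs of_real_mult)
      also have "\<dots> = 1" using pos by (simp add: power_divide)
      finally have "quad_form H u = 1" .
      moreover have "outer (0 :: complex^'n) w = 0" for w :: "complex^'n" by (simp add: vec_eq_iff)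
      moreover have "Re (quad_form K1 q) \<le> c * Re (quad_form K2 q)" for q
        using less.prems(3) by (simp add: K1_def K2_def)
      ultimately show ?thesis using c by (intro exI[of _ u] exI[of _ 0]) (simp add: NHv)
    next
      case K1: False
      have "pos_semidef K2"
        unfolding pos_semidef_def
      proof (intro conjI allI hK2)
        fix v
        have "0 \<le> c * Re (quad_form K2 v)" 
          using less.prems(3)[of v] psdK1 unfolding pos_semidef_def K1_def K2_def by (meson order_trans)
        moreover have "c \<noteq> 0"
        proof
          assume "c = 0"
          then have "Re (quad_form K1 q) = 0" for q
            using less.prems(3)[of q] psdK1 unfolding pos_semidef_def K1_def
            by (metis mult_zero_left order_antisym)
          then have "K1 *v q = 0" for q using pos_semidef_kernel[OF psdK1] by blast
          with K1 show False by (auto simp: matrix_eq)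
        qed
        ultimately show "0 \<le> Re (quad_form K2 v)" using c by (simp add: zero_le_mult_iff)
      qed
      then obtain p l where pl: "0 < l" "l \<le> c" "K1 *v p = of_real l *s (K2 *v p)" "quad_form K1 p = 1"
        using pencil_eigenvector[OF psdK1 _ _ K1, of K2 c] less.prems(3) unfolding K1_def K2_def by blast
      define u where "u = conj_transpose N *v p"
      have Ne: "N *v (H *v u) = K1 *v p"
        by (simp add: u_def K1_def matrix_vector_mul_assoc matrix_mul_assoc)
      have "conj_transpose K2 = K2" using hK2 by (simp add: hermitian_def)
      then have "G ** H ** conj_transpose N = K2"
        using hH by (simp add: K2_def conj_transpose_mult hermitian_def matrix_mul_assoc)
      then have Ge: "G *v (H *v u) = K2 *v p"
        by (simp add: u_def matrix_vector_mul_assoc matrix_mul_assoc)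
      have "quad_form H u = 1"
        using quad_form_congruence[of "conj_transpose N" H p] pl(4) by (simp add: u_def K1_def)
      moreover have "Re (quad_form (K1 - outer (K1 *v p) (K1 *v p)) q)
          \<le> c * Re (quad_form (K2 - outer (K1 *v p) (K2 *v p)) q)" for q
      proof -
        define \<alpha> where "\<alpha> = hinner p (K1 *v q)"
        have \<alpha>2: "\<alpha> = of_real l * hinner p (K2 *v q)"
          unfolding \<alpha>_def hermitian_hinner[OF hK1] pl(3) hermitian_hinner[OF hK2]
          by (simp add: hinner_scale_left)
        have "of_real l * quad_form K2 p = 1" using pl(3,4) by (simp add: quad_form_eq_hinner hinner_scale_right)
        note d2 = quad_form_deflation[OF hK2 this, of q]
        have d1: "quad_form K1 (q - \<alpha> *s p) = quad_form K1 q - cnj \<alpha> * \<alpha>"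
          using quad_form_deflation[OF hK1, of 1 p q] pl(4) by (simp add: \<alpha>_def)
        have "quad_form (K1 - outer (K1 *v p) (K1 *v p)) q = quad_form K1 (q - \<alpha> *s p)"
          unfolding d1 by (simp add: quad_form_diff quad_form_outer \<alpha>_def hermitian_hinner[OF hK1])
        moreover have "quad_form (K2 - outer (K1 *v p) (K2 *v p)) q = quad_form K2 (q - \<alpha> *s p)"
          unfolding \<alpha>2 d2 by (simp add: quad_form_diff quad_form_outer pl(3) hinner_scale_left hermitian_hinner[OF hK2])
        ultimately show ?thesis using less.prems(3)[of "q - \<alpha> *s p"] by (simp add: K1_def K2_def)
      qed
      ultimately show ?thesis using pl unfolding Ne[symmetric] Ge[symmetric]
        by (intro exI[of _ u] exI[of _ l]) (auto simp: Ne Ge)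
    qed
    then obtain u l where l: "0 \<le> l" "l \<le> c" and Hu: "quad_form H u = 1"
      and ev: "N *v (H *v u) = of_real l *s (G *v (H *v u))"
      and le': "\<And>q. Re (quad_form (K1 - outer (N *v (H *v u)) (N *v (H *v u))) q)
          \<le> c * Re (quad_form (K2 - outer (N *v (H *v u)) (G *v (H *v u))) q)" by blast
    define e where "e = H *v u"
    define H' where "H' = H - outer e e"
    have cong: "M ** H' ** conj_transpose L = M ** H ** conj_transpose L - outer (M *v e) (L *v e)" for M L :: "complex^'k^'n"
      by (simp add: H'_def outer_congruence matrix_sub_ldistrib matrix_sub_rdistrib)
    have "hermitian H'" unfolding H'_def by (intro hermitian_diff hH hermitian_outer)
    moreover have "quad_form H' v = quad_form H (v - hinner u (H *v v) *s u)" for v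
      using quad_form_deflation[OF hH, of 1 u v] Hu
      by (simp add: H'_def e_def quad_form_diff quad_form_outer hermitian_hinner[OF hH])
    ultimately have psdH': "pos_semidef H'" using less.prems(1) by (simp add: pos_semidef_def)
    have "hermitian (outer (N *v e) (G *v e))"
      using ev by (simp add: e_def hermitian_def vec_eq_iff mult_ac)
    then have hK2': "hermitian (N ** H' ** conj_transpose G)"
      unfolding cong using less.prems(2) hermitian_diff by blast
    have "range ((*v) H') \<subset> range ((*v) H)"
    proof
      have "H' *v v = H *v (v - hinner e v *s u)" for v
        by (simp add: H'_def e_def matrix_vector_mult_diff_rdistrib outer_mult_vec
            matrix_vector_mult_diff_distrib vector_scalar_commute)
      then show "range ((*v) H') \<subseteq> range ((*v) H)" by auto
      have "hinner u (H' *v v) = 0" for v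
        using Hu by (simp add: H'_def e_def matrix_vector_mult_diff_rdistrib outer_mult_vec hinner_diff_right
            hinner_scale_right hermitian_hinner[OF hH] quad_form_eq_hinner)
      then have "e \<notin> range ((*v) H')" using Hu by (auto simp: e_def quad_form_eq_hinner)
      then show "range ((*v) H') \<noteq> range ((*v) H)" by (auto simp: e_def)
    qed
    moreover have "subspace (range ((*v) M))" for M :: "complex^'k^'k"
      by (intro linear_subspace_image subspace_UNIV matrix_vector_mul_linear)
    ultimately have "dim (range ((*v) H')) < dim (range ((*v) H))"
      by (intro dim_psubset) (metis span_eq_iff)
    then have "Re (trace (P ** H')) \<le> 0"
    proof (rule less.hyps[OF _ psdH' hK2'])
      fix q
      show "Re (quad_form (N ** H' ** conj_transpose N) q) \<le> c * Re (quad_form (N ** H' ** conj_transpose G) q)"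
        unfolding cong using le'[of q] by (simp add: K1_def K2_def e_def)
    qed
    moreover have "Re (quad_form P e) \<le> 0" using vec[OF l] ev by (simp add: e_def)
    moreover have "trace (P ** H) = trace (P ** H') + quad_form P e"
      by (simp add: H'_def matrix_sub_ldistrib trace_sub trace_mult_outer)
    ultimately show ?thesis by simp
  qed
qed

section \<open>Controllability and invariant subspaces\<close>

lemma projection_along_subspace:
  fixes S :: "'a::euclidean_space set"
  assumes S: "subspace S"
  obtains Q where "linear Q" and "\<And>v. v - Q v \<in> S" and "\<And>v. Q v = 0 \<longleftrightarrow> v \<in> S"
proof -
  have "\<exists>w. v - w \<in> S \<and> (\<forall>y\<in>S. orthogonal w y)" for v
  proof -
    obtain y w where "y \<in> span S" "\<And>z. z \<in> span S \<Longrightarrow> orthogonal w z" "v = y + w"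
      using orthogonal_subspace_decomp_exists by metis
    then show ?thesis using S by (intro exI[of _ w]) (auto simp: span_eq_iff[THEN iffD2])
  qed
  then obtain Q where Q: "\<And>v. v - Q v \<in> S" "\<And>v y. y \<in> S \<Longrightarrow> orthogonal (Q v) y" by metis
  have unique: "Q v = w" if "v - w \<in> S" "\<And>y. y \<in> S \<Longrightarrow> orthogonal w y" for v w
  proof -
    have "w - Q v \<in> S" using subspace_diff[OF S Q(1)[of v] that(1)] by simp
    then have "orthogonal (w - Q v) (w - Q v)" using that(2) Q(2) by (simp add: orthogonal_def inner_diff_left)
    then show ?thesis by (simp add: orthogonal_def)
  qed
  have "linear Q"
  proof (rule linearI)
    fix u v
    have "u + v - (Q u + Q v) \<in> S"
      using subspace_add[OF S Q(1)[of u] Q(1)[of v]] by (simp add: algebra_simps)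
    then show "Q (u + v) = Q u + Q v"
      by (rule unique) (use Q(2) in \<open>simp add: orthogonal_def inner_add_left\<close>)
  next
    fix c v
    have "c *\<^sub>R v - c *\<^sub>R Q v \<in> S"
      using subspace_scale[OF S Q(1)[of v], of c] by (simp add: algebra_simps)
    then show "Q (c *\<^sub>R v) = c *\<^sub>R Q v"
      by (rule unique) (use Q(2) in \<open>simp add: orthogonal_def\<close>)
  qed
  moreover have "Q v = 0 \<longleftrightarrow> v \<in> S" for v
    using Q(1)[of v] unique[of v 0] by (auto simp: orthogonal_def)
  ultimately show ?thesis using that Q(1) by blast
qed

text \<open>A trajectory that starts in an invariant subspace containing the range of \<open>B\<close> never leaves it: the component
\<open>z\<close> of the state transversal to the subspace satisfies \<open>z' = Q A z\<close>, and a Gronwall argument on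
\<open>exp (- 2 K t) |z|\<^sup>2\<close> keeps it at zero. Hence no state outside is reachable from the origin.\<close>

lemma controllable_invariant_subspace:
  fixes A :: "complex^'n^'n" and B :: "complex^'m^'n"
  assumes ctr: "controllable A B" and S: "subspace S"
    and inv: "\<And>v. v \<in> S \<Longrightarrow> A *v v \<in> S" and ran: "\<And>u. B *v u \<in> S"
  shows "S = UNIV"
proof -
  obtain Q where Q: "linear Q" "\<And>v. v - Q v \<in> S" "\<And>v. Q v = 0 \<longleftrightarrow> v \<in> S"
    using projection_along_subspace[OF S] by metis
  have blQ: "bounded_linear Q" using Q(1) by (simp add: linear_conv_bounded_linear)
  have "linear (\<lambda>v. Q (A *v v))"
    using linear_compose[OF matrix_vector_mul_linear Q(1)] by (simp add: o_def)
  then obtain K where K: "K > 0" "\<And>v. norm (Q (A *v v)) \<le> K * norm v"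
    using linear_bounded_pos by metis
  have "x1 \<in> S" for x1
  proof -
    obtain T u x where T: "T > 0" and sol: "solution_on {0..T} A B u x" and x0: "x 0 = 0" and xT: "x T = x1"
      using ctr unfolding controllable_def by metis
    define z where "z t = Q (x t)" for t
    \<comment> \<open>Nonincreasing, since \<open>K\<close> bounds \<open>Q A\<close>; zero at time zero.\<close>
    define f where "f t = exp (- 2 * K * t) *\<^sub>R (z t \<bullet> z t)" for t
    have acx: "abs_continuous_on_interval 0 T x" using sol by (simp add: solution_on_def)
    have acz: "abs_continuous_on_interval 0 T z"
      unfolding z_def by (rule abs_continuous_bounded_linear[OF blQ acx])
    have acexp: "abs_continuous_on_interval 0 T (\<lambda>t. exp (- 2 * K * t))"
    proof (rule abs_continuous_bounded_derivative)
      show "((\<lambda>t. exp (- 2 * K * t)) has_vector_derivative - 2 * K * exp (- 2 * K * t)) (at t within {0..T})" for t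
        unfolding has_real_derivative_iff_has_vector_derivative[symmetric]
        by (auto intro!: derivative_eq_intros)
      show "norm (- 2 * K * exp (- 2 * K * t)) \<le> 2 * K" if "t \<in> {0..T}" for t
        using K that by (simp add: abs_mult)
    qed
    have acf: "abs_continuous_on_interval 0 T f"
      unfolding f_def
      by (rule abs_continuous_bilinear[OF bounded_bilinear_scaleR acexp
          abs_continuous_bilinear[OF bounded_bilinear_inner acz acz]])
    obtain N where N: "negligible N"
      "\<And>t. t \<in> {0..T} - N \<Longrightarrow> (x has_vector_derivative (A *v x t + B *v u t)) (at t within {0..T})"
      using solution_onE[OF sol] by (metis atLeastAtMost_borel sets_completionI_sets sets_lborel)
    define g where "g t = exp (- 2 * K * t) *\<^sub>R (2 * (z t \<bullet> Q (A *v z t))) + (- 2 * K * exp (- 2 * K * t)) *\<^sub>R (z t \<bullet> z t)" for t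
    have "(g has_integral (f T - f 0)) {0..T}"
    proof (rule abs_continuous_fundamental_theorem[OF _ acf N(1)])
      fix t assume t: "t \<in> {0..T} - N"
      have "Q (A *v x t + B *v u t) = Q (A *v z t)"
      proof -
        have "A *v (x t - Q (x t)) + B *v u t \<in> S" using inv Q(2) ran subspace_add[OF S] by blast
        then have "Q (A *v (x t - Q (x t)) + B *v u t) = 0" using Q(3) by blast
        then show ?thesis
          by (simp add: z_def matrix_vector_mult_diff_distrib linear_add[OF Q(1)] linear_diff[OF Q(1)]
                algebra_simps eq_neg_iff_add_eq_0[symmetric])
      qed
      then have dz: "(z has_vector_derivative Q (A *v z t)) (at t within {0..T})"
        using bounded_linear.has_vector_derivative[OF blQ N(2)[OF t]] by (simp add: z_def[abs_def])
      have dzz: "((\<lambda>t. z t \<bullet> z t) has_vector_derivative 2 * (z t \<bullet> Q (A *v z t))) (at t within {0..T})"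
        using bounded_bilinear.has_vector_derivative[OF bounded_bilinear_inner dz dz]
        by (simp add: inner_commute)
      have dexp: "((\<lambda>t. exp (- 2 * K * t)) has_vector_derivative - 2 * K * exp (- 2 * K * t)) (at t within {0..T})"
        unfolding has_real_derivative_iff_has_vector_derivative[symmetric]
        by (auto intro!: derivative_eq_intros)
      show "(f has_vector_derivative g t) (at t within {0..T})"
        unfolding f_def g_def
        by (rule bounded_bilinear.has_vector_derivative[OF bounded_bilinear_scaleR dexp dzz])
    qed (use T in auto)
    moreover have "g t \<le> 0" for t
    proof -
      have "z t \<bullet> Q (A *v z t) \<le> norm (z t) * norm (Q (A *v z t))" by (rule norm_cauchy_schwarz)
      also have "\<dots> \<le> norm (z t) * (K * norm (z t))" by (intro mult_left_mono K) auto
      finally have "z t \<bullet> Q (A *v z t) \<le> K * (z t \<bullet> z t)"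
        by (simp add: power2_norm_eq_inner[symmetric] power2_eq_square mult_ac)
      then have "exp (- 2 * K * t) * (2 * (z t \<bullet> Q (A *v z t) - K * (z t \<bullet> z t))) \<le> 0"
        by (intro mult_nonneg_nonpos) auto
      then show ?thesis by (simp add: g_def algebra_simps)
    qed
    ultimately have "f T - f 0 \<le> 0" using has_integral_le[OF _ has_integral_0] by blast
    then have "z T \<bullet> z T \<le> 0"
      using linear_0[OF Q(1)] by (simp add: f_def z_def x0 mult_le_0_iff)
    then have "z T = 0" using inner_ge_zero[of "z T"] by (simp add: order_antisym)
    then show ?thesis using Q(3) by (simp add: z_def xT)
  qed
  then show ?thesis by auto
qed

section \<open>Harmonic trajectories and the frequency domain inequality\<close>

definition state_part :: "complex^('n::finite + 'm::finite)^'n" where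
  "state_part = (\<chi> i r. case r of Inl k \<Rightarrow> if i = k then 1 else 0 | Inr k \<Rightarrow> 0)"

definition dynamics :: "complex^'n^'n \<Rightarrow> complex^'m^'n \<Rightarrow> complex^('n + 'm)^'n" where
  "dynamics A B = (\<chi> i r. case r of Inl k \<Rightarrow> A $ i $ k | Inr k \<Rightarrow> B $ i $ k)"

lemma sum_UNIV_Plus: "(\<Sum>r\<in>UNIV. f r) = (\<Sum>k\<in>UNIV. f (Inl k)) + (\<Sum>k\<in>UNIV. f (Inr k))"
  for f :: "'n::finite + 'm::finite \<Rightarrow> 'a::comm_monoid_add"
  unfolding UNIV_Plus_UNIV[symmetric] by (subst sum.Plus) auto

lemma stack_nth [simp]: "stack x u $ Inl i = x $ i" "stack x u $ Inr k = u $ k"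
  by (simp_all add: stack_def)

lemma state_part_stack [simp]: "state_part *v stack x u = x"
  by (simp add: vec_eq_iff matrix_vector_mult_def state_part_def sum_UNIV_Plus mult_if_delta)

lemma dynamics_stack [simp]: "dynamics A B *v stack x u = A *v x + B *v u"
  by (simp add: vec_eq_iff matrix_vector_mult_def dynamics_def sum_UNIV_Plus)

lemma stack_surj: obtains x u where "\<eta> = stack x u"
proof
  show "\<eta> = stack (\<chi> i. \<eta> $ Inl i) (\<chi> k. \<eta> $ Inr k)"
    unfolding vec_eq_iff
  proof
    fix r show "\<eta> $ r = stack (\<chi> i. \<eta> $ Inl i) (\<chi> k. \<eta> $ Inr k) $ r" by (cases r) simp_all
  qed
qed

text \<open>For such a vector the signal \<open>exp (\<i> w t) \<eta>\<close> is a periodic trajectory of the system. Unlike the frequency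
response, the notion makes sense also when \<open>\<i> w\<close> is an eigenvalue of \<open>A\<close>.\<close>

definition harmonic :: "complex^'n^'n \<Rightarrow> complex^'m^'n \<Rightarrow> real \<Rightarrow> complex^('n + 'm) \<Rightarrow> bool" where
  "harmonic A B w \<eta> \<longleftrightarrow> dynamics A B *v \<eta> = (\<i> * of_real w) *s (state_part *v \<eta>)"

lemma harmonic_stack: "harmonic A B w (stack x u) \<longleftrightarrow> A *v x + B *v u = (\<i> * of_real w) *s x"
  by (simp add: harmonic_def)

lemma harmonic_scale: "harmonic A B w \<eta> \<Longrightarrow> harmonic A B w (z *s \<eta>)"
  by (simp add: harmonic_def vector_scalar_commute vector_smult_assoc mult.commute)

lemma resolvent_mult_vec: "(mat z - A) *v v = z *s v - A *v v" for v :: "complex^'n"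
  by (simp add: matrix_vector_mult_diff_rdistrib mat_mult_vec)

lemma matrix_inv_cancel:
  fixes M :: "complex^'n^'n"
  assumes "det M \<noteq> 0"
  shows "matrix_inv M ** M = mat 1" and "M ** matrix_inv M = mat 1"
proof -
  have "\<exists>M'. M ** M' = mat 1 \<and> M' ** M = mat 1"
    using assms by (simp add: invertible_det_nz[symmetric] invertible_def)
  from someI_ex[OF this] show "matrix_inv M ** M = mat 1" "M ** matrix_inv M = mat 1"
    by (auto simp: matrix_inv_def)
qed

lemma freq_response_mult_vec:
  "freq_response A B w *v u = stack (matrix_inv (mat (\<i> * of_real w) - A) *v (B *v u)) u"
  unfolding vec_eq_iff
proof
  fix r show "(freq_response A B w *v u) $ r = stack (matrix_inv (mat (\<i> * of_real w) - A) *v (B *v u)) u $ r"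
  proof (cases r)
    case (Inl i)
    have "(freq_response A B w *v u) $ Inl i = ((matrix_inv (mat (\<i> * of_real w) - A) ** B) *v u) $ i"
      by (simp add: matrix_vector_mult_def freq_response_def)
    then show ?thesis by (simp add: Inl matrix_vector_mul_assoc)
  next
    case (Inr k)
    have "(freq_response A B w *v u) $ Inr k = (mat 1 *v u) $ k"
      by (simp add: matrix_vector_mult_def freq_response_def)
    then show ?thesis by (simp add: Inr)
  qed
qed

lemma harmonic_iff_freq_response:
  assumes "det (mat (\<i> * of_real w) - A) \<noteq> 0"
  shows "harmonic A B w \<eta> \<longleftrightarrow> (\<exists>u. \<eta> = freq_response A B w *v u)"
proof -
  define R where "R = mat (\<i> * of_real w) - A"
  have inv: "matrix_inv R *v (R *v v) = v" "R *v (matrix_inv R *v v) = v" for v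
    using matrix_inv_cancel[of R] assms by (simp_all add: R_def matrix_vector_mul_assoc)
  obtain x u where \<eta>: "\<eta> = stack x u" by (rule stack_surj)
  have "harmonic A B w \<eta> \<longleftrightarrow> R *v x = B *v u"
    unfolding \<eta> harmonic_stack R_def resolvent_mult_vec by (auto simp: diff_eq_eq add.commute)
  also have "\<dots> \<longleftrightarrow> x = matrix_inv R *v (B *v u)" using inv by metis
  also have "\<dots> \<longleftrightarrow> (\<exists>u'. \<eta> = stack (matrix_inv R *v (B *v u')) u')"
  proof -
    have "stack x u = stack x' u' \<longleftrightarrow> x = x' \<and> u = u'" for x' u'
      by (metis stack_nth vec_eq_iff)
    then show ?thesis by (auto simp: \<eta>)
  qed
  finally show ?thesis by (simp add: freq_response_mult_vec R_def)
qed

lemma neg_semidef_freq_response_iff: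
  assumes P: "hermitian P" and nz: "det (mat (\<i> * of_real w) - A) \<noteq> 0"
  shows "neg_semidef (conj_transpose (freq_response A B w) ** P ** freq_response A B w)
    \<longleftrightarrow> (\<forall>\<eta>. harmonic A B w \<eta> \<longrightarrow> Re (quad_form P \<eta>) \<le> 0)"
  using hermitian_congruence[OF P, of "conj_transpose (freq_response A B w)"]
  by (auto simp: neg_semidef_def quad_form_congruence harmonic_iff_freq_response[OF nz])

text \<open>The determinant is a polynomial in the frequency parameter, and it does not vanish beyond the norm of \<open>A\<close>.\<close>

lemma finite_imaginary_eigenvalues:
  fixes A :: "complex^'n^'n"
  shows "finite {w. det (mat (\<i> * of_real w) - A) = 0}"
proof -
  \<comment> \<open>The characteristic matrix, as a matrix of polynomials.\<close>
  define M where "M = (\<chi> i k. ([:- (A $ i $ k), if i = k then 1 else 0:] :: complex poly))"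
  define p where "p = det M"
  have eval: "poly p z = det (mat z - A)" for z
    unfolding p_def det_def poly_sum
    by (intro sum.cong refl) (simp add: poly_prod M_def mat_def sign_def if_distrib[of "(*) z"] cong: if_cong)
  obtain C where C: "\<And>v. norm (A *v v) \<le> C * norm v"
    using linear_bounded_pos[OF matrix_vector_mul_linear[of A]] by metis
  have "det (mat (of_real (\<bar>C\<bar> + 1)) - A) \<noteq> 0"
  proof
    assume "det (mat (of_real (\<bar>C\<bar> + 1)) - A) = 0"
    then have "\<not> invertible (mat (of_real (\<bar>C\<bar> + 1)) - A)" by (simp add: invertible_det_nz)
    then obtain v where v: "v \<noteq> 0" "(mat (of_real (\<bar>C\<bar> + 1)) - A) *v v = 0"
      by (auto simp: invertible_left_inverse matrix_left_invertible_ker)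
    then have "A *v v = (\<bar>C\<bar> + 1) *\<^sub>R v" by (simp add: resolvent_mult_vec scaleR_eq_scale)
    then have "(\<bar>C\<bar> + 1) * norm v \<le> C * norm v" using C[of v] by simp
    then show False using v(1) by (simp add: mult_le_cancel_right)
  qed
  then have "p \<noteq> 0" unfolding eval[symmetric] by auto
  then have "finite {z. poly p z = 0}" by (rule poly_roots_finite)
  moreover have "inj (\<lambda>w::real. \<i> * of_real w)" by (auto simp: inj_on_def)
  ultimately have "finite ((\<lambda>w::real. \<i> * of_real w) -` {z. poly p z = 0})" by (rule finite_vimageI)
  then show ?thesis by (simp add: eval vimage_def)
qed

lemma linear_scale_diff_matrix: "linear (\<lambda>v. z *s (M *v v) - N *v v)"
  for M N :: "complex^'k^'n"
proof -
  have "(\<lambda>v. z *s (M *v v) - N *v v) = (\<lambda>v. (mat z ** M - N) *v v)"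
    by (simp add: fun_eq_iff matrix_vector_mult_diff_rdistrib matrix_vector_mul_assoc[symmetric] mat_mult_vec)
  then show ?thesis using matrix_vector_mul_linear[of "mat z ** M - N"] by simp
qed

text \<open>The Hautus criterion: the range in question is invariant under \<open>A\<close> and contains the range of \<open>B\<close>.\<close>

lemma Hautus_surj:
  fixes A :: "complex^'n^'n" and B :: "complex^'m^'n"
  assumes "controllable A B"
  shows "surj (\<lambda>\<eta>. (\<i> * of_real w) *s (state_part *v \<eta>) - dynamics A B *v \<eta>)"
proof -
  define f where "f = (\<lambda>\<eta>. (\<i> * of_real w) *s (state_part *v \<eta>) - dynamics A B *v \<eta>)"
  have fs: "f (stack x u) = (\<i> * of_real w) *s x - A *v x - B *v u" for x u
    by (simp add: f_def algebra_simps)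
  have "linear f"
    unfolding f_def by (rule linear_scale_diff_matrix)
  then have "subspace (range f)" by (intro linear_subspace_image subspace_UNIV)
  then have "range f = UNIV"
  proof (rule controllable_invariant_subspace[OF assms])
    fix v assume "v \<in> range f"
    then obtain x u where v: "v = f (stack x u)" by (metis rangeE stack_surj)
    have "A *v v = f (stack ((\<i> * of_real w) *s x - v) ((\<i> * of_real w) *s u))"
      unfolding fs by (simp only: v fs matrix_vector_mult_diff_distrib vector_scalar_commute vector_ssub_ldistrib)
        (simp add: vec_eq_iff)
    then show "A *v v \<in> range f" by blast
  next
    fix u
    have "B *v u = f (stack 0 (- u))"
      by (simp add: fs linear_neg[OF matrix_vector_mul_linear])
    then show "B *v u \<in> range f" by blast
  qed
  then show ?thesis by (simp add: f_def)
qed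

text \<open>By the Hautus criterion the equation for harmonic vectors has a right inverse \<open>g\<close> at \<open>w\<close>. With its help a
harmonic vector at \<open>w\<close> is corrected to one at \<open>w + \<delta>\<close> by solving an equation for \<open>v\<close> that is a perturbation of
size \<open>\<delta>\<close> of the identity.\<close>

lemma harmonic_perturbation:
  fixes A :: "complex^'n^'n" and B :: "complex^'m^'n"
  assumes ctr: "controllable A B" and \<eta>: "harmonic A B w \<eta>" and "e > 0"
  obtains d where "d > 0" and "\<And>\<delta>. \<bar>\<delta>\<bar> < d \<Longrightarrow> \<exists>\<eta>'. norm (\<eta>' - \<eta>) < e \<and> harmonic A B (w + \<delta>) \<eta>'"
proof -
  define f where "f = (\<lambda>\<eta>. (\<i> * of_real w) *s (state_part *v \<eta>) - dynamics A B *v \<eta>)"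
  have linf: "linear f"
    unfolding f_def by (rule linear_scale_diff_matrix)
  have "surj f" using Hautus_surj[OF ctr] by (simp add: f_def)
  then obtain g where g: "linear g" "\<And>v. f (g v) = v"
    using linear_surjective_right_inverse[OF linf] by (metis comp_apply id_apply)
  obtain C where C: "C > 0" "\<And>v. norm (g v) \<le> C * norm v"
    using linear_bounded_pos[OF g(1)] by metis
  obtain D where D: "D > 0" "\<And>v. norm ((state_part :: complex^('n + 'm)^'n) *v v) \<le> D * norm v"
    using linear_bounded_pos[OF matrix_vector_mul_linear] by metis
  \<comment> \<open>The first bound makes the perturbation of the identity a contraction by 1/2, the second one keeps the
    correction below \<open>e\<close>.\<close>
  define d where "d = min (1 / (2 * C * D)) (e / (2 * C * D * norm \<eta> + 1))"
  have d: "d > 0" using C(1) D(1) \<open>e > 0\<close> by (auto simp: d_def intro!: divide_pos_pos add_nonneg_pos)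
  have "\<exists>\<eta>'. norm (\<eta>' - \<eta>) < e \<and> harmonic A B (w + \<delta>) \<eta>'" if \<delta>: "\<bar>\<delta>\<bar> < d" for \<delta>
  proof -
    have small: "\<bar>\<delta>\<bar> * (C * D) \<le> 1 / 2"
    proof -
      have "\<bar>\<delta>\<bar> \<le> 1 / (2 * C * D)" using \<delta> by (simp add: d_def)
      then show ?thesis using C(1) D(1) by (simp add: field_simps)
    qed
    define k where "k v = (\<i> * of_real \<delta>) *s (state_part *v g v)" for v
    have nk: "norm (k v) \<le> norm v / 2" for v
    proof -
      have "norm (k v) = \<bar>\<delta>\<bar> * norm ((state_part :: complex^('n + 'm)^'n) *v g v)"
        by (simp add: k_def norm_scale norm_mult)
      also have "\<dots> \<le> \<bar>\<delta>\<bar> * (D * (C * norm v))"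
        using C D by (intro mult_left_mono) (auto intro: order_trans[OF D(2)])
      also have "\<dots> = (\<bar>\<delta>\<bar> * (C * D)) * norm v" by (simp add: mult_ac)
      also have "\<dots> \<le> (1 / 2) * norm v" using small by (rule mult_right_mono) simp
      finally show ?thesis by simp
    qed
    have lin: "linear (\<lambda>v. v + k v)"
    proof -
      have "linear (\<lambda>v. v + (mat (\<i> * of_real \<delta>) ** state_part) *v g v)"
        using linear_compose_add[OF linear_id linear_compose[OF g(1) matrix_vector_mul_linear]] by (simp add: o_def id_def)
      then show ?thesis by (simp add: k_def matrix_vector_mul_assoc[symmetric] mat_mult_vec)
    qed
    have "v = 0" if "v + k v = 0" for v
    proof -
      have "k v = - v" using that by (simp add: eq_neg_iff_add_eq_0 add.commute)
      then have "norm v = norm (k v)" by simp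
      then show ?thesis using nk[of v] by simp
    qed
    then have "inj (\<lambda>v. v + k v)" unfolding linear_injective_0[OF lin] by blast
    with lin have "surj (\<lambda>v. v + k v)" by (rule linear_inj_imp_surj)
    then obtain v where v: "v + k v = (\<i> * of_real \<delta>) *s (state_part *v \<eta>)" by (metis surjD)
    define \<eta>' where "\<eta>' = \<eta> - g v"
    have "harmonic A B (w + \<delta>) \<eta>'"
    proof -
      have "(\<i> * of_real (w + \<delta>)) *s (state_part *v \<eta>') - dynamics A B *v \<eta>'
          = f \<eta> - f (g v) + ((\<i> * of_real \<delta>) *s (state_part *v \<eta>) - k v)"
        by (simp add: f_def k_def \<eta>'_def matrix_vector_mult_diff_distrib vec_eq_iff algebra_simps)
      also have "\<dots> = 0" using \<eta> v g(2) by (simp add: f_def harmonic_def algebra_simps flip: v)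
      finally show ?thesis by (simp add: harmonic_def)
    qed
    moreover have "norm (\<eta>' - \<eta>) < e"
    proof -
      have "norm v \<le> norm (v + k v) + norm (k v)" using norm_triangle_ineq4[of "v + k v" "k v"] by simp
      then have "norm v \<le> 2 * norm (v + k v)" using nk[of v] by simp
      also have "norm (v + k v) = \<bar>\<delta>\<bar> * norm ((state_part :: complex^('n + 'm)^'n) *v \<eta>)"
        unfolding v by (simp add: norm_scale norm_mult)
      finally have "norm v \<le> 2 * (\<bar>\<delta>\<bar> * (D * norm \<eta>))"
        using D(2)[of \<eta>] by (smt (verit) mult_left_mono abs_ge_zero)
      then have "norm (g v) \<le> C * (2 * (\<bar>\<delta>\<bar> * (D * norm \<eta>)))"
        using C by (meson mult_left_mono order_trans less_imp_le)
      also have "\<dots> = \<bar>\<delta>\<bar> * (2 * C * D * norm \<eta>)" by simp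
      also have "\<dots> < e"
      proof (cases "\<delta> = 0")
        case True then show ?thesis using \<open>e > 0\<close> by simp
      next
        case False
        have pos: "2 * C * D * norm \<eta> + 1 > 0" using C(1) D(1) by (auto intro!: add_nonneg_pos)
        have "\<bar>\<delta>\<bar> * (2 * C * D * norm \<eta>) < \<bar>\<delta>\<bar> * (2 * C * D * norm \<eta> + 1)" using False by simp
        also have "\<dots> \<le> e"
        proof -
          have "\<bar>\<delta>\<bar> \<le> e / (2 * C * D * norm \<eta> + 1)" using \<delta> by (simp add: d_def)
          then show ?thesis using pos by (simp add: pos_le_divide_eq)
        qed
        finally show ?thesis .
      qed
      finally show ?thesis by (simp add: \<eta>'_def)
    qed
    ultimately show ?thesis by blast
  qed
  with d show ?thesis using that by blast
qed

lemma freq_set_eq_interval: "freq_set w1 w2 = {min w1 w2..max w1 w2}"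
  by (auto simp: freq_set_def mult_le_0_iff min_def max_def)

text \<open>At all but finitely many frequencies the harmonic vectors are the range of the frequency response. The
interval being nondegenerate, an exceptional frequency is a limit of others in it, and its harmonic vectors are
limits of harmonic vectors at those.\<close>

lemma frequency_inequality_iff_harmonic:
  fixes A :: "complex^'n^'n" and B :: "complex^'m^'n"
  assumes ctr: "controllable A B" and P: "hermitian P" and int: "interior (freq_set w1 w2) \<noteq> {}"
  shows "(\<forall>w\<in>freq_set w1 w2. det (mat (\<i> * of_real w) - A) \<noteq> 0 \<longrightarrow>
        neg_semidef (conj_transpose (freq_response A B w) ** P ** freq_response A B w))
    \<longleftrightarrow> (\<forall>w\<in>freq_set w1 w2. \<forall>\<eta>. harmonic A B w \<eta> \<longrightarrow> Re (quad_form P \<eta>) \<le> 0)"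
    (is "?L \<longleftrightarrow> ?R")
proof
  assume ?R
  then show ?L using neg_semidef_freq_response_iff[OF P] by blast
next
  assume L: ?L
  show ?R
  proof (intro ballI allI impI, rule ccontr)
    fix w \<eta> assume w: "w \<in> freq_set w1 w2" and \<eta>: "harmonic A B w \<eta>" and "\<not> Re (quad_form P \<eta>) \<le> 0"
    then have pos: "0 < Re (quad_form P \<eta>)" by simp
    have "continuous_on UNIV (\<lambda>v. Re (quad_form P v))" by (intro continuous_intros)
    then have "open {v. 0 < Re (quad_form P v)}"
      by (intro open_Collect_less continuous_intros)
    then obtain e where e: "e > 0" "\<And>v. norm (v - \<eta>) < e \<Longrightarrow> 0 < Re (quad_form P v)"
      using pos unfolding open_dist by (fastforce simp: dist_norm)
    obtain d where d: "d > 0" "\<And>\<delta>. \<bar>\<delta>\<bar> < d \<Longrightarrow> \<exists>\<eta>'. norm (\<eta>' - \<eta>) < e \<and> harmonic A B (w + \<delta>) \<eta>'"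
      using harmonic_perturbation[OF ctr \<eta> e(1)] by metis
    define a b where "a = min w1 w2" and "b = max w1 w2"
    have S: "freq_set w1 w2 = {a..b}" by (simp add: freq_set_eq_interval a_def b_def)
    have ab: "a < b" using int by (auto simp: S interior_atLeastAtMost_real)
    have "max a (w - d) < min b (w + d)" using w d(1) ab by (auto simp: S)
    then have "infinite {max a (w - d)<..<min b (w + d)}" by (simp add: infinite_Ioo)
    then obtain w' where w': "w' \<in> {max a (w - d)<..<min b (w + d)}" "det (mat (\<i> * of_real w') - A) \<noteq> 0"
      using finite_subset[OF _ finite_imaginary_eigenvalues[of A]] by blast
    then have "\<bar>w' - w\<bar> < d" "w' \<in> freq_set w1 w2" by (auto simp: S)
    then obtain \<eta>' where "norm (\<eta>' - \<eta>) < e" "harmonic A B w' \<eta>'" using d(2)[of "w' - w"] by auto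
    then show False
      using L w'(2) \<open>w' \<in> freq_set w1 w2\<close> neg_semidef_freq_response_iff[OF P w'(2)] e(2) by (metis not_le)
  qed
qed

text \<open>Let \<open>S\<close> be the span. It is generated by finitely many harmonic states, so there is a frequency \<open>w\<close> that none of them
uses. By the resolvent identity the inverse \<open>r\<close> of \<open>\<i> w - A\<close> maps each generator into \<open>S\<close>; being injective, it maps \<open>S\<close>
onto itself. Therefore \<open>S\<close> is invariant under \<open>A\<close>, and it contains \<open>B u\<close> because \<open>r (B u)\<close> is a harmonic state.
Controllability leaves only the whole space.\<close>

lemma span_harmonic_states:
  fixes A :: "complex^'n^'n" and B :: "complex^'m^'n"
  assumes ctr: "controllable A B" and ab: "a < b"
  shows "span {state_part *v \<eta> |\<eta>. \<exists>w. a < w \<and> w < b \<and> harmonic A B w \<eta>} = UNIV"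
proof -
  define J where "J = {w. a < w \<and> w < b \<and> det (mat (\<i> * of_real w) - A) \<noteq> 0}"
  define V where "V = {state_part *v \<eta> |\<eta>. \<exists>w\<in>J. harmonic A B w \<eta>}"
  define S where "S = span V"
  have "infinite J"
  proof
    assume "finite J"
    moreover have "{a<..<b} \<subseteq> J \<union> {w. det (mat (\<i> * of_real w) - A) = 0}" by (auto simp: J_def)
    ultimately have "finite {a<..<b}" using finite_imaginary_eigenvalues[of A] by (meson finite_UnI finite_subset)
    then show False using infinite_Ioo[OF ab] by blast
  qed
  obtain Bs where Bs: "Bs \<subseteq> V" "independent Bs" "V \<subseteq> span Bs"
    using maximal_independent_subset[of V] by metis
  have "finite Bs" using Bs(2) by (rule independent_imp_finite)
  have S_Bs: "S = span Bs" unfolding S_def using Bs(1,3) by (meson span_minimal span_mono subset_antisym subspace_span)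
  have "\<forall>v\<in>Bs. \<exists>w\<in>J. \<exists>\<eta>. v = state_part *v \<eta> \<and> harmonic A B w \<eta>" using Bs(1) unfolding V_def by blast
  then obtain freq where freq: "\<And>v. v \<in> Bs \<Longrightarrow> freq v \<in> J"
    "\<And>v. v \<in> Bs \<Longrightarrow> \<exists>\<eta>. v = state_part *v \<eta> \<and> harmonic A B (freq v) \<eta>" by metis
  obtain w where w: "w \<in> J" "w \<notin> freq ` Bs"
    using \<open>infinite J\<close> \<open>finite Bs\<close> by (meson finite_imageI finite_subset subsetI)
  define R where "R = mat (\<i> * of_real w) - A"
  define r where "r v = matrix_inv R *v v" for v
  have detR: "det R \<noteq> 0" using w(1) by (simp add: J_def R_def)
  have inv: "r (R *v v) = v" "R *v (r v) = v" for v
    using matrix_inv_cancel[OF detR] by (simp_all add: r_def matrix_vector_mul_assoc)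
  have linr: "linear r" unfolding r_def by (rule matrix_vector_mul_linear)
  have subS: "subspace S" unfolding S_def by (rule subspace_span)
  have V_S: "v \<in> V \<Longrightarrow> v \<in> S" for v unfolding S_def by (rule span_base)
  have V_scale: "z *s v \<in> V" if "v \<in> V" for z v
    using that unfolding V_def by (smt (verit) mem_Collect_eq harmonic_scale vector_scalar_commute)
  have scaleS: "z *s v \<in> S" if "v \<in> S" for z v
  proof -
    have "linear (\<lambda>v :: complex^'n. z *s v)"
      using matrix_vector_mul_linear[of "mat z :: complex^'n^'n"] by (simp add: mat_mult_vec)
    then have "(\<lambda>v. z *s v) ` S = span ((\<lambda>v. z *s v) ` V)" unfolding S_def by (simp add: linear_span_image)
    also have "\<dots> \<subseteq> S" unfolding S_def by (rule span_mono) (use V_scale in auto)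
    finally show ?thesis using that by blast
  qed
  have rB: "r (B *v u) \<in> V" for u
  proof -
    have "harmonic A B w (freq_response A B w *v u)"
      using harmonic_iff_freq_response[OF detR[unfolded R_def]] by blast
    then have "state_part *v (freq_response A B w *v u) \<in> V" unfolding V_def using w(1) by blast
    then show ?thesis by (simp add: freq_response_mult_vec r_def R_def)
  qed
  have r_Bs: "r v \<in> S" if v: "v \<in> Bs" for v
  proof -
    obtain \<eta> where \<eta>: "v = state_part *v \<eta>" "harmonic A B (freq v) \<eta>" using freq(2)[OF v] by blast
    obtain x u where xu: "\<eta> = stack x u" by (rule stack_surj)
    define d where "d = \<i> * of_real (freq v - w)"
    have "d \<noteq> 0" using w(2) v by (auto simp: d_def)
    have "A *v v + B *v u = (\<i> * of_real (freq v)) *s v" using \<eta> by (simp add: xu harmonic_stack)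
    then have "B *v u = (\<i> * of_real (freq v)) *s v - A *v v" by (simp add: eq_diff_eq add.commute)
    also have "\<dots> = R *v v + d *s v"
      unfolding R_def resolvent_mult_vec d_def by (simp add: vec_eq_iff algebra_simps)
    finally have "B *v u = R *v v + d *s v" .
    then have "r (B *v u) = v + d *s r v"
      unfolding r_def by (simp add: matrix_vector_right_distrib vector_scalar_commute inv[unfolded r_def])
    then have "d *s r v = r (B *v u) - v" by simp
    also have "\<dots> \<in> S" using V_S[OF rB] V_S Bs(1) v subspace_diff[OF subS] by blast
    finally have "(1 / d) *s (d *s r v) \<in> S" by (rule scaleS)
    then show ?thesis using \<open>d \<noteq> 0\<close> by simp
  qed
  have rS: "r ` S \<subseteq> S"
  proof -
    have "r ` S = span (r ` Bs)" unfolding S_Bs using linr by (simp add: linear_span_image)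
    also have "\<dots> \<subseteq> S" by (rule span_minimal) (use r_Bs subS in auto)
    finally show ?thesis .
  qed
  have "inj_on r S" using inv(2) by (metis inj_onI)
  then have "dim (r ` S) = dim S"
    using dim_image_eq[OF linr] subS by (metis span_eq_iff)
  then have "r ` S = S"
    using rS subS linear_subspace_image[OF linr subS] by (intro subspace_dim_equal) auto
  then have RS: "R *v v \<in> S" if "v \<in> S" for v using that inv(2) by (metis imageE)
  have "S = UNIV"
  proof (rule controllable_invariant_subspace[OF ctr subS])
    fix v assume "v \<in> S"
    then have "(\<i> * of_real w) *s v - R *v v \<in> S" using scaleS RS subspace_diff[OF subS] by blast
    then show "A *v v \<in> S" by (simp add: R_def resolvent_mult_vec)
  next
    fix u show "B *v u \<in> S" using RS[OF V_S[OF rB[of u]]] by (simp add: inv)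
  qed
  moreover have "V \<subseteq> {state_part *v \<eta> |\<eta>. \<exists>w. a < w \<and> w < b \<and> harmonic A B w \<eta>}"
    by (auto simp: V_def J_def)
  ultimately show ?thesis unfolding S_def using span_mono by blast
qed

section \<open>The Gram matrix of a square integrable trajectory\<close>

lemma bounded_bilinear_outer: "bounded_bilinear (outer :: complex^'n \<Rightarrow> complex^'m \<Rightarrow> complex^'m^'n)"
proof
  fix a a' :: "complex^'n" and b b' :: "complex^'m" and r :: real
  show "outer (a + a') b = outer a b + outer a' b" "outer a (b + b') = outer a b + outer a b'"
    by (simp_all add: vec_eq_iff algebra_simps)
  show "outer (r *\<^sub>R a) b = r *\<^sub>R outer a b" "outer a (r *\<^sub>R b) = r *\<^sub>R outer a b"
    by (simp_all add: vec_eq_iff scaleR_conv_of_real[where 'a = complex] mult_ac)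
  show "\<exists>K. \<forall>a b. norm (outer a b :: complex^'m^'n) \<le> norm a * norm b * K"
    by (rule exI[of _ 1]) (simp add: norm_outer)
qed

lemma borel_measurable_outer:
  assumes "f \<in> borel_measurable M" and "g \<in> borel_measurable M"
  shows "(\<lambda>t. outer (f t) (g t)) \<in> borel_measurable M"
  by (rule borel_measurable_continuous_Pair[OF assms])
    (intro bounded_bilinear.continuous_on[OF bounded_bilinear_outer] continuous_intros)

lemma integrable_outer:
  assumes "L2_on S f" and "L2_on S g"
  shows "integrable (lebesgue_on S) (\<lambda>t. outer (f t) (g t))"
proof (rule Bochner_Integration.integrable_bound)
  show "integrable (lebesgue_on S) (\<lambda>t. (norm (f t))\<^sup>2 + (norm (g t))\<^sup>2)"
    using assms by (simp add: L2_on_def)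
  show "(\<lambda>t. outer (f t) (g t)) \<in> borel_measurable (lebesgue_on S)"
    using assms by (intro borel_measurable_outer) (auto simp: L2_on_def)
  have "norm (outer v w) \<le> (norm v)\<^sup>2 + (norm w)\<^sup>2" for v :: "complex^'c" and w :: "complex^'b"
    using sum_squares_bound[of "norm v" "norm w"] mult_nonneg_nonneg[OF norm_ge_zero[of v] norm_ge_zero[of w]]
    unfolding norm_outer by linarith
  then show "AE t in lebesgue_on S. norm (outer (f t) (g t)) \<le> norm ((norm (f t))\<^sup>2 + (norm (g t))\<^sup>2)"
    by (intro AE_I2) simp
qed

lemma L2_on_stack:
  fixes x :: "real \<Rightarrow> complex^'n" and u :: "real \<Rightarrow> complex^'m"
  assumes "L2_on S x" and "L2_on S u"
  shows "L2_on S (\<lambda>t. stack (x t) (u t))"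
proof -
  have "continuous_on UNIV (\<lambda>p::(complex^'n) \<times> (complex^'m). stack (fst p) (snd p))"
    unfolding stack_def
  proof (rule continuous_on_vec_lambda)
    fix r :: "'n + 'm"
    show "continuous_on UNIV (\<lambda>p::(complex^'n) \<times> (complex^'m). case r of Inl i \<Rightarrow> fst p $ i | Inr k \<Rightarrow> snd p $ k)"
      by (cases r) (auto intro!: continuous_intros)
  qed
  moreover have "x \<in> borel_measurable (lebesgue_on S)" "u \<in> borel_measurable (lebesgue_on S)"
    using assms by (simp_all add: L2_on_def)
  ultimately have "(\<lambda>t. stack (x t) (u t)) \<in> borel_measurable (lebesgue_on S)"
    by (rule borel_measurable_continuous_Pair[rotated 2])
  moreover have "(norm (stack v w))\<^sup>2 = (norm v)\<^sup>2 + (norm w)\<^sup>2" for v :: "complex^'n" and w :: "complex^'m"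
    by (simp only: power2_norm_vec sum_UNIV_Plus stack_nth)
  ultimately show ?thesis using assms by (simp add: L2_on_def)
qed

text \<open>Every quadratic integral of a signal is a linear function of this matrix.\<close>

definition gram :: "real set \<Rightarrow> (real \<Rightarrow> complex^'k) \<Rightarrow> complex^'k^'k" where
  "gram S f = (LINT t|lebesgue_on S. outer (f t) (f t))"

lemma integral_outer_congruence:
  assumes "L2_on S f"
  shows "integrable (lebesgue_on S) (\<lambda>t. outer (M *v f t) (N *v f t))"
    and "(LINT t|lebesgue_on S. outer (M *v f t) (N *v f t)) = M ** gram S f ** conj_transpose N"
proof -
  have bl: "bounded_linear (\<lambda>X. M ** X ** conj_transpose N)"
    using linear_sandwich by (simp add: linear_conv_bounded_linear)
  show "integrable (lebesgue_on S) (\<lambda>t. outer (M *v f t) (N *v f t))"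
    unfolding outer_congruence by (rule integrable_bounded_linear[OF bl integrable_outer[OF assms assms]])
  show "(LINT t|lebesgue_on S. outer (M *v f t) (N *v f t)) = M ** gram S f ** conj_transpose N"
    unfolding outer_congruence gram_def
    by (rule integral_bounded_linear[OF bl integrable_outer[OF assms assms]])
qed

lemma integral_quad_form_eq_trace:
  assumes "L2_on S f"
  shows "(LINT t|lebesgue_on S. quad_form P (f t)) = trace (P ** gram S f)"
proof -
  have "linear (\<lambda>X. trace (P ** X))"
    by (intro linearI) (simp_all add: matrix_add_ldistrib trace_add, simp add: trace_def matrix_matrix_mult_def
        scaleR_sum_right)
  then have bl: "bounded_linear (\<lambda>X. trace (P ** X))" by (simp add: linear_conv_bounded_linear)
  show ?thesis
    unfolding gram_def trace_mult_outer[symmetric]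
    by (rule integral_bounded_linear[OF bl integrable_outer[OF assms assms]])
qed

lemma pos_semidef_gram:
  assumes "L2_on S f"
  shows "pos_semidef (gram S f)"
proof -
  have int: "integrable (lebesgue_on S) (\<lambda>t. outer (f t) (f t))" by (rule integrable_outer[OF assms assms])
  have "linear (conj_transpose :: complex^'a^'a \<Rightarrow> _)"
    by (intro linearI) (simp_all add: vec_eq_iff)
  then have bl: "bounded_linear (conj_transpose :: complex^'a^'a \<Rightarrow> _)" by (simp add: linear_conv_bounded_linear)
  have "conj_transpose (gram S f) = (LINT t|lebesgue_on S. conj_transpose (outer (f t) (f t)))"
    unfolding gram_def by (rule integral_bounded_linear[OF bl int, symmetric])
  also have "\<dots> = gram S f" by (simp only: hermitian_outer[unfolded hermitian_def] gram_def)
  finally have "hermitian (gram S f)" by (simp add: hermitian_def)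
  moreover have "0 \<le> Re (quad_form (gram S f) v)" for v
  proof -
    have "linear (\<lambda>X. Re (quad_form X v))"
      by (intro linearI) (simp_all add: quad_form_def distrib_left distrib_right sum.distrib sum_distrib_left
          Re_sum mult_ac)
    then have bl: "bounded_linear (\<lambda>X. Re (quad_form X v))" by (simp add: linear_conv_bounded_linear)
    have "Re (quad_form (gram S f) v) = (LINT t|lebesgue_on S. Re (quad_form (outer (f t) (f t)) v))"
      unfolding gram_def by (rule integral_bounded_linear[OF bl int, symmetric])
    also have "\<dots> \<ge> 0"
    proof (rule Bochner_Integration.integral_nonneg)
      fix t show "0 \<le> Re (quad_form (outer (f t) (f t)) v)"
        by (simp add: quad_form_outer)
    qed
    finally show ?thesis .
  qed
  ultimately show ?thesis by (simp add: pos_semidef_def)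
qed

text \<open>The function \<open>f\<close> is an integral of an integrable \<open>g\<close>, hence has a limit at infinity; being integrable itself,
it can only tend to zero.\<close>

lemma integral_derivative_eq_zero:
  fixes f g :: "real \<Rightarrow> 'a::euclidean_space"
  assumes ftc: "\<And>T. T \<ge> 0 \<Longrightarrow> (g has_integral f T) {0..T}"
    and g: "integrable (lebesgue_on {0..}) g" and f: "integrable (lebesgue_on {0..}) f"
  shows "(LINT t|lebesgue_on {0..}. g t) = 0"
proof (rule ccontr)
  define L where "L = lebesgue_on {0::real..}"
  define I where "I = integral\<^sup>L L g"
  assume "(LINT t|lebesgue_on {0..}. g t) \<noteq> 0"
  then have I: "norm I > 0" by (simp add: I_def L_def)
  have setL: "{..T} \<inter> {0..} \<in> sets L" "{T..} \<inter> {0..} \<in> sets L" for T :: real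
    by (auto simp: L_def sets_restrict_space intro!: image_eqI)
  have cut: "integral\<^sup>L L (\<lambda>t. indicator ({..T} \<inter> {0..}) t *\<^sub>R g t) = f T" if T: "T \<ge> 0" for T
  proof -
    define h where "h t = indicat_real ({..T} \<inter> {0..}) t *\<^sub>R g t" for t
    have "integrable L h" unfolding h_def using g setL by (intro integrable_mult_indicator) (auto simp: L_def)
    then have 1: "(h has_integral integral\<^sup>L L h) {0..}"
      unfolding L_def by (rule has_integral_integral_lebesgue_on) auto
    have "(h has_integral f T) {0..T}"
      by (rule has_integral_eq[OF _ ftc[OF T]]) (auto simp: h_def)
    then have 2: "(h has_integral f T) {0..}"
      by (rule has_integral_on_superset) (auto simp: h_def)
    show ?thesis using has_integral_unique[OF 1 2] by (simp add: h_def[abs_def])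
  qed
  have "(f \<longlongrightarrow> I) at_top"
  proof (rule tendsto_at_topI_sequentially)
    fix X :: "nat \<Rightarrow> real" assume X: "filterlim X at_top sequentially"
    have "(\<lambda>n. integral\<^sup>L L (\<lambda>t. indicator ({..X n} \<inter> {0..}) t *\<^sub>R g t)) \<longlonglongrightarrow> I"
      unfolding I_def
    proof (rule integral_dominated_convergence)
      show "g \<in> borel_measurable L" "integrable L (\<lambda>t. norm (g t))" using g by (auto simp: L_def)
      show "(\<lambda>t. indicator ({..X n} \<inter> {0..}) t *\<^sub>R g t) \<in> borel_measurable L" for n
        using g setL by (intro borel_measurable_scaleR borel_measurable_indicator) (auto simp: L_def)
      show "AE t in L. (\<lambda>n. indicator ({..X n} \<inter> {0..}) t *\<^sub>R g t) \<longlonglongrightarrow> g t"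
      proof (rule AE_I2)
        fix t assume "t \<in> space L"
        then have t: "t \<ge> 0" by (simp add: L_def)
        have "eventually (\<lambda>n. t \<le> X n) sequentially" using X by (simp add: filterlim_at_top)
        then have "eventually (\<lambda>n. indicat_real ({..X n} \<inter> {0..}) t *\<^sub>R g t = g t) sequentially"
          by eventually_elim (use t in auto)
        then show "(\<lambda>n. indicat_real ({..X n} \<inter> {0..}) t *\<^sub>R g t) \<longlonglongrightarrow> g t" by (rule tendsto_eventually)
      qed
      show "AE t in L. norm (indicator ({..X n} \<inter> {0..}) t *\<^sub>R g t) \<le> norm (g t)" for n
        by (intro AE_I2) (auto simp: indicator_def)
    qed
    moreover have "eventually (\<lambda>n. integral\<^sup>L L (\<lambda>t. indicator ({..X n} \<inter> {0..}) t *\<^sub>R g t) = f (X n)) sequentially"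
    proof -
      have "eventually (\<lambda>n. 0 \<le> X n) sequentially" using X by (simp add: filterlim_at_top)
      then show ?thesis by eventually_elim (rule cut)
    qed
    ultimately show "(\<lambda>n. f (X n)) \<longlonglongrightarrow> I" by (rule Lim_transform_eventually)
  qed
  then have "((\<lambda>t. norm (f t)) \<longlongrightarrow> norm I) at_top" by (rule tendsto_norm)
  then have "eventually (\<lambda>t. norm I / 2 < norm (f t)) at_top" using I by (intro order_tendstoD) auto
  then obtain R where R: "\<And>t. t \<ge> R \<Longrightarrow> norm I / 2 < norm (f t)" by (auto simp: eventually_at_top_linorder)
  define c where "c = norm I / 2"
  define R' where "R' = max R 0"
  have "integrable L (\<lambda>t. indicat_real ({R'..} \<inter> {0..}) t *\<^sub>R c)"
  proof (rule Bochner_Integration.integrable_bound)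
    show "integrable L (\<lambda>t. norm (f t))" using f by (simp add: L_def)
    show "(\<lambda>t. indicat_real ({R'..} \<inter> {0..}) t *\<^sub>R c) \<in> borel_measurable L"
      using setL by (intro borel_measurable_scaleR borel_measurable_indicator) auto
    show "AE t in L. norm (indicat_real ({R'..} \<inter> {0..}) t *\<^sub>R c) \<le> norm (norm (f t))"
    proof (rule AE_I2)
      fix t
      show "norm (indicat_real ({R'..} \<inter> {0..}) t *\<^sub>R c) \<le> norm (norm (f t))"
        using R[of t] by (auto simp: indicator_def c_def R'_def)
    qed
  qed
  then have "integrable L (\<lambda>t. (1 / c) *\<^sub>R (indicat_real ({R'..} \<inter> {0..}) t *\<^sub>R c))" by (rule integrable_scaleR_right)
  then have "integrable L (indicat_real ({R'..} \<inter> {0..}))" using I by (simp add: c_def)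
  moreover have "{R'..} \<inter> {0..} = {R'..}" by (auto simp: R'_def)
  ultimately have "integrable L (indicat_real {R'..})" by simp
  then have "(indicat_real {R'..} has_integral integral\<^sup>L L (indicat_real {R'..})) {0..}"
    unfolding L_def by (rule has_integral_integral_lebesgue_on) auto
  then obtain J where J: "(indicat_real {R'..} has_integral J) {0..}" by blast
  have "real n \<le> J" for n :: nat
  proof (rule has_integral_subset_le[OF _ _ J])
    show "{R'..R' + real n} \<subseteq> {0..}" by (auto simp: R'_def)
    have "((\<lambda>t. 1::real) has_integral real n) {R'..R' + real n}"
      using has_integral_const_real[of "1::real" R' "R' + real n"] by simp
    then show "(indicat_real {R'..} has_integral real n) {R'..R' + real n}"
      by (rule has_integral_eq[rotated]) auto
  qed auto
  then show False using reals_Archimedean2[of J] by (meson not_le)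
qed

locale L2_trajectory =
  fixes A :: "complex^'n^'n" and B :: "complex^'m^'n" and u x
  assumes sol: "solution_on {0..} A B u x" and L2u: "L2_on {0..} u" and x0: "x 0 = 0" and L2x: "L2_on {0..} x"
begin

definition "eta t = stack (x t) (u t)"
definition "H = gram {0..} eta"

lemma L2_eta: "L2_on {0..} eta"
  unfolding eta_def by (rule L2_on_stack[OF L2x L2u])

lemma eta_parts: "state_part *v eta t = x t" "dynamics A B *v eta t = A *v x t + B *v u t"
  by (simp_all add: eta_def)

text \<open>The left hand side is the integral of the derivative of \<open>x x\<^sup>*\<close>, and \<open>x\<close> vanishes at time zero and at
infinity.\<close>

lemma lyapunov_balance:
  "dynamics A B ** H ** conj_transpose state_part + state_part ** H ** conj_transpose (dynamics A B) = 0"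
proof -
  obtain N where N: "negligible N"
    "\<And>t. t \<in> {0..} - N \<Longrightarrow> (x has_vector_derivative (A *v x t + B *v u t)) (at t within {0..})"
    using solution_onE[OF sol] by auto
  define g where "g t = outer (state_part *v eta t) (dynamics A B *v eta t)
    + outer (dynamics A B *v eta t) (state_part *v eta t)" for t
  have i1: "integrable (lebesgue_on {0..}) (\<lambda>t. outer (state_part *v eta t) (dynamics A B *v eta t))"
    by (rule integral_outer_congruence(1)[OF L2_eta])
  have i2: "integrable (lebesgue_on {0..}) (\<lambda>t. outer (dynamics A B *v eta t) (state_part *v eta t))"
    by (rule integral_outer_congruence(1)[OF L2_eta])
  have "(LINT t|lebesgue_on {0..}. g t) = 0"
  proof (rule integral_derivative_eq_zero)
    show "integrable (lebesgue_on {0..}) g" unfolding g_def by (rule Bochner_Integration.integrable_add[OF i1 i2])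
    show "integrable (lebesgue_on {0..}) (\<lambda>t. outer (x t) (x t))" by (rule integrable_outer[OF L2x L2x])
    fix T :: real assume T: "T \<ge> 0"
    have ac: "abs_continuous_on_interval 0 T x" using sol by (simp add: solution_on_def)
    have "(g has_integral (outer (x T) (x T) - outer (x 0) (x 0))) {0..T}"
    proof (rule abs_continuous_fundamental_theorem[OF T _ N(1)])
      show "abs_continuous_on_interval 0 T (\<lambda>t. outer (x t) (x t))"
        by (rule abs_continuous_bilinear[OF bounded_bilinear_outer ac ac])
      fix t assume t: "t \<in> {0..T} - N"
      have "(x has_vector_derivative (A *v x t + B *v u t)) (at t within {0..T})"
        using N(2)[of t] t by (auto intro: has_vector_derivative_within_subset)
      from bounded_bilinear.has_vector_derivative[OF bounded_bilinear_outer this this]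
      show "((\<lambda>t. outer (x t) (x t)) has_vector_derivative g t) (at t within {0..T})"
        by (simp add: g_def eta_parts)
    qed
    then show "(g has_integral outer (x T) (x T)) {0..T}"
      by (simp add: x0 bounded_bilinear.zero_left[OF bounded_bilinear_outer])
  qed
  then have "(LINT t|lebesgue_on {0..}. outer (state_part *v eta t) (dynamics A B *v eta t))
      + (LINT t|lebesgue_on {0..}. outer (dynamics A B *v eta t) (state_part *v eta t)) = 0"
    unfolding g_def Bochner_Integration.integral_add[OF i1 i2] .
  then show ?thesis
    unfolding integral_outer_congruence(2)[OF L2_eta] H_def by (simp only: add.commute)
qed

text \<open>The derivative obeys the differential equation only almost everywhere; measurability of the integrand follows
from completeness of Lebesgue measure.\<close>

lemma integral_shifted_deriv:
  "(LINT t|lebesgue_on {0..}. outer (shifted_deriv w1 x t) (shifted_deriv w2 x t))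
    = (mat (of_real w1) ** state_part + mat \<i> ** dynamics A B) ** H
      ** conj_transpose (mat (of_real w2) ** state_part + mat \<i> ** dynamics A B)"
proof -
  define S where "S w = mat (of_real w) ** state_part + mat \<i> ** dynamics A B" for w
  obtain N where N: "negligible N"
    "\<And>t. t \<in> {0..} - N \<Longrightarrow> (x has_vector_derivative (A *v x t + B *v u t)) (at t within {0..})"
    using solution_onE[OF sol] by auto
  have S: "S w *v eta t = of_real w *s x t + \<i> *s (A *v x t + B *v u t)" for w t
    by (simp add: S_def matrix_vector_mult_add_rdistrib matrix_vector_mul_assoc[symmetric] mat_mult_vec eta_parts)
  have eq: "shifted_deriv w x t = S w *v eta t" if "t \<in> {0..} - N" for w t
  proof -
    have "at_right t \<le> at t within {0..}" using that by (intro at_le) auto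
    then have "at t within {0..} \<noteq> bot" using trivial_limit_at_right_real[of t] by (auto simp: bot_unique)
    then have "vector_derivative x (at t within {0..}) = A *v x t + B *v u t"
      using N(2)[OF that] by (rule vector_derivative_within)
    then show ?thesis by (simp add: shifted_deriv_def S)
  qed
  define F where "F t = outer (S w1 *v eta t) (S w2 *v eta t)" for t
  define G where "G t = outer (shifted_deriv w1 x t) (shifted_deriv w2 x t)" for t
  have FG: "F t = G t" if "t \<in> {0..} - N" for t using eq[OF that] by (simp add: F_def G_def)
  have intF: "integrable (lebesgue_on {0..}) F" unfolding F_def by (rule integral_outer_congruence(1)[OF L2_eta])
  have AE: "AE t in lebesgue_on {0..}. F t = G t" by (rule AE_lebesgue_onI[OF N(1) FG]) auto
  have "(\<lambda>t. if t \<in> {0..} then F t else 0) \<in> borel_measurable lebesgue"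
    using intF by (intro borel_measurable_if_I) auto
  moreover have "AE t in lebesgue. (if t \<in> {0..} then F t else 0) = (if t \<in> {0..} then G t else 0)"
  proof -
    have "AE t in lebesgue. t \<notin> N" using N(1) by (simp add: negligible_iff_null_sets AE_not_in)
    then show ?thesis by eventually_elim (use FG in auto)
  qed
  ultimately have "(\<lambda>t. if t \<in> {0..} then G t else 0) \<in> borel_measurable lebesgue"
    by (rule borel_measurable_AE)
  then have "G \<in> borel_measurable (lebesgue_on {0..})" by (rule borel_measurable_if_D)
  then have "integral\<^sup>L (lebesgue_on {0..}) F = integral\<^sup>L (lebesgue_on {0..}) G"
    using intF AE by (intro integral_cong_AE) auto
  moreover have "integral\<^sup>L (lebesgue_on {0..}) F = S w1 ** H ** conj_transpose (S w2)"
    unfolding F_def H_def by (rule integral_outer_congruence(2)[OF L2_eta])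
  ultimately show ?thesis by (simp add: G_def[abs_def] S_def)
qed

lemma integral_quad_form: "(LINT t|lebesgue_on {0..}. quad_form P (stack (x t) (u t))) = trace (P ** H)"
  using integral_quad_form_eq_trace[OF L2_eta, of P] by (simp add: eta_def H_def)

end

section \<open>From harmonic vectors to trajectories\<close>

text \<open>The matrix that maps the joint vector of state and input to \<open>w x + \<i> x'\<close> along trajectories.\<close>

definition shifted_dynamics :: "complex^'n^'n \<Rightarrow> complex^'m^'n \<Rightarrow> real \<Rightarrow> complex^('n + 'm)^'n" where
  "shifted_dynamics A B w = mat (of_real w) ** state_part + mat \<i> ** dynamics A B"

lemma shifted_dynamics_mult_vec:
  "shifted_dynamics A B w *v v = of_real w *s (state_part *v v) + \<i> *s (dynamics A B *v v)"
  by (simp add: shifted_dynamics_def matrix_vector_mult_add_rdistrib matrix_vector_mul_assoc[symmetric] mat_mult_vec)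

text \<open>With \<open>N = - \<i> F - a G\<close>, where \<open>F\<close> is the dynamics and \<open>G\<close> the state part, a vector satisfies \<open>N v = l G v\<close> exactly if
it is harmonic at \<open>a + l\<close>. The two shifted dynamics are \<open>- N\<close> and \<open>(b - a) G - N\<close>, so the constraint reads
\<open>N H N\<^sup>* \<le> (b - a) N H G\<^sup>*\<close>, and the balance equation says that \<open>N H G\<^sup>*\<close> is Hermitian. The splitting of \<open>H\<close>
applies.\<close>

lemma trace_nonpos_if_harmonic_nonpos:
  fixes A :: "complex^'n^'n" and B :: "complex^'m^'n"
  assumes fdi: "\<And>w \<eta>. \<lbrakk>a \<le> w; w \<le> b; harmonic A B w \<eta>\<rbrakk> \<Longrightarrow> Re (quad_form P \<eta>) \<le> 0"
    and ab: "a \<le> b" and H: "pos_semidef H"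
    and balance: "dynamics A B ** H ** conj_transpose state_part + state_part ** H ** conj_transpose (dynamics A B) = 0"
    and constraint: "\<And>q. Re (quad_form (shifted_dynamics A B a ** H ** conj_transpose (shifted_dynamics A B b)) q) \<le> 0"
  shows "Re (trace (P ** H)) \<le> 0"
proof -
  define G where "G = (state_part :: complex^('n + 'm)^'n)"
  define F where "F = dynamics A B"
  define N where "N = mat (- \<i>) ** F - mat (of_real a) ** G"
  have hH: "hermitian H" using H by (simp add: pos_semidef_def)
  have Nv: "N *v v = - (\<i> *s (F *v v)) - of_real a *s (G *v v)" for v
    by (simp add: N_def matrix_vector_mult_diff_rdistrib matrix_vector_mul_assoc[symmetric] mat_mult_vec)
  show ?thesis
  proof (rule trace_nonpos_if_constrained_vectors_nonpos[of "b - a" N G P])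
    fix l v assume l: "0 \<le> l" "l \<le> b - a" and ev: "N *v v = of_real l *s (G *v v)"
    have "\<i> *s (N *v v) = \<i> *s (of_real l *s (G *v v))" using ev by simp
    then have "F *v v = (\<i> * of_real (a + l)) *s (G *v v)"
      unfolding Nv by (simp add: vec_eq_iff algebra_simps)
    then have "harmonic A B (a + l) v" by (simp add: harmonic_def F_def G_def)
    then show "Re (quad_form P v) \<le> 0" using l by (intro fdi[of "a + l"]) auto
  next
    define X where "X = F ** H ** conj_transpose G"
    define Y where "Y = G ** H ** conj_transpose G"
    have "N ** H ** conj_transpose G = mat (- \<i>) ** X - mat (of_real a) ** Y"
      by (simp add: N_def X_def Y_def matrix_sub_rdistrib matrix_mul_assoc)
    moreover have "conj_transpose Y = Y" using hermitian_congruence[OF hH] by (simp add: Y_def hermitian_def)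
    then have "cnj (Y $ k $ i) = Y $ i $ k" for i k by (metis conj_transpose_nth)
    moreover have "X + conj_transpose X = 0"
      using balance hH by (simp add: X_def F_def G_def conj_transpose_mult hermitian_def matrix_mul_assoc)
    then have "(X + conj_transpose X) $ i $ k = 0" for i k by simp
    then have "cnj (X $ k $ i) = - X $ i $ k" for i k by (simp add: eq_neg_iff_add_eq_0 add.commute)
    ultimately show "hermitian (N ** H ** conj_transpose G)"
      by (simp add: hermitian_def vec_eq_iff mat_matrix_mult_nth)
  next
    fix q
    have adj: "conj_transpose (shifted_dynamics A B a) *v q = - (conj_transpose N *v q)"
      "conj_transpose (shifted_dynamics A B b) *v q = of_real (b - a) *s (conj_transpose G *v q) - conj_transpose N *v q"
      by (simp_all add: vec_eq_iff matrix_vector_mult_def shifted_dynamics_def N_def F_def G_def mat_matrix_mult_nth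
          sum_subtractf sum.distrib sum_negf sum_distrib_left algebra_simps)
    have "quad_form (shifted_dynamics A B a ** H ** conj_transpose (shifted_dynamics A B b)) q
      = quad_form (N ** H ** conj_transpose N) q - of_real (b - a) * quad_form (N ** H ** conj_transpose G) q"
      unfolding quad_form_sandwich adj
      by (simp add: matrix_vector_mult_diff_distrib vector_scalar_commute hinner_diff_right hinner_scale_right
          hinner_diff_left[of 0, simplified] left_diff_distrib)
    then show "Re (quad_form (N ** H ** conj_transpose N) q) \<le> (b - a) * Re (quad_form (N ** H ** conj_transpose G) q)"
      using constraint[of q] by simp
  qed (use ab H in auto)
qed

section \<open>Concatenating trajectories\<close>

text \<open>Signals on different time intervals become comparable as functions on the whole line, where Lebesgue
measure is translation invariant.\<close>

definition zero_extend :: "real set \<Rightarrow> (real \<Rightarrow> 'a::real_vector) \<Rightarrow> real \<Rightarrow> 'a" where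
  "zero_extend S f t = indicat_real S t *\<^sub>R f t"

lemma L2_on_iff_zero_extend:
  assumes "S \<in> sets lebesgue"
  shows "L2_on S f \<longleftrightarrow> zero_extend S f \<in> borel_measurable lebesgue
     \<and> integrable lebesgue (\<lambda>t. (norm (zero_extend S f t))\<^sup>2)"
proof -
  have "indicat_real S t *\<^sub>R (norm (f t))\<^sup>2 = (norm (zero_extend S f t))\<^sup>2" for t
    by (simp add: zero_extend_def indicator_def)
  then show ?thesis
    using assms unfolding L2_on_def zero_extend_def[abs_def]
    by (simp add: borel_measurable_restrict_space_iff integrable_restrict_space)
qed

lemma gram_eq_zero_extend:
  assumes "S \<in> sets lebesgue"
  shows "gram S f = (LINT t|lebesgue. outer (zero_extend S f t) (zero_extend S f t))"
proof -
  have "indicat_real S t *\<^sub>R outer (f t) (f t) = outer (zero_extend S f t) (zero_extend S f t)" for t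
    by (simp add: zero_extend_def indicator_def bounded_bilinear.zero_left[OF bounded_bilinear_outer])
  then show ?thesis using assms by (simp add: gram_def integral_restrict_space)
qed

lemma integrable_outer_zero_extend:
  assumes "S \<in> sets lebesgue" "L2_on S f"
  shows "integrable lebesgue (\<lambda>t. outer (zero_extend S f t) (zero_extend S f t))"
proof -
  have "indicat_real S t *\<^sub>R outer (f t) (f t) = outer (zero_extend S f t) (zero_extend S f t)" for t
    by (simp add: zero_extend_def indicator_def bounded_bilinear.zero_left[OF bounded_bilinear_outer])
  then show ?thesis using integrable_outer[OF assms(2) assms(2)] assms(1)
    by (simp add: integrable_restrict_space)
qed

lemma lebesgue_eq_distr_translation: "lebesgue = distr lebesgue lebesgue (\<lambda>t::real. t - c)"
  using lebesgue_real_affine[of 1 "- c"] by (simp add: density_1)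

lemma measurable_translation_lebesgue: "(\<lambda>t::real. t - c) \<in> lebesgue \<rightarrow>\<^sub>M lebesgue"
  using lebesgue_affine_measurable[of "\<lambda>_. 1" "- c :: real"] by simp

lemma lebesgue_translation:
  fixes f :: "real \<Rightarrow> 'a::{banach, second_countable_topology}"
  assumes "f \<in> borel_measurable lebesgue"
  shows "(\<lambda>t. f (t - c)) \<in> borel_measurable lebesgue"
    and "integrable lebesgue (\<lambda>t. f (t - c)) \<longleftrightarrow> integrable lebesgue f"
    and "(LINT t|lebesgue. f (t - c)) = (LINT t|lebesgue. f t)"
proof -
  show "(\<lambda>t. f (t - c)) \<in> borel_measurable lebesgue"
    using measurable_compose[OF measurable_translation_lebesgue assms] by simp
  show "integrable lebesgue (\<lambda>t. f (t - c)) \<longleftrightarrow> integrable lebesgue f"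
    using integrable_distr_eq[OF measurable_translation_lebesgue assms, of c]
    by (simp flip: lebesgue_eq_distr_translation)
  show "(LINT t|lebesgue. f (t - c)) = (LINT t|lebesgue. f t)"
    using integral_distr[OF measurable_translation_lebesgue assms, of c]
    by (simp flip: lebesgue_eq_distr_translation)
qed

lemma L2_on_concat:
  fixes f :: "real \<Rightarrow> complex^'k"
  assumes T: "0 \<le> T1" "0 \<le> T2" and f1: "L2_on {0..T1} f1" and f2: "L2_on {0..T2} f2"
    and f: "\<And>t. f t = (if t \<le> T1 then f1 t else f2 (t - T1))"
  shows "L2_on {0..T1 + T2} f" and "gram {0..T1 + T2} f = gram {0..T1} f1 + gram {0..T2} f2"
proof -
  define e1 where "e1 = zero_extend {0..T1} f1"
  define e2 where "e2 = zero_extend {0..T2} f2"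
  define e where "e = zero_extend {0..T1 + T2} f"
  have ms: "{a..b} \<in> sets lebesgue" for a b :: real by auto
  have e1: "e1 \<in> borel_measurable lebesgue" "integrable lebesgue (\<lambda>t. (norm (e1 t))\<^sup>2)"
    using f1 by (simp_all add: L2_on_iff_zero_extend[OF ms] e1_def)
  have e2: "e2 \<in> borel_measurable lebesgue" "integrable lebesgue (\<lambda>t. (norm (e2 t))\<^sup>2)"
    using f2 by (simp_all add: L2_on_iff_zero_extend[OF ms] e2_def)
  have e_if: "e t = (if t \<le> T1 then e1 t else e2 (t - T1))" for t
    using T by (auto simp: e_def e1_def e2_def zero_extend_def indicator_def f)
  have me: "e \<in> borel_measurable lebesgue"
    unfolding e_if[abs_def]
    by (intro measurable_If e1 lebesgue_translation e2) auto
  \<comment> \<open>At the joint itself both pieces contribute, hence the exceptional null set.\<close>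
  have AE: "AE t in lebesgue. Q (e1 t) + Q (e2 (t - T1)) = Q (e t)"
    if "Q 0 = 0" for Q :: "complex^'k \<Rightarrow> 'z::real_normed_vector"
  proof -
    have "AE t in lebesgue. t \<notin> {T1}" 
      using AE_not_in[of "{T1}" lebesgue] negligible_sing[of T1] by (simp add: negligible_iff_null_sets)
    then show ?thesis
      by eventually_elim (auto simp: e_if e1_def e2_def zero_extend_def indicator_def that)
  qed
  have "integrable lebesgue (\<lambda>t. (norm (e1 t))\<^sup>2 + (norm (e2 (t - T1)))\<^sup>2)"
    using e1 e2 lebesgue_translation(2)[of "\<lambda>t. (norm (e2 t))\<^sup>2" T1] by simp
  then have "integrable lebesgue (\<lambda>t. (norm (e t))\<^sup>2)"
    by (rule integrable_cong_AE_imp) (use me AE[of "\<lambda>v. (norm v)\<^sup>2"] in auto)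
  then show L2: "L2_on {0..T1 + T2} f"
    using me by (simp add: L2_on_iff_zero_extend[OF ms] e_def)
  have i1: "integrable lebesgue (\<lambda>t. outer (e1 t) (e1 t))" 
    unfolding e1_def by (rule integrable_outer_zero_extend[OF ms f1])
  have i2: "integrable lebesgue (\<lambda>t. outer (e2 t) (e2 t))"
    unfolding e2_def by (rule integrable_outer_zero_extend[OF ms f2])
  have m2: "(\<lambda>t. outer (e2 t) (e2 t)) \<in> borel_measurable lebesgue" using i2 by auto
  have i2': "integrable lebesgue (\<lambda>t. outer (e2 (t - T1)) (e2 (t - T1)))"
    using lebesgue_translation(2)[OF m2] i2 by simp
  have "gram {0..T1} f1 + gram {0..T2} f2
      = (LINT t|lebesgue. outer (e1 t) (e1 t)) + (LINT t|lebesgue. outer (e2 (t - T1)) (e2 (t - T1)))"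
    unfolding gram_eq_zero_extend[OF ms] e1_def[symmetric] e2_def[symmetric] lebesgue_translation(3)[OF m2] ..
  also have "\<dots> = (LINT t|lebesgue. outer (e1 t) (e1 t) + outer (e2 (t - T1)) (e2 (t - T1)))"
    by (rule Bochner_Integration.integral_add[OF i1 i2', symmetric])
  also have "\<dots> = (LINT t|lebesgue. outer (e t) (e t))"
  proof (rule integral_cong_AE)
    show "(\<lambda>t. outer (e1 t) (e1 t) + outer (e2 (t - T1)) (e2 (t - T1))) \<in> borel_measurable lebesgue"
      using i1 i2' by auto
    show "(\<lambda>t. outer (e t) (e t)) \<in> borel_measurable lebesgue" by (rule borel_measurable_outer[OF me me])
    show "AE t in lebesgue. outer (e1 t) (e1 t) + outer (e2 (t - T1)) (e2 (t - T1)) = outer (e t) (e t)"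
      by (rule AE) (simp add: bounded_bilinear.zero_left[OF bounded_bilinear_outer])
  qed
  also have "\<dots> = gram {0..T1 + T2} f" unfolding gram_eq_zero_extend[OF ms] e_def ..
  finally show "gram {0..T1 + T2} f = gram {0..T1} f1 + gram {0..T2} f2" by simp
qed

text \<open>Of a finite trajectory only its end points and its Gram matrix are recorded: concatenation adds the
latter, and the constraint and the integral of the quadratic form depend on nothing else.\<close>

definition steers :: "complex^'n^'n \<Rightarrow> complex^'m^'n \<Rightarrow> complex^'n \<Rightarrow> complex^'n \<Rightarrow> complex^('n + 'm)^('n + 'm) \<Rightarrow> bool" where
  "steers A B a b K \<longleftrightarrow> (\<exists>T\<ge>0. \<exists>u x. L2_on {0..T} u \<and> solution_on {0..T} A B u x \<and> x 0 = a \<and> x T = b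
     \<and> gram {0..T} (\<lambda>t. stack (x t) (u t)) = K)"

lemma L2_on_continuous:
  fixes f :: "real \<Rightarrow> 'a::euclidean_space"
  assumes "continuous_on {a..b} f"
  shows "L2_on {a..b} f"
proof -
  have "f \<in> borel_measurable (lebesgue_on {a..b})"
    by (rule continuous_imp_measurable_on_sets_lebesgue[OF assms]) auto
  moreover have "integrable (lebesgue_on (cbox a b)) (\<lambda>t. (norm (f t))\<^sup>2)"
    by (rule continuous_imp_integrable) (use assms in \<open>auto intro!: continuous_intros\<close>)
  ultimately show ?thesis by (simp add: L2_on_def)
qed

lemma steers_exists:
  assumes "controllable A B"
  shows "\<exists>K. steers A B a b K"
  using assms unfolding controllable_def steers_def by (metis less_imp_le)

lemma steers_trans:
  fixes A :: "complex^'n^'n" and B :: "complex^'m^'n"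
  assumes "steers A B a b K1" and "steers A B b c K2"
  shows "steers A B a c (K1 + K2)"
proof -
  obtain T1 u1 x1 where 1: "T1 \<ge> 0" "L2_on {0..T1} u1" "solution_on {0..T1} A B u1 x1" "x1 0 = a" "x1 T1 = b"
    "gram {0..T1} (\<lambda>t. stack (x1 t) (u1 t)) = K1"
    using assms(1) unfolding steers_def by blast
  obtain T2 u2 x2 where 2: "T2 \<ge> 0" "L2_on {0..T2} u2" "solution_on {0..T2} A B u2 x2" "x2 0 = b" "x2 T2 = c"
    "gram {0..T2} (\<lambda>t. stack (x2 t) (u2 t)) = K2"
    using assms(2) unfolding steers_def by blast
  define T where "T = T1 + T2"
  define u where "u t = (if t \<le> T1 then u1 t else u2 (t - T1))" for t
  \<comment> \<open>Each summand is constant outside the time interval of its own trajectory.\<close>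
  define x where "x t = x1 (min t T1) + (x2 (max 0 (t - T1)) - b)" for t
  have x_if: "x t = (if t \<le> T1 then x1 t else x2 (t - T1))" for t
    using 1 2 by (auto simp: x_def)
  have ac1: "abs_continuous_on_interval 0 T1 x1" and ac2: "abs_continuous_on_interval 0 T2 x2"
    using 1 2 by (simp_all add: solution_on_def)
  have L2x1: "L2_on {0..T1} x1" and L2x2: "L2_on {0..T2} x2"
    using abs_continuous_imp_continuous ac1 ac2 L2_on_continuous by blast+
  have "stack (x t) (u t) = (if t \<le> T1 then stack (x1 t) (u1 t) else stack (x2 (t - T1)) (u2 (t - T1)))" for t
    by (simp add: x_if u_def)
  from L2_on_concat(2)[OF 1(1) 2(1) L2_on_stack[OF L2x1 1(2)] L2_on_stack[OF L2x2 2(2)] this]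
  have gram: "gram {0..T} (\<lambda>t. stack (x t) (u t)) = K1 + K2" by (simp add: T_def 1 2)
  have L2u: "L2_on {0..T} u" unfolding T_def by (rule L2_on_concat(1)[OF 1(1) 2(1) 1(2) 2(2)]) (simp add: u_def)
  have ac: "abs_continuous_on_interval s t x" if "{s..t} \<subseteq> {0..T}" for s t
  proof (rule abs_continuous_dominated)
    show "abs_continuous_on_interval s t (\<lambda>r. x1 (min (max 0 r) T1))"
      by (rule abs_continuous_comp_mono[OF ac1]) (use 1(1) in auto)
    show "abs_continuous_on_interval s t (\<lambda>r. x2 (min (max 0 (r - T1)) T2))"
      by (rule abs_continuous_comp_mono[OF ac2]) (use 2(1) in auto)
    fix r r' assume r: "s \<le> r" "r \<le> r'" "r' \<le> t"
    then have "r \<in> {s..t}" "r' \<in> {s..t}" by auto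
    then have "r \<in> {0..T}" "r' \<in> {0..T}" using that by blast+
    then have x: "x r = x1 (min (max 0 r) T1) + (x2 (min (max 0 (r - T1)) T2) - b)"
      "x r' = x1 (min (max 0 r') T1) + (x2 (min (max 0 (r' - T1)) T2) - b)"
      using 2(1) by (auto simp: x_def T_def min_def max_def)
    have "x r' - x r = (x1 (min (max 0 r') T1) - x1 (min (max 0 r) T1))
        + (x2 (min (max 0 (r' - T1)) T2) - x2 (min (max 0 (r - T1)) T2))"
      unfolding x by simp
    then show "norm (x r' - x r) \<le> 1 * (norm (x1 (min (max 0 r') T1) - x1 (min (max 0 r) T1))
        + norm (x2 (min (max 0 (r' - T1)) T2) - x2 (min (max 0 (r - T1)) T2)))"
      using norm_triangle_ineq by (metis mult_1)
  qed
  obtain N1 where N1: "negligible N1"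
    "\<And>t. t \<in> {0..T1} - N1 \<Longrightarrow> (x1 has_vector_derivative (A *v x1 t + B *v u1 t)) (at t within {0..T1})"
    using solution_onE[OF 1(3)] by auto
  obtain N2 where N2: "negligible N2"
    "\<And>t. t \<in> {0..T2} - N2 \<Longrightarrow> (x2 has_vector_derivative (A *v x2 t + B *v u2 t)) (at t within {0..T2})"
    using solution_onE[OF 2(3)] by auto
  define N where "N = N1 \<union> (+) T1 ` N2 \<union> {0, T1, T}"
  have "negligible N" unfolding N_def using N1(1) N2(1) by (simp add: negligible_translation)
  have deriv: "(x has_vector_derivative (A *v x t + B *v u t)) (at t within {0..T})" if t: "t \<in> {0..T} - N" for t
  proof (cases "t < T1")
    case True
    then have t1: "t \<in> {0<..<T1}" "t \<in> {0..T1} - N1" using t by (auto simp: N_def)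
    have "(x1 has_vector_derivative (A *v x1 t + B *v u1 t)) (at t within {0<..<T1})"
      by (rule has_vector_derivative_within_subset[OF N1(2)[OF t1(2)]]) auto
    then have "(x1 has_vector_derivative (A *v x1 t + B *v u1 t)) (at t)"
      using t1 by (simp add: at_within_open[of t "{0<..<T1}"])
    then have "(x has_vector_derivative (A *v x1 t + B *v u1 t)) (at t)"
      by (rule has_vector_derivative_transform_within_open[where S = "{0<..<T1}"]) (use t1 in \<open>auto simp: x_if\<close>)
    then show ?thesis using True by (simp add: x_if u_def has_vector_derivative_at_within)
  next
    case False
    have "t - T1 \<notin> N2"
    proof
      assume "t - T1 \<in> N2"
      then have "T1 + (t - T1) \<in> (+) T1 ` N2" by blast
      then show False using t by (simp add: N_def)
    qed
    then have t2: "t - T1 \<in> {0<..<T2}" "t - T1 \<in> {0..T2} - N2" using t False by (auto simp: N_def T_def)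
    have "(x2 has_vector_derivative (A *v x2 (t - T1) + B *v u2 (t - T1))) (at (t - T1) within {0<..<T2})"
      by (rule has_vector_derivative_within_subset[OF N2(2)[OF t2(2)]]) auto
    then have "(x2 has_vector_derivative (A *v x2 (t - T1) + B *v u2 (t - T1))) (at (t - T1))"
      using t2 by (simp add: at_within_open[of "t - T1" "{0<..<T2}"])
    moreover have "((\<lambda>t. t - T1) has_vector_derivative 1) (at t)"
      by (auto intro!: derivative_eq_intros)
    ultimately have "(x2 \<circ> (\<lambda>t. t - T1) has_vector_derivative (A *v x2 (t - T1) + B *v u2 (t - T1))) (at t)"
      using vector_diff_chain_at[of "\<lambda>t. t - T1" 1 t x2] by simp
    then have "(x has_vector_derivative (A *v x2 (t - T1) + B *v u2 (t - T1))) (at t)"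
      by (rule has_vector_derivative_transform_within_open[where S = "{T1<..}"]) (use t2 in \<open>auto simp: x_if\<close>)
    moreover have "\<not> t \<le> T1" using t2 by auto
    ultimately show ?thesis by (simp add: x_if u_def has_vector_derivative_at_within)
  qed
  have "AE t in lebesgue_on {0..T}. (x has_vector_derivative (A *v x t + B *v u t)) (at t within {0..T})"
    by (rule AE_lebesgue_onI[OF \<open>negligible N\<close> deriv]) auto
  then have "solution_on {0..T} A B u x"
    unfolding solution_on_def using ac by blast
  moreover have "x 0 = a" "x T = c" using 1 2 by (auto simp: x_def T_def min_def max_def)
  moreover have "T \<ge> 0" using 1 2 by (simp add: T_def)
  ultimately show ?thesis unfolding steers_def using L2u gram by blast
qed

text \<open>One period of a harmonic trajectory returns to its initial state. The Gram matrix is exact because the phase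
factor cancels in \<open>\<eta> \<eta>\<^sup>*\<close>. At frequency zero the trajectory is constant and any duration is a period.\<close>

lemma steers_harmonic:
  fixes A :: "complex^'n^'n" and B :: "complex^'m^'n"
  assumes harm: "harmonic A B w \<eta>"
  obtains \<tau> where "\<tau> > 0" and "steers A B (state_part *v \<eta>) (state_part *v \<eta>) (\<tau> *\<^sub>R outer \<eta> \<eta>)"
proof -
  obtain x0 u0 where \<eta>: "\<eta> = stack x0 u0" by (rule stack_surj)
  have dyn: "A *v x0 + B *v u0 = (\<i> * of_real w) *s x0" using harm by (simp add: \<eta> harmonic_stack)
  define \<tau> where "\<tau> = (if w = 0 then 1 else 2 * pi / \<bar>w\<bar>)"
  have \<tau>: "\<tau> > 0" by (simp add: \<tau>_def)
  define e where "e t = exp (t *\<^sub>R (\<i> * of_real w))" for t :: real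
  have e\<tau>: "e \<tau> = 1"
  proof (cases "w = 0")
    case False
    then have "\<tau> * w = 2 * pi \<or> \<tau> * w = - (2 * pi)" by (auto simp: \<tau>_def abs_if)
    moreover have "e \<tau> = cis (\<tau> * w)" by (simp add: e_def cis_conv_exp scaleR_conv_of_real mult_ac)
    ultimately show ?thesis by (auto simp: cis.ctr complex_eq_iff)
  qed (simp add: e_def)
  have norm_e: "norm (e t) = 1" for t by (simp add: e_def)
  define x where "x t = e t *s x0" for t
  define u where "u t = e t *s u0" for t
  have de: "(e has_vector_derivative (\<i> * of_real w) * e t) (at t within S)" for t S
    unfolding e_def by (rule has_vector_derivative_at_within[OF exp_scaleR_has_vector_derivative_left])
  have bl: "bounded_linear (\<lambda>z::complex. z *s v)" for v :: "complex^'k"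
  proof -
    have "linear (\<lambda>z::complex. z *s v)"
      by (intro linearI) (simp_all add: vec_eq_iff algebra_simps scaleR_conv_of_real[where 'a = complex])
    then show ?thesis by (simp add: linear_conv_bounded_linear)
  qed
  have dx: "(x has_vector_derivative (A *v x t + B *v u t)) (at t within S)" for t S
  proof -
    have "A *v x t + B *v u t = e t *s (A *v x0 + B *v u0)"
      by (simp add: x_def u_def vector_scalar_commute vector_add_ldistrib)
    also have "\<dots> = ((\<i> * of_real w) * e t) *s x0" by (simp add: dyn mult.commute)
    finally show ?thesis
      using bounded_linear.has_vector_derivative[OF bl de[of t S], of x0] by (simp add: x_def[abs_def])
  qed
  have ac: "abs_continuous_on_interval s t x" for s t
  proof (rule abs_continuous_bounded_derivative[OF dx])
    fix r
    have "A *v x r + B *v u r = e r *s (A *v x0 + B *v u0)"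
      by (simp add: x_def u_def vector_scalar_commute vector_add_ldistrib)
    then have "norm (A *v x r + B *v u r) = norm (e r) * norm (A *v x0 + B *v u0)" by (simp only: norm_scale)
    then show "norm (A *v x r + B *v u r) \<le> norm (A *v x0 + B *v u0)" by (simp add: norm_e)
  qed
  have "continuous_on {0..\<tau>} e"
    using de by (meson continuous_on_eq_continuous_within has_vector_derivative_continuous)
  then have "continuous_on {0..\<tau>} u" unfolding u_def by (rule bounded_linear.continuous_on[OF bl])
  then have L2u: "L2_on {0..\<tau>} u" by (rule L2_on_continuous)
  have "outer (stack (x t) (u t)) (stack (x t) (u t)) = outer \<eta> \<eta>" for t
  proof -
    have "stack (x t) (u t) = e t *s \<eta>"
      unfolding vec_eq_iff
    proof
      fix r show "stack (x t) (u t) $ r = (e t *s \<eta>) $ r"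
        by (cases r) (simp_all add: x_def u_def \<eta>)
    qed
    moreover have "e t * cnj (e t) = 1" using norm_e[of t] by (metis complex_norm_square of_real_1 power_one)
    then have "e t * a * (cnj (e t) * b) = a * b" for a b by (simp add: mult_ac) 
    ultimately show ?thesis by (simp add: vec_eq_iff)
  qed
  then have "gram {0..\<tau>} (\<lambda>t. stack (x t) (u t)) = \<tau> *\<^sub>R outer \<eta> \<eta>"
    using \<tau> by (simp add: gram_def measure_restrict_space space_restrict_space)
  moreover have "solution_on {0..\<tau>} A B u x"
    unfolding solution_on_def using ac dx by auto
  moreover have "x 0 = x0" "x \<tau> = x0" using e\<tau> by (simp_all add: x_def e_def)
  ultimately have "steers A B x0 x0 (\<tau> *\<^sub>R outer \<eta> \<eta>)"
    unfolding steers_def using \<tau> L2u by (intro exI[of _ \<tau>]) auto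
  with \<tau> show ?thesis using that by (simp add: \<eta>)
qed

lemma steers_zero_extends:
  fixes A :: "complex^'n^'n" and B :: "complex^'m^'n"
  assumes "steers A B 0 0 K"
  obtains u x where "L2_trajectory A B u x" and "L2_trajectory.H u x = K"
proof -
  obtain T u x where T: "T \<ge> 0" and L2u: "L2_on {0..T} u" and sol: "solution_on {0..T} A B u x"
    and x0: "x 0 = 0" and xT: "x T = 0" and K: "gram {0..T} (\<lambda>t. stack (x t) (u t)) = K"
    using assms unfolding steers_def by blast
  define u' where "u' t = (if t \<le> T then u t else 0)" for t
  define x' where "x' t = (if t \<le> T then x t else 0)" for t
  have ms: "{0..T} \<in> sets lebesgue" "{0::real..} \<in> sets lebesgue" by auto
  have ac: "abs_continuous_on_interval 0 T x" using sol by (simp add: solution_on_def)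
  have ext: "zero_extend {0..} f' = zero_extend {0..T} f"
    if "\<And>t. f' t = (if t \<le> T then f t else 0)" for f f' :: "real \<Rightarrow> 'z::real_vector"
    using T by (auto simp: fun_eq_iff zero_extend_def indicator_def that)
  have "L2_on {0..T} x" using L2_on_continuous abs_continuous_imp_continuous[OF ac] by blast
  then have L2x': "L2_on {0..} x'"
    using ext[of x' x] by (simp add: L2_on_iff_zero_extend[OF ms(1)] L2_on_iff_zero_extend[OF ms(2)] x'_def)
  have L2u': "L2_on {0..} u'"
    using L2u ext[of u' u] by (simp add: L2_on_iff_zero_extend[OF ms(1)] L2_on_iff_zero_extend[OF ms(2)] u'_def)
  have "stack (0 :: complex^'n) (0 :: complex^'m) = 0"
    unfolding vec_eq_iff
  proof
    fix r show "stack (0 :: complex^'n) (0 :: complex^'m) $ r = 0 $ r" by (cases r) simp_all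
  qed
  then have "zero_extend {0..} (\<lambda>t. stack (x' t) (u' t)) = zero_extend {0..T} (\<lambda>t. stack (x t) (u t))"
    by (intro ext) (simp add: x'_def u'_def)
  then have gram': "gram {0..} (\<lambda>t. stack (x' t) (u' t)) = K"
    using K by (simp add: gram_eq_zero_extend[OF ms(1)] gram_eq_zero_extend[OF ms(2)])
  \<comment> \<open>Since the final state is zero, extending the state by zero is the same as clamping the time.\<close>
  have ac': "abs_continuous_on_interval s t x'" if "{s..t} \<subseteq> {0..}" for s t
  proof (rule abs_continuous_dominated)
    show "abs_continuous_on_interval s t (\<lambda>r. x (min (max 0 r) T))"
      by (rule abs_continuous_comp_mono[OF ac]) (use T in auto)
    then show "abs_continuous_on_interval s t (\<lambda>r. x (min (max 0 r) T))" .
    fix r r' assume r: "s \<le> r" "r \<le> r'" "r' \<le> t"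
    then have "r \<in> {s..t}" "r' \<in> {s..t}" by auto
    then have "r \<ge> 0" "r' \<ge> 0" using that by auto
    then have "x' r = x (min (max 0 r) T)" "x' r' = x (min (max 0 r') T)"
      using xT by (auto simp: x'_def min_def max_def)
    then show "norm (x' r' - x' r) \<le> 1 * (norm (x (min (max 0 r') T) - x (min (max 0 r) T))
        + norm (x (min (max 0 r') T) - x (min (max 0 r) T)))" by simp
  qed
  obtain N where N: "negligible N"
    "\<And>t. t \<in> {0..T} - N \<Longrightarrow> (x has_vector_derivative (A *v x t + B *v u t)) (at t within {0..T})"
    using solution_onE[OF sol] by auto
  have "negligible (N \<union> {0, T})" using N(1) by simp
  have deriv: "(x' has_vector_derivative (A *v x' t + B *v u' t)) (at t within {0..})"
    if t: "t \<in> {0..} - (N \<union> {0, T})" for t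
  proof (cases "t < T")
    case True
    then have t1: "t \<in> {0<..<T}" "t \<in> {0..T} - N" using t by auto
    have "(x has_vector_derivative (A *v x t + B *v u t)) (at t within {0<..<T})"
      by (rule has_vector_derivative_within_subset[OF N(2)[OF t1(2)]]) auto
    then have "(x has_vector_derivative (A *v x t + B *v u t)) (at t)"
      using t1 by (simp add: at_within_open[of t "{0<..<T}"])
    then have "(x' has_vector_derivative (A *v x t + B *v u t)) (at t)"
      by (rule has_vector_derivative_transform_within_open[where S = "{0<..<T}"]) (use t1 in \<open>auto simp: x'_def\<close>)
    then show ?thesis using True by (simp add: x'_def u'_def has_vector_derivative_at_within)
  next
    case False
    then have t1: "t \<in> {T<..}" using t by auto
    have "((\<lambda>_. 0 :: complex^'n) has_vector_derivative 0) (at t)" by simp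
    then have "(x' has_vector_derivative 0) (at t)"
      by (rule has_vector_derivative_transform_within_open[where S = "{T<..}"]) (use t1 in \<open>auto simp: x'_def\<close>)
    then show ?thesis using t1 by (simp add: x'_def u'_def has_vector_derivative_at_within)
  qed
  have "AE t in lebesgue_on {0..}. (x' has_vector_derivative (A *v x' t + B *v u' t)) (at t within {0..})"
    by (rule AE_lebesgue_onI[OF \<open>negligible (N \<union> {0, T})\<close> deriv]) auto
  then have "solution_on {0..} A B u' x'"
    unfolding solution_on_def using ac' by blast
  then have traj: "L2_trajectory A B u' x'"
    using L2x' L2u' x0 T by unfold_locales (simp_all add: x'_def)
  moreover have "L2_trajectory.eta u' x' = (\<lambda>t. stack (x' t) (u' t))"
    by (simp add: fun_eq_iff L2_trajectory.eta_def[OF traj])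
  then have "L2_trajectory.H u' x' = K"
    using gram' by (simp add: L2_trajectory.H_def[OF traj])
  ultimately show ?thesis using that by blast
qed

section \<open>From trajectories to harmonic vectors\<close>

text \<open>Up to a fixed error \<open>E\<close>, which accounts for the transients, every natural multiple of \<open>D\<close> is the Gram matrix of
a trajectory from the origin to itself. In the long run such a trajectory looks like \<open>D\<close>.\<close>

definition repeatable :: "complex^'n^'n \<Rightarrow> complex^'m^'n \<Rightarrow> complex^('n + 'm)^('n + 'm) \<Rightarrow> bool" where
  "repeatable A B D \<longleftrightarrow> (\<exists>E. \<forall>N::nat. steers A B 0 0 (real N *\<^sub>R D + E))"

lemma repeatable_zero:
  assumes "controllable A B"
  shows "repeatable A B 0"
  using steers_exists[OF assms, of 0 0] by (auto simp: repeatable_def)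

lemma repeatable_add:
  assumes "repeatable A B D1" "repeatable A B D2"
  shows "repeatable A B (D1 + D2)"
proof -
  obtain E1 E2 where E: "\<And>N::nat. steers A B 0 0 (real N *\<^sub>R D1 + E1)" "\<And>N::nat. steers A B 0 0 (real N *\<^sub>R D2 + E2)"
    using assms unfolding repeatable_def by blast
  have "steers A B 0 0 (real N *\<^sub>R (D1 + D2) + (E1 + E2))" for N :: nat
    using steers_trans[OF E(1)[of N] E(2)[of N]] by (simp add: algebra_simps)
  then show ?thesis unfolding repeatable_def by blast
qed

lemma repeatable_sum:
  assumes "controllable A B" "finite I" "\<And>i. i \<in> I \<Longrightarrow> repeatable A B (D i)"
  shows "repeatable A B (\<Sum>i\<in>I. D i)"
  using assms(2,3) by (induction I rule: finite_induct) (simp_all add: repeatable_zero[OF assms(1)] repeatable_add)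

lemma repeatable_multiple:
  assumes "repeatable A B D"
  shows "repeatable A B (real k *\<^sub>R D)"
proof -
  obtain E where E: "\<And>N::nat. steers A B 0 0 (real N *\<^sub>R D + E)"
    using assms unfolding repeatable_def by blast
  have "steers A B 0 0 (real N *\<^sub>R (real k *\<^sub>R D) + E)" for N using E[of "N * k"] by simp
  then show ?thesis unfolding repeatable_def by blast
qed

text \<open>Steer from the origin to the initial state of a harmonic trajectory, run through \<open>N\<close> periods and steer back;
the two transfers are the same for all \<open>N\<close>.\<close>

lemma repeatable_harmonic:
  assumes ctr: "controllable A B" and harm: "harmonic A B w \<eta>"
  obtains \<tau> where "\<tau> > 0" and "repeatable A B (\<tau> *\<^sub>R outer \<eta> \<eta>)"
proof -
  define x0 where "x0 = state_part *v \<eta>"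
  obtain \<tau> where \<tau>: "\<tau> > 0" "steers A B x0 x0 (\<tau> *\<^sub>R outer \<eta> \<eta>)"
    using steers_harmonic[OF harm] unfolding x0_def by blast
  obtain E1 E2 where E: "steers A B 0 x0 E1" "steers A B x0 0 E2"
    using steers_exists[OF ctr] by blast
  have "steers A B 0 x0 (real N *\<^sub>R (\<tau> *\<^sub>R outer \<eta> \<eta>) + E1)" for N :: nat
  proof (induction N)
    case 0
    show ?case using E(1) by simp
  next
    case (Suc N)
    have step: "real (Suc N) *\<^sub>R (\<tau> *\<^sub>R outer \<eta> \<eta>) + E1 = (real N *\<^sub>R (\<tau> *\<^sub>R outer \<eta> \<eta>) + E1) + \<tau> *\<^sub>R outer \<eta> \<eta>"
      by (simp add: algebra_simps)
    show ?case unfolding step by (rule steers_trans[OF Suc.IH \<tau>(2)])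
  qed
  then have "steers A B 0 0 (real N *\<^sub>R (\<tau> *\<^sub>R outer \<eta> \<eta>) + (E1 + E2))" for N :: nat
    using steers_trans[OF _ E(2)] by (metis add.assoc)
  then have "repeatable A B (\<tau> *\<^sub>R outer \<eta> \<eta>)" unfolding repeatable_def by blast
  with \<tau>(1) show ?thesis using that by blast
qed

text \<open>Along a harmonic vector the shifted dynamics act as the scalars \<open>w1 - w\<close> and \<open>w2 - w\<close>, whose product is negative
exactly inside the interval.\<close>

lemma quad_form_shifted_harmonic:
  fixes A :: "complex^'n^'n" and B :: "complex^'m^'n"
  assumes "harmonic A B w \<eta>"
  shows "Re (quad_form (shifted_dynamics A B w1 ** (\<tau> *\<^sub>R outer \<eta> \<eta>) ** conj_transpose (shifted_dynamics A B w2)) q)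
    = \<tau> * ((w1 - w) * (w2 - w)) * (norm (hinner (state_part *v \<eta>) q))\<^sup>2"
proof -
  define L where "L = (\<lambda>X. shifted_dynamics A B w1 ** X ** conj_transpose (shifted_dynamics A B w2))"
  have S: "shifted_dynamics A B w' *v \<eta> = of_real (w' - w) *s (state_part *v \<eta>)" for w'
    using assms by (simp add: shifted_dynamics_mult_vec harmonic_def vec_eq_iff algebra_simps)
  have "L (\<tau> *\<^sub>R outer \<eta> \<eta>) = \<tau> *\<^sub>R L (outer \<eta> \<eta>)"
    unfolding L_def by (rule linear_scale[OF linear_sandwich])
  also have "L (outer \<eta> \<eta>) = outer (of_real (w1 - w) *s (state_part *v \<eta>)) (of_real (w2 - w) *s (state_part *v \<eta>))"
    unfolding L_def outer_congruence[symmetric] S ..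
  finally have L: "L (\<tau> *\<^sub>R outer \<eta> \<eta>)
      = \<tau> *\<^sub>R outer (of_real (w1 - w) *s (state_part *v \<eta>)) (of_real (w2 - w) *s (state_part *v \<eta>))" .
  have "quad_form (outer (of_real s *s v) (of_real t *s v)) q = of_real (s * t) * (hinner v q * cnj (hinner v q))"
    for s t and v :: "complex^'n" by (simp add: quad_form_outer hinner_scale_left mult_ac)
  then have "quad_form (L (\<tau> *\<^sub>R outer \<eta> \<eta>)) q = of_real (\<tau> * ((w1 - w) * (w2 - w)))
      * (hinner (state_part *v \<eta>) q * cnj (hinner (state_part *v \<eta>) q))"
    unfolding L quad_form_scaleR of_real_mult by (simp only: mult.assoc)
  then show ?thesis by (simp add: L_def complex_norm_square[symmetric])
qed

text \<open>Suppose that the form of \<open>P\<close> is positive at a harmonic vector. Repeating that vector alone makes the integral of the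
form large, but its contribution to the constraint has rank one and may even vanish, so it need not
compensate the transients. Harmonic vectors at interior frequencies whose states span the state space
contribute a negative definite matrix. The direction \<open>D\<close> consists of \<open>k\<close> copies of the former and one copy of each
of the latter, with \<open>k\<close> large enough that the trace stays positive; then a long repetition of \<open>D\<close> violates the
time domain inequality.\<close>

lemma harmonic_nonpos_if_trajectories_nonpos:
  fixes A :: "complex^'n^'n" and B :: "complex^'m^'n"
  assumes ctr: "controllable A B" and lt: "w1 < w2"
    and td: "\<And>u x. \<lbrakk>L2_trajectory A B u x;
        \<And>q. Re (quad_form (shifted_dynamics A B w1 ** L2_trajectory.H u x ** conj_transpose (shifted_dynamics A B w2)) q) \<le> 0\<rbrakk>
        \<Longrightarrow> Re (trace (P ** L2_trajectory.H u x)) \<le> 0"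
    and w: "w1 \<le> w" "w \<le> w2" and harm: "harmonic A B w \<eta>"
  shows "Re (quad_form P \<eta>) \<le> 0"
proof (rule ccontr)
  assume "\<not> Re (quad_form P \<eta>) \<le> 0"
  then have pos: "Re (quad_form P \<eta>) > 0" by simp
  define L where "L X = shifted_dynamics A B w1 ** X ** conj_transpose (shifted_dynamics A B w2)" for X
  have linL: "linear L" unfolding L_def by (rule linear_sandwich)
  define l where "l X q = Re (quad_form (L X) q)" for X q
  have lin_l: "linear (\<lambda>X. l X q)" for q
    by (intro linearI) (simp_all add: l_def linear_add[OF linL] linear_scale[OF linL] quad_form_def distrib_left distrib_right
        sum.distrib sum_distrib_left Re_sum mult_ac)
  define tr where "tr X = Re (trace (P ** X))" for X
  have lin_tr: "linear tr"
    by (intro linearI) (simp_all add: tr_def matrix_add_ldistrib trace_add, simp add: trace_def matrix_matrix_mult_def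
        sum_distrib_left)
  obtain \<tau>0 where \<tau>0: "\<tau>0 > 0" "repeatable A B (\<tau>0 *\<^sub>R outer \<eta> \<eta>)" using repeatable_harmonic[OF ctr harm] by blast
  define D0 where "D0 = \<tau>0 *\<^sub>R outer \<eta> \<eta>"
  have trD0: "tr D0 > 0"
    using \<tau>0(1) pos by (simp add: D0_def linear_scale[OF lin_tr]) (simp add: tr_def trace_mult_outer)
  have lD0: "l D0 q \<le> 0" for q
    unfolding l_def L_def D0_def quad_form_shifted_harmonic[OF harm]
    using \<tau>0(1) w by (intro mult_nonpos_nonneg mult_nonneg_nonpos) (auto intro: mult_nonpos_nonneg)
  define V where "V = {state_part *v \<eta> |\<eta>. \<exists>w. w1 < w \<and> w < w2 \<and> harmonic A B w \<eta>}"
  obtain Bs where Bs: "Bs \<subseteq> V" "independent Bs" "V \<subseteq> span Bs"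
    using maximal_independent_subset[of V] by metis
  have "finite Bs" using Bs(2) by (rule independent_imp_finite)
  have spanBs: "span Bs = UNIV"
    using span_harmonic_states[OF ctr lt] Bs(3) unfolding V_def[symmetric]
    by (metis span_minimal subspace_span top.extremum_uniqueI)
  have "\<exists>\<zeta> \<nu> \<tau>. v = state_part *v \<zeta> \<and> w1 < \<nu> \<and> \<nu> < w2 \<and> harmonic A B \<nu> \<zeta> \<and> \<tau> > 0 \<and> repeatable A B (\<tau> *\<^sub>R outer \<zeta> \<zeta>)"
    if "v \<in> Bs" for v
  proof -
    obtain \<zeta> \<nu> where z: "v = state_part *v \<zeta>" "w1 < \<nu>" "\<nu> < w2" "harmonic A B \<nu> \<zeta>"
      using \<open>v \<in> Bs\<close> Bs(1) by (auto simp: V_def)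
    obtain \<tau> where "\<tau> > 0" "repeatable A B (\<tau> *\<^sub>R outer \<zeta> \<zeta>)" using repeatable_harmonic[OF ctr z(4)] by blast
    with z show ?thesis by blast
  qed
  then have "\<forall>v. \<exists>\<zeta> \<nu> \<tau>. v \<in> Bs \<longrightarrow> v = state_part *v \<zeta> \<and> w1 < \<nu> \<and> \<nu> < w2 \<and> harmonic A B \<nu> \<zeta> \<and> \<tau> > 0 \<and> repeatable A B (\<tau> *\<^sub>R outer \<zeta> \<zeta>)"
    by blast
  then obtain \<zeta> \<nu> \<tau> where \<zeta>: "\<And>v. v \<in> Bs \<Longrightarrow> v = state_part *v \<zeta> v" "\<And>v. v \<in> Bs \<Longrightarrow> w1 < \<nu> v"
    "\<And>v. v \<in> Bs \<Longrightarrow> \<nu> v < w2" "\<And>v. v \<in> Bs \<Longrightarrow> harmonic A B (\<nu> v) (\<zeta> v)" "\<And>v. v \<in> Bs \<Longrightarrow> \<tau> v > 0"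
    "\<And>v. v \<in> Bs \<Longrightarrow> repeatable A B (\<tau> v *\<^sub>R outer (\<zeta> v) (\<zeta> v))"
    unfolding choice_iff by blast
  define D1 where "D1 = (\<Sum>v\<in>Bs. \<tau> v *\<^sub>R outer (\<zeta> v) (\<zeta> v))"
  have repD1: "repeatable A B D1" unfolding D1_def by (rule repeatable_sum[OF ctr \<open>finite Bs\<close> \<zeta>(6)])
  have lD1: "l D1 q < 0" if "q \<noteq> 0" for q
  proof -
    have summand: "l (\<tau> v *\<^sub>R outer (\<zeta> v) (\<zeta> v)) q = \<tau> v * ((w1 - \<nu> v) * (w2 - \<nu> v)) * (norm (hinner v q))\<^sup>2" if "v \<in> Bs" for v
      unfolding l_def L_def quad_form_shifted_harmonic[OF \<zeta>(4)[OF that]] using \<zeta>(1)[OF that] by simp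
    have coef: "\<tau> v * ((w1 - \<nu> v) * (w2 - \<nu> v)) < 0" if "v \<in> Bs" for v
      using \<zeta>(2,3,5)[OF that] by (intro mult_pos_neg mult_neg_pos) auto
    have "\<exists>v\<in>Bs. v \<bullet> q \<noteq> 0"
    proof (rule ccontr)
      assume "\<not> ?thesis"
      then have "orthogonal q v" if "v \<in> span Bs" for v
        using that by (intro orthogonal_to_span[of v Bs q]) (auto simp: orthogonal_def inner_commute)
      then have "orthogonal q q" using spanBs by blast
      then show False using \<open>q \<noteq> 0\<close> by (simp add: orthogonal_def)
    qed
    then obtain v0 where v0: "v0 \<in> Bs" "hinner v0 q \<noteq> 0" by (metis Re_hinner zero_complex.sel(1))
    have "l D1 q = (\<Sum>v\<in>Bs. \<tau> v * ((w1 - \<nu> v) * (w2 - \<nu> v)) * (norm (hinner v q))\<^sup>2)"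
      unfolding D1_def linear_sum[OF lin_l] using summand by (rule sum.cong[OF refl])
    also have "\<dots> < (\<Sum>v\<in>Bs. 0)"
    proof (rule sum_strict_mono_ex1[OF \<open>finite Bs\<close>])
      show "\<forall>v\<in>Bs. \<tau> v * ((w1 - \<nu> v) * (w2 - \<nu> v)) * (norm (hinner v q))\<^sup>2 \<le> 0"
        using mult_nonpos_nonneg[OF less_imp_le[OF coef]] by simp
      show "\<exists>v\<in>Bs. \<tau> v * ((w1 - \<nu> v) * (w2 - \<nu> v)) * (norm (hinner v q))\<^sup>2 < 0"
        using v0(2) by (intro bexI[OF _ v0(1)] mult_neg_pos[OF coef[OF v0(1)]]) simp
    qed
    finally show ?thesis by simp
  qed
  obtain k :: nat where k: "- tr D1 / tr D0 < real k" using reals_Archimedean2 by blast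
  define D where "D = real k *\<^sub>R D0 + D1"
  have "- tr D1 < real k * tr D0" using k trD0 by (simp only: pos_divide_less_eq)
  then have trD: "tr D > 0" by (simp add: D_def linear_add[OF lin_tr] linear_scale[OF lin_tr])
  have lD: "l D q < 0" if "q \<noteq> 0" for q
    using lD1[OF that] mult_nonneg_nonpos[OF of_nat_0_le_iff lD0[of q], of k]
    by (simp add: D_def linear_add[OF lin_l] linear_scale[OF lin_l])
  have "repeatable A B D"
    unfolding D_def using repeatable_add[OF repeatable_multiple[OF \<tau>0(2)] repD1] by (simp add: D0_def)
  then obtain E where E: "\<And>N::nat. steers A B 0 0 (real N *\<^sub>R D + E)" unfolding repeatable_def by blast
  obtain N0 where N0: "\<And>N q. N \<ge> N0 \<Longrightarrow> real N * l D q + l E q \<le> 0"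
    using neg_def_dominates[of "L D" "L E"] lD unfolding l_def by blast
  obtain N1 :: nat where N1: "- tr E / tr D < real N1" using reals_Archimedean2 by blast
  define N where "N = max N0 N1"
  obtain u x where ux: "L2_trajectory A B u x" "L2_trajectory.H u x = real N *\<^sub>R D + E"
    using steers_zero_extends[OF E[of N]] by blast
  have "tr (real N *\<^sub>R D + E) \<le> 0"
    unfolding tr_def ux(2)[symmetric]
  proof (rule td[OF ux(1)])
    fix q
    show "Re (quad_form (shifted_dynamics A B w1 ** L2_trajectory.H u x ** conj_transpose (shifted_dynamics A B w2)) q) \<le> 0"
      using N0[of N q] linear_add[OF lin_l[of q], of "real N *\<^sub>R D" E] linear_scale[OF lin_l[of q], of "real N" D]
      unfolding ux(2) by (simp add: N_def l_def L_def)
  qed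
  moreover have "real N1 * tr D \<le> real N * tr D" using trD by (intro mult_right_mono) (auto simp: N_def)
  moreover have "- tr E < real N1 * tr D" using N1 trD by (simp only: pos_divide_less_eq)
  ultimately show False by (simp add: linear_add[OF lin_tr] linear_scale[OF lin_tr])
qed

section \<open>Equivalence of the two inequalities\<close>

theorem theorem4:
  fixes A :: "complex^'n^'n" and B :: "complex^'m^'n"
    and P :: "complex^('n + 'm)^('n + 'm)"
    and w1 w2 :: real
  assumes "controllable A B"
    and "hermitian P"
    and "interior (freq_set w1 w2) \<noteq> {}"
  shows
    "(\<forall>w\<in>freq_set w1 w2. det (mat (\<i> * of_real w) - A) \<noteq> 0 \<longrightarrow>
        neg_semidef (conj_transpose (freq_response A B w) ** P ** freq_response A B w))
     \<longleftrightarrow>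
     (\<forall>u x. solution_on {0..} A B u x \<and> L2_on {0..} u \<and> x 0 = 0 \<and> L2_on {0..} x
        \<and> neg_semidef (He (LINT t|lebesgue_on {0..}.
              outer (shifted_deriv w1 x t) (shifted_deriv w2 x t)))
        \<longrightarrow> Re (LINT t|lebesgue_on {0..}. quad_form P (stack (x t) (u t))) \<le> 0)"
proof -
  define a b where "a = min w1 w2" and "b = max w1 w2"
  have S: "freq_set w1 w2 = {a..b}" by (simp add: freq_set_eq_interval a_def b_def)
  have ab: "a < b" using assms(3) by (auto simp: S interior_atLeastAtMost_real)
  have time: "(solution_on {0..} A B u x \<and> L2_on {0..} u \<and> x 0 = 0 \<and> L2_on {0..} x
        \<and> neg_semidef (He (LINT t|lebesgue_on {0..}. outer (shifted_deriv w1 x t) (shifted_deriv w2 x t)))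
        \<longrightarrow> Re (LINT t|lebesgue_on {0..}. quad_form P (stack (x t) (u t))) \<le> 0)
    \<longleftrightarrow> (L2_trajectory A B u x \<longrightarrow>
        (\<forall>q. Re (quad_form (shifted_dynamics A B a ** L2_trajectory.H u x ** conj_transpose (shifted_dynamics A B b)) q) \<le> 0)
        \<longrightarrow> Re (trace (P ** L2_trajectory.H u x)) \<le> 0)" for u x
  proof (cases "L2_trajectory A B u x")
    case True
    then interpret L2_trajectory A B u x .
    have "hermitian H" using pos_semidef_gram[OF L2_eta] by (simp add: H_def pos_semidef_def)
    from quad_form_sandwich_commute[OF this]
    have "Re (quad_form (shifted_dynamics A B w1 ** H ** conj_transpose (shifted_dynamics A B w2)) q)
        = Re (quad_form (shifted_dynamics A B a ** H ** conj_transpose (shifted_dynamics A B b)) q)" for q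
      by (cases "w1 \<le> w2") (simp_all add: a_def b_def)
    then have "neg_semidef (He (LINT t|lebesgue_on {0..}. outer (shifted_deriv w1 x t) (shifted_deriv w2 x t)))
        \<longleftrightarrow> (\<forall>q. Re (quad_form (shifted_dynamics A B a ** H ** conj_transpose (shifted_dynamics A B b)) q) \<le> 0)"
      by (simp add: integral_shifted_deriv neg_semidef_He_iff shifted_dynamics_def)
    then show ?thesis using True sol L2u x0 L2x by (simp add: integral_quad_form)
  next
    case False
    then show ?thesis by (auto simp: L2_trajectory_def)
  qed
  have "(\<forall>w\<in>freq_set w1 w2. \<forall>\<eta>. harmonic A B w \<eta> \<longrightarrow> Re (quad_form P \<eta>) \<le> 0) \<longleftrightarrow>
    (\<forall>u x. L2_trajectory A B u x \<longrightarrow>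
        (\<forall>q. Re (quad_form (shifted_dynamics A B a ** L2_trajectory.H u x ** conj_transpose (shifted_dynamics A B b)) q) \<le> 0)
        \<longrightarrow> Re (trace (P ** L2_trajectory.H u x)) \<le> 0)" (is "?F \<longleftrightarrow> ?T")
  proof
    assume F: ?F
    show ?T
    proof (intro allI impI)
      fix u x
      assume "L2_trajectory A B u x"
      then interpret L2_trajectory A B u x .
      assume "\<forall>q. Re (quad_form (shifted_dynamics A B a ** H ** conj_transpose (shifted_dynamics A B b)) q) \<le> 0"
      then show "Re (trace (P ** H)) \<le> 0"
        using trace_nonpos_if_harmonic_nonpos[OF _ less_imp_le[OF ab] _ lyapunov_balance, of P]
          F pos_semidef_gram[OF L2_eta] by (simp add: S H_def)
    qed
  next
    assume T: ?T
    show ?F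
    proof (intro ballI allI impI)
      fix w \<eta> assume "w \<in> freq_set w1 w2" "harmonic A B w \<eta>"
      then show "Re (quad_form P \<eta>) \<le> 0"
        using harmonic_nonpos_if_trajectories_nonpos[OF assms(1) ab, of P w \<eta>] T by (auto simp: S)
    qed
  qed
  then show ?thesis
    unfolding frequency_inequality_iff_harmonic[OF assms] time .
qed

end
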